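(* Let $\pi\colon S^3\to S^2$ be a real analytic conformal submersion (with respect to the conformal structures of the round metrics), and let $\Psi\colon S^3\to SS^3\cong Q\subset\mathbb{CP}^3$ be its oriented fiber tangent map, which assigns to each $p\in S^3$ the oriented tangent line $[T_p]$ at $p$ of the fiber of $\pi$ through $p$. Then there is a (not necessarily closed) complex surface $A\subset\mathbb{CP}^3$ such that $$\Psi(S^3)=A\cap Q .$$
   Context: A submersion $\pi\colon (P,g)\to(M,h)$ of Riemannian manifolds is conformal if for each $p\in P$ the restriction $d_p\pi\colon(\ker d_p\pi)^\perp\to T_{\pi(p)}M$ is a conformal linear map; this depends only on the conformal classes. Identification $SS^3\cong Q$. The tangent sphere bundle $SS^3$ is the bundle of oriented tangent lines of $S^3$; its elements are classes $[v]$ of nonzero tangent vectors modulo positive multiples. Let $\mathbb H$ be the quaternions, regard $\mathbb H^2$ as a right $\mathbb H$-vector space, and identify $\mathbb H^2\cong\mathbb C^4$ via right multiplication by $i$, i.e. $(z_1+jz_2,\,z_3+jz_4)\leftrightarrow(z_1,z_2,z_3,z_4)$. The twistor projection is $\mathbb{CP}^3\to\mathbb{HP}^1\cong S^4$, $e\mapsto e\mathbb H=e\oplus ej$. The unit sphere $S^3\subset\mathbb H$ is embedded in $\mathbb{HP}^1$ by $x\mapsto[x:1]$; it is the set of isotropic quaternionic lines of $\langle v,w\rangle=\bar v_1w_1-\bar v_2w_2$. The real quadric $Q\subset\mathbb{CP}^3$ is the preimage of $S^3$ under the twistor projection: $$Q=\{[z]\in\mathbb{CP}^3 : |z_1|^2+|z_2|^2-|z_3|^2-|z_4|^2=0\}.$$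 An oriented tangent line $[x\mu]$ at $x\in S^3$, with $\mu\in\operatorname{Im}\mathbb H$, $|\mu|=1$, is identified with the point $e=\{(x,1)\lambda : \lambda\in\mathbb H,\ \mu\lambda=\lambda i\}\in Q$. Orientation of the fibers. With orientations of $S^3$ and $S^2$ fixed, a nonzero vector $T$ tangent to a fiber is positive if $T\wedge A\wedge B>0$ for all $A,B\perp T$ with $\pi_*A\wedge\pi_*B>0$. "Not necessarily closed" means that $A$ is a 2-dimensional complex submanifold of $\mathbb{CP}^3$ that need not be a closed subset. *)

theory Defs
  imports "HOL-Analysis.Analysis"
begin

section \<open>Quaternions\<close>

text \<open>The pair \<open>(a, b)\<close> stands for the quaternion \<open>a + j b\<close>. The norm and the inner product of
  the product type are the Euclidean ones of \<open>\<H> = \<real>\<^sup>4\<close>. The product follows from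
  \<open>a j = j (cnj a)\<close> and \<open>j\<^sup>2 = -1\<close>.\<close>

type_synonym quat = "complex \<times> complex"

definition qmult :: "quat \<Rightarrow> quat \<Rightarrow> quat" (infixl "\<otimes>\<^sub>q" 70) where
  "p \<otimes>\<^sub>q q = (fst p * fst q - cnj (snd p) * snd q, snd p * fst q + cnj (fst p) * snd q)"

definition quat_i :: quat where
  "quat_i = (\<i>, 0)"

definition ImH :: "quat set" where
  "ImH = {q. Re (fst q) = 0}"

text \<open>Coordinates with respect to \<open>1, i, j, k\<close>; the last sign comes from \<open>j i = - k\<close>.\<close>

definition quat_coords :: "quat \<Rightarrow> real^4" where
  "quat_coords q = vector [Re (fst q), Im (fst q), Re (snd q), - Im (snd q)]"

abbreviation S3 :: "quat set" where
  "S3 \<equiv> sphere 0 1"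

abbreviation S2 :: "(real^3) set" where
  "S2 \<equiv> sphere 0 1"


section \<open>Real analytic maps\<close>

text \<open>The power series is indexed by the multi-indices \<open>\<alpha> : Basis \<Rightarrow> \<nat>\<close>, and it converges
  unconditionally (hence absolutely) on a ball.\<close>

definition real_analytic_at :: "('a::euclidean_space \<Rightarrow> 'b::euclidean_space) \<Rightarrow> 'a \<Rightarrow> bool" where
  "real_analytic_at F p \<longleftrightarrow>
     (\<exists>c :: ('a \<Rightarrow> nat) \<Rightarrow> 'b. \<exists>r>0. \<forall>x\<in>ball p r.
        ((\<lambda>\<alpha>. (\<Prod>b\<in>Basis. ((x - p) \<bullet> b) ^ \<alpha> b) *\<^sub>R c \<alpha>) has_sum F x) (Basis \<rightarrow>\<^sub>E UNIV))"

text \<open>Analyticity on an analytic submanifold such as a sphere: local analytic extendability to the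
  ambient space.\<close>

definition real_analytic_on :: "('a::euclidean_space \<Rightarrow> 'b::euclidean_space) \<Rightarrow> 'a set \<Rightarrow> bool" where
  "real_analytic_on f S \<longleftrightarrow>
     (\<forall>p\<in>S. \<exists>F. \<exists>e>0. real_analytic_at F p \<and> (\<forall>x\<in>S \<inter> ball p e. F x = f x))"


section \<open>Conformal submersions between unit spheres\<close>

definition sphere_tangent :: "'a::euclidean_space \<Rightarrow> 'a set" where
  "sphere_tangent p = {v. v \<bullet> p = 0}"

text \<open>Only the values on \<^term>\<open>sphere_tangent p\<close> are meaningful: there the derivative within the
  sphere is unique, whereas in the normal direction it is an arbitrary choice.\<close>

definition sphere_diff ::
    "('a::euclidean_space \<Rightarrow> 'b::euclidean_space) \<Rightarrow> 'a \<Rightarrow> 'a \<Rightarrow> 'b" where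
  "sphere_diff f p = frechet_derivative f (at p within sphere 0 1)"

definition vertical :: "('a::euclidean_space \<Rightarrow> 'b::euclidean_space) \<Rightarrow> 'a \<Rightarrow> 'a set" where
  "vertical f p = {v \<in> sphere_tangent p. sphere_diff f p v = 0}"

definition horizontal :: "('a::euclidean_space \<Rightarrow> 'b::euclidean_space) \<Rightarrow> 'a \<Rightarrow> 'a set" where
  "horizontal f p = {v \<in> sphere_tangent p. \<forall>u\<in>vertical f p. v \<bullet> u = 0}"

definition conformal_on :: "('a::euclidean_space \<Rightarrow> 'b::euclidean_space) \<Rightarrow> 'a set \<Rightarrow> bool" where
  "conformal_on L V \<longleftrightarrow> (\<exists>c>0. \<forall>v\<in>V. \<forall>w\<in>V. L v \<bullet> L w = c * (v \<bullet> w))"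

definition conformal_submersion :: "('a::euclidean_space \<Rightarrow> 'b::euclidean_space) \<Rightarrow> bool" where
  "conformal_submersion f \<longleftrightarrow>
     f \<in> sphere 0 1 \<rightarrow> sphere 0 1 \<and>
     (\<forall>p\<in>sphere 0 1.
        f differentiable (at p within sphere 0 1) \<and>
        sphere_diff f p ` sphere_tangent p = sphere_tangent (f p) \<and>
        conformal_on (sphere_diff f p) (horizontal f p))"


section \<open>The oriented fiber tangent map\<close>

text \<open>The orientation of each sphere is given by a sign: \<open>1\<close> is the boundary orientation of the
  unit ball (outer normal first), \<open>-1\<close> the opposite one. The values of \<open>vol3\<close> and \<open>vol2\<close> are the
  signed volumes of \<open>T \<and> A \<and> B\<close> and \<open>u \<and> v\<close>.\<close>

definition vol3 :: "real \<Rightarrow> quat \<Rightarrow> quat \<Rightarrow> quat \<Rightarrow> quat \<Rightarrow> real" where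
  "vol3 o3 p T A B =
     o3 * det (vector [quat_coords p, quat_coords T, quat_coords A, quat_coords B] :: real^4^4)"

definition vol2 :: "real \<Rightarrow> real^3 \<Rightarrow> real^3 \<Rightarrow> real^3 \<Rightarrow> real" where
  "vol2 o2 x u v = o2 * det (vector [x, u, v] :: real^3^3)"

definition positive_fiber_tangent ::
    "real \<Rightarrow> real \<Rightarrow> (quat \<Rightarrow> real^3) \<Rightarrow> quat \<Rightarrow> quat \<Rightarrow> bool" where
  "positive_fiber_tangent o3 o2 f p T \<longleftrightarrow>
     T \<in> vertical f p \<and> T \<noteq> 0 \<and>
     (\<forall>A\<in>sphere_tangent p. \<forall>B\<in>sphere_tangent p.
        A \<bullet> T = 0 \<longrightarrow> B \<bullet> T = 0 \<longrightarrow>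
        vol2 o2 (f p) (sphere_diff f p A) (sphere_diff f p B) > 0 \<longrightarrow> vol3 o3 p T A B > 0)"

text \<open>An oriented tangent line of \<open>S\<^sup>3\<close> is a pair of the base point and the class \<open>[v]\<close> of a nonzero
  tangent vector, an open ray. As fibers are one-dimensional, the positive fiber tangent vectors at
  \<open>p\<close> form precisely one such class.\<close>

definition fiber_tangent_map ::
    "real \<Rightarrow> real \<Rightarrow> (quat \<Rightarrow> real^3) \<Rightarrow> quat \<Rightarrow> quat \<times> quat set" where
  "fiber_tangent_map o3 o2 f p = (p, {T. positive_fiber_tangent o3 o2 f p T})"


section \<open>Complex projective space and the real quadric\<close>

text \<open>Points are the one-dimensional complex linear subspaces of \<open>\<complex>\<^sup>4\<close>.\<close>

definition CP3 :: "(complex^4) set set" where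
  "CP3 = {e. vec.subspace e \<and> vec.dim e = 1}"

definition real_quadric :: "(complex^4) set set" where
  "real_quadric = {vec.span {z} | z. z \<noteq> 0 \<and>
     (cmod (z$1))\<^sup>2 + (cmod (z$2))\<^sup>2 - (cmod (z$3))\<^sup>2 - (cmod (z$4))\<^sup>2 = 0}"

text \<open>\<open>(z\<^sub>1 + j z\<^sub>2, z\<^sub>3 + j z\<^sub>4) \<mapsto> (z\<^sub>1, z\<^sub>2, z\<^sub>3, z\<^sub>4)\<close>\<close>

definition H2_to_C4 :: "quat \<times> quat \<Rightarrow> complex^4" where
  "H2_to_C4 v = vector [fst (fst v), snd (fst v), fst (snd v), snd (snd v)]"

text \<open>The oriented line \<open>[x \<mu>]\<close> at \<open>x\<close> goes to \<open>{(x, 1) q | \<mu> q = q i}\<close>, where \<open>\<mu>\<close> is determined by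
  \<open>x \<mu>\<close> being the unit vector in the ray \<open>l\<close>.\<close>

definition SS3_to_Q :: "quat \<times> quat set \<Rightarrow> (complex^4) set" where
  "SS3_to_Q = (\<lambda>(x, l). {H2_to_C4 (x \<otimes>\<^sub>q q, q) | q \<mu>.
     \<mu> \<in> ImH \<and> norm \<mu> = 1 \<and> x \<otimes>\<^sub>q \<mu> \<in> l \<and> \<mu> \<otimes>\<^sub>q q = q \<otimes>\<^sub>q quat_i})"

definition Psi :: "real \<Rightarrow> real \<Rightarrow> (quat \<Rightarrow> real^3) \<Rightarrow> quat \<Rightarrow> (complex^4) set" where
  "Psi o3 o2 f p = SS3_to_Q (fiber_tangent_map o3 o2 f p)"


section \<open>Complex submanifolds\<close>

definition holomorphic_map_on :: "(complex^'n \<Rightarrow> complex^'m) \<Rightarrow> (complex^'n) set \<Rightarrow> bool" where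
  "holomorphic_map_on f U \<longleftrightarrow>
     (\<forall>x\<in>U. \<exists>D. (f has_derivative D) (at x) \<and> (\<forall>c v. D (c *s v) = c *s D v))"

definition biholomorphism ::
    "(complex^'n) set \<Rightarrow> (complex^'n) set \<Rightarrow> (complex^'n \<Rightarrow> complex^'n) \<Rightarrow> bool" where
  "biholomorphism U V \<phi> \<longleftrightarrow>
     open U \<and> open V \<and> bij_betw \<phi> U V \<and>
     holomorphic_map_on \<phi> U \<and> holomorphic_map_on (inv_into U \<phi>) V"

text \<open>Embedded complex submanifolds of \<open>\<complex>\<^sup>n\<close> of dimension \<open>d\<close>, not necessarily closed.\<close>

definition complex_submanifold :: "nat \<Rightarrow> (complex^'n) set \<Rightarrow> bool" where
  "complex_submanifold d S \<longleftrightarrow>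
     (\<forall>a\<in>S. \<exists>U V \<phi> L. a \<in> U \<and> biholomorphism U V \<phi> \<and>
        vec.subspace L \<and> vec.dim L = d \<and> \<phi> ` (S \<inter> U) = V \<inter> L)"

text \<open>The (inverses of the) four standard holomorphic charts of \<open>\<complex>P\<^sup>3\<close>, lifted to \<open>\<complex>\<^sup>4\<close>. Their domains
  cover \<open>\<complex>P\<^sup>3\<close>, so being a submanifold can be tested in them.\<close>

definition affine_lifts :: "(complex^3 \<Rightarrow> complex^4) set" where
  "affine_lifts =
     {\<lambda>w. vector [1, w$1, w$2, w$3],
      \<lambda>w. vector [w$1, 1, w$2, w$3],
      \<lambda>w. vector [w$1, w$2, 1, w$3],
      \<lambda>w. vector [w$1, w$2, w$3, 1]}"

definition complex_surface_CP3 :: "(complex^4) set set \<Rightarrow> bool" where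
  "complex_surface_CP3 A \<longleftrightarrow>
     A \<subseteq> CP3 \<and> (\<forall>\<sigma>\<in>affine_lifts. complex_submanifold 2 {w. vec.span {\<sigma> w} \<in> A})"

end

theory Submission
  imports Defs "HOL-Complex_Analysis.Conformal_Mappings"
begin

text \<open>This is Kerr's theorem. Compose \<open>\<pi>\<close>, extended to be constant along rays, with a stereographic
  projection whose orientation is chosen according to those of \<open>S\<^sup>3\<close> and \<open>S\<^sup>2\<close>. Conformality says
  that the complex gradient \<open>W\<close> of the resulting function is null. Analyticity extends the function, and
  with it \<open>W \<bullet> W = 0\<close>, to a neighbourhood of \<open>S\<^sup>3\<close> in \<open>\<H> \<otimes> \<complex> = M\<^sub>2(\<complex>)\<close>; differentiating and using the
  symmetry of second derivatives, \<open>W\<close> is parallel along itself, so it is constant on the null lines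
  \<open>{X. X \<lambda> = \<eta>, det X = 1}\<close> with \<open>W \<lambda> = 0\<close>. A point \<open>[\<eta> : \<lambda>]\<close> of \<open>\<complex>P\<^sup>3\<close> is such a null line, and the
  surface consists of those near \<open>S\<^sup>3\<close> on which \<open>W \<lambda> = 0\<close>. The points of the quadric are the
  lines that meet \<open>S\<^sup>3\<close>, say in \<open>x\<close>, and there \<open>W \<lambda> = 0\<close> singles out the oriented fiber tangent at \<open>x\<close>.\<close>

section \<open>Holomorphic functions of several variables\<close>

text \<open>Write \<eta> = (z1, z2) and \<lambda> = (z3, z4). Two solutions of X \<lambda> = \<eta>
  with determinant 1 differ by a matrix that kills \<lambda> and is orthogonal to X, and these
  conditions leave one direction: a rank-one matrix built from \<eta> and \<lambda>. The gradient W
  satisfies the same two conditions: W \<lambda> = 0 by the choice of the line, and W is orthogonal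
  to X because the chart is constant along rays. So W points along the line, which is why being
  parallel along itself makes it constant there. Nothing global is available: a stereographic chart
  misses a pole, and its extension lives on a small ball. Hence the surface is pieced together from
  balls around the points of S^3, which is why it need not be closed. Overlapping charts have
  proportional gradients and only the kernel of W is used, so the pieces fit. Membership is tested
  at one canonical point of each null line. Orientations enter because conjugating W at a point of
  S^3 replaces its kernel by that of the opposite tangent; the chart sign \<open>o2 * o3\<close>
  selects the right one.\<close>

definition cdot :: "complex^'n \<Rightarrow> complex^'n \<Rightarrow> complex" where
  "cdot g v = (\<Sum>i\<in>UNIV. g$i * v$i)"

lemma cdot_smult [simp]: "cdot g (c *s v) = c * cdot g v" "cdot (c *s g) v = c * cdot g v"
  by (simp_all add: cdot_def sum_distrib_left algebra_simps)

lemma cdot_add: "cdot g (u + v) = cdot g u + cdot g v" "cdot (g + h) v = cdot g v + cdot h v"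
  by (simp_all add: cdot_def sum.distrib algebra_simps)

lemma cdot_diff: "cdot g (u - v) = cdot g u - cdot g v" "cdot (g - h) v = cdot g v - cdot h v"
  by (simp_all add: cdot_def sum_subtractf algebra_simps)

lemma cdot_0 [simp]: "cdot g 0 = 0" "cdot 0 v = 0"
  by (simp_all add: cdot_def)

lemma cdot_commute: "cdot g v = cdot v g"
  by (simp add: cdot_def mult.commute)

lemma cdot_axis [simp]: "cdot g (axis i t) = g$i * t" "cdot (axis i t) g = t * g$i"
  by (simp_all add: cdot_def axis_def if_distrib if_distribR cong: if_cong)

lemma norm_smult_vec: "norm (t *s (v :: complex^'n)) = norm t * norm v"
  by (simp add: norm_vec_def norm_mult L2_set_right_distrib)

lemma norm_axis_complex: "norm (axis i t :: complex^'n) = norm t"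
proof -
  have "axis i t = t *s (axis i 1 :: complex^'n)" by (simp add: vec_eq_iff axis_def)
  then show ?thesis by (simp add: norm_smult_vec)
qed

lemma bounded_linear_axis: "bounded_linear (axis i :: complex \<Rightarrow> complex^'n)"
proof (rule bounded_linear_intro[where K = 1])
  show "axis i (x + y) = (axis i x + axis i y :: complex^'n)" for x y
    by (simp add: axis_def vec_eq_iff)
  show "axis i (r *\<^sub>R x) = (r *\<^sub>R axis i x :: complex^'n)" for r x
    by (simp add: axis_def vec_eq_iff)
  show "norm (axis i x :: complex^'n) \<le> norm x * 1" for x
    by (simp add: norm_axis_complex)
qed

lemma bounded_linear_smult_left: "bounded_linear (\<lambda>t. t *s (v :: complex^'n))"
proof -
  have "(\<lambda>t. t *s v) = (\<lambda>t. \<Sum>i\<in>UNIV. axis i (t * v$i))"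
    by (auto simp: vec_eq_iff axis_def if_distrib if_distribR cong: if_cong)
  moreover have "bounded_linear (\<lambda>t. \<Sum>i\<in>UNIV. (axis i (t * v$i) :: complex^'n))"
    by (intro bounded_linear_sum bounded_linear_compose[OF bounded_linear_axis] bounded_linear_mult_left)
  ultimately show ?thesis by simp
qed

text \<open>As \<open>cdot\<close> is bilinear rather than Hermitian, a derivative of the form
  \<open>cdot g\<close> is exactly a complex linear one.\<close>

definition holo :: "(complex^'n \<Rightarrow> complex) \<Rightarrow> (complex^'n) set \<Rightarrow> bool" where
  "holo f U \<longleftrightarrow> open U \<and> (\<forall>z\<in>U. \<exists>g. (f has_derivative cdot g) (at z))"

text \<open>One-variable derivatives along the axes make this total, and Cauchy's formula applies to
  each entry directly.\<close>

definition cgrad :: "(complex^'n \<Rightarrow> complex) \<Rightarrow> complex^'n \<Rightarrow> complex^'n" where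
  "cgrad f z = (\<chi> i. deriv (\<lambda>t. f (z + axis i t)) 0)"

lemma has_field_derivative_line:
  assumes "(f has_derivative cdot g) (at (z + t *s v))"
  shows "((\<lambda>t. f (z + t *s v)) has_field_derivative cdot g v) (at t)"
proof -
  have "((\<lambda>t. z + t *s v) has_derivative (\<lambda>h. h *s v)) (at t)"
    by (auto intro!: derivative_eq_intros bounded_linear.has_derivative[OF bounded_linear_smult_left])
  from has_derivative_compose[OF this assms]
  show ?thesis
    by (simp add: has_field_derivative_def mult.commute mult_commute_abs)
qed

lemma axis_smult: "t *s (axis i 1 :: complex^'n) = axis i t"
  by (simp add: vec_eq_iff axis_def)

lemma axis_zero [simp]: "axis i (0 :: complex) = 0"
  by (simp add: vec_eq_iff axis_def)

lemma cgrad_eqI: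
  assumes "(f has_derivative cdot g) (at z)"
  shows "cgrad f z = g"
proof -
  have "deriv (\<lambda>t. f (z + axis i t)) 0 = g$i" for i
    using has_field_derivative_line[of f g z 0 "axis i 1"] assms
    by (intro DERIV_imp_deriv) (simp add: axis_smult)
  then show ?thesis by (simp add: cgrad_def vec_eq_iff)
qed

lemma holo_derivative:
  assumes "holo f U" "z \<in> U"
  shows "(f has_derivative cdot (cgrad f z)) (at z)"
  using assms cgrad_eqI unfolding holo_def by metis

lemma holoI:
  assumes "open U" "\<And>z. z \<in> U \<Longrightarrow> (f has_derivative cdot (g z)) (at z)"
  shows "holo f U"
  using assms unfolding holo_def by blast

lemma holo_open: "holo f U \<Longrightarrow> open U"
  by (simp add: holo_def)

lemma holo_subset: "holo f U \<Longrightarrow> open V \<Longrightarrow> V \<subseteq> U \<Longrightarrow> holo f V"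
  unfolding holo_def by blast

lemma holo_continuous: "holo f U \<Longrightarrow> continuous_on U f"
  by (meson continuous_at_imp_continuous_on has_derivative_continuous holo_derivative)

lemma holo_const:
  fixes U :: "(complex^'n) set"
  shows "open U \<Longrightarrow> holo (\<lambda>z. c) U"
proof (rule holoI[where g = "\<lambda>_. 0"])
  fix z :: "complex^'n"
  have "cdot (0 :: complex^'n) = (\<lambda>v. 0)" by (simp add: fun_eq_iff)
  then show "((\<lambda>z. c) has_derivative cdot 0) (at z)"
    by (metis has_derivative_const)
qed

lemma holo_nth:
  fixes U :: "(complex^'n) set"
  shows "open U \<Longrightarrow> holo (\<lambda>z. z $ i) U"
proof (rule holoI[where g = "\<lambda>_. axis i 1"])
  fix z :: "complex^'n"
  have "cdot (axis i 1 :: complex^'n) = (\<lambda>v. v $ i)" by (simp add: fun_eq_iff)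
  then show "((\<lambda>z. z $ i) has_derivative cdot (axis i 1)) (at z)"
    by (simp add: bounded_linear_imp_has_derivative bounded_linear_vec_nth)
qed

lemma holo_add: "holo f U \<Longrightarrow> holo g U \<Longrightarrow> holo (\<lambda>z. f z + g z) U"
proof (rule holoI[where g = "\<lambda>z. cgrad f z + cgrad g z"])
  fix z assume "holo f U" "holo g U" "z \<in> U"
  from has_derivative_add[OF this(1,2)[THEN holo_derivative, OF this(3) ]]
  show "((\<lambda>z. f z + g z) has_derivative cdot (cgrad f z + cgrad g z)) (at z)"
    by (simp add: cdot_add[abs_def])
qed (rule holo_open)

lemma holo_uminus: "holo f U \<Longrightarrow> holo (\<lambda>z. - f z) U"
proof (rule holoI[where g = "\<lambda>z. - cgrad f z"])
  fix z assume "holo f U" "z \<in> U"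
  from has_derivative_minus[OF holo_derivative[OF this]]
  show "((\<lambda>z. - f z) has_derivative cdot (- cgrad f z)) (at z)"
    by (simp add: cdot_def[abs_def] sum_negf)
qed (rule holo_open)

lemma holo_diff: "holo f U \<Longrightarrow> holo g U \<Longrightarrow> holo (\<lambda>z. f z - g z) U"
  using holo_add[OF _ holo_uminus, of f U g] by simp

lemma holo_mult: "holo f U \<Longrightarrow> holo g U \<Longrightarrow> holo (\<lambda>z. f z * g z) U"
proof (rule holoI[where g = "\<lambda>z. f z *s cgrad g z + g z *s cgrad f z"])
  fix z assume "holo f U" "holo g U" "z \<in> U"
  from has_derivative_mult[OF this(1,2)[THEN holo_derivative, OF this(3)]]
  show "((\<lambda>z. f z * g z) has_derivative cdot (f z *s cgrad g z + g z *s cgrad f z)) (at z)"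
    by (simp add: cdot_add[abs_def] mult.commute)
qed (rule holo_open)

lemma holo_sum: "open U \<Longrightarrow> (\<And>i. i \<in> I \<Longrightarrow> holo (f i) U) \<Longrightarrow> holo (\<lambda>z. \<Sum>i\<in>I. f i z) U"
  by (induction I rule: infinite_finite_induct) (simp_all add: holo_const holo_add)

lemma holo_compose_vec:
  fixes \<Phi> :: "complex^'n \<Rightarrow> complex^'m"
  assumes "\<And>i. holo (\<lambda>z. \<Phi> z $ i) U" "holo f V" "\<Phi> ` U \<subseteq> V"
  shows "holo (\<lambda>z. f (\<Phi> z)) U"
proof (rule holoI[where g = "\<lambda>z. \<Sum>i\<in>UNIV. cgrad f (\<Phi> z) $ i *s cgrad (\<lambda>z. \<Phi> z $ i) z"])
  show "open U" using assms(1) holo_open by blast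
next
  fix z assume z: "z \<in> U"
  have "(\<Phi> has_derivative (\<lambda>v. \<chi> i. cdot (cgrad (\<lambda>z. \<Phi> z $ i) z) v)) (at z)"
  proof (subst has_derivative_componentwise_within, rule ballI)
    fix b :: "complex^'m" assume "b \<in> Basis"
    then obtain i c where b: "b = axis i c" by (auto simp: Basis_vec_def)
    show "((\<lambda>x. \<Phi> x \<bullet> b) has_derivative
        (\<lambda>x. (\<chi> i. cdot (cgrad (\<lambda>z. \<Phi> z $ i) z) x) \<bullet> b)) (at z)"
      unfolding b inner_axis
      using has_derivative_inner_left[OF holo_derivative[OF assms(1) z], of i c] by simp
  qed
  moreover have "(f has_derivative cdot (cgrad f (\<Phi> z))) (at (\<Phi> z))"
    using assms(2,3) z by (intro holo_derivative) auto
  ultimately have "((\<lambda>z. f (\<Phi> z)) has_derivative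
      (\<lambda>v. cdot (cgrad f (\<Phi> z)) (\<chi> i. cdot (cgrad (\<lambda>z. \<Phi> z $ i) z) v))) (at z)"
    by (rule has_derivative_compose)
  moreover have "cdot (cgrad f (\<Phi> z)) (\<chi> i. cdot (cgrad (\<lambda>z. \<Phi> z $ i) z) v)
      = cdot (\<Sum>i\<in>UNIV. cgrad f (\<Phi> z) $ i *s cgrad (\<lambda>z. \<Phi> z $ i) z) v" for v
    by (simp add: cdot_def sum_distrib_left sum_distrib_right)
       (subst sum.swap, simp add: mult.assoc)
  ultimately show "((\<lambda>z. f (\<Phi> z)) has_derivative
      cdot (\<Sum>i\<in>UNIV. cgrad f (\<Phi> z) $ i *s cgrad (\<lambda>z. \<Phi> z $ i) z)) (at z)"
    by (simp add: fun_eq_iff[symmetric])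
qed

lemma holo_compose1:
  assumes "holo f U" "\<And>z. z \<in> U \<Longrightarrow> \<phi> field_differentiable at (f z)"
  shows "holo (\<lambda>z. \<phi> (f z)) U"
proof (rule holoI[where g = "\<lambda>z. deriv \<phi> (f z) *s cgrad f z"])
  show "open U" using assms holo_open by blast
  fix z assume z: "z \<in> U"
  have "(\<phi> has_derivative (*) (deriv \<phi> (f z))) (at (f z))"
    using assms(2)[OF z] by (simp add: field_differentiable_derivI has_field_derivative_imp_has_derivative)
  from has_derivative_compose[OF holo_derivative[OF assms(1) z] this]
  show "((\<lambda>z. \<phi> (f z)) has_derivative cdot (deriv \<phi> (f z) *s cgrad f z)) (at z)"
    by (simp add: cdot_smult(2)[abs_def])
qed

lemma holo_inverse: "holo f U \<Longrightarrow> (\<And>z. z \<in> U \<Longrightarrow> f z \<noteq> 0) \<Longrightarrow> holo (\<lambda>z. inverse (f z)) U"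
  by (rule holo_compose1) (auto intro: derivative_intros)

lemma holo_divide:
  "holo f U \<Longrightarrow> holo g U \<Longrightarrow> (\<And>z. z \<in> U \<Longrightarrow> g z \<noteq> 0) \<Longrightarrow> holo (\<lambda>z. f z / g z) U"
  using holo_mult[OF _ holo_inverse, of f U g] by (simp add: divide_inverse)

section \<open>Restriction to complex lines and Cauchy's integral formula\<close>

lemma holo_line:
  assumes "holo f U"
  shows "(\<lambda>t. f (z + t *s v)) holomorphic_on {t. z + t *s v \<in> U}"
proof (rule holomorphic_onI)
  fix t assume "t \<in> {t. z + t *s v \<in> U}"
  then have "((\<lambda>t. f (z + t *s v)) has_field_derivative cdot (cgrad f (z + t *s v)) v) (at t)"
    by (intro has_field_derivative_line holo_derivative[OF assms]) simp
  then show "(\<lambda>t. f (z + t *s v)) field_differentiable at t within {t. z + t *s v \<in> U}"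
    using field_differentiable_at_within field_differentiable_def by blast
qed

lemma open_line: "open U \<Longrightarrow> open {t. z + t *s (v :: complex^'n) \<in> U}"
  using continuous_open_preimage[of UNIV "\<lambda>t. z + t *s v" U]
  by (simp add: vimage_def continuous_on_add bounded_linear.continuous_on[OF bounded_linear_smult_left])

text \<open>Cauchy's formula for the first derivative, on a circle in the \<open>i\<close>-th
  coordinate line parametrised over [0, 1], where the factor 2 pi i cancels. As an integral over a
  fixed interval it can be differentiated with respect to the centre.\<close>

lemma cgrad_integral:
  assumes f: "holo f U" and r: "r > 0" "cball z r \<subseteq> U"
  shows "cgrad f z $ i = integral (cbox 0 1)
    (\<lambda>t::real. f (z + axis i (r * exp (2 * of_real pi * \<i> * t))) / (r * exp (2 * of_real pi * \<i> * t)))"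
proof -
  let ?S = "{t. z + t *s axis i 1 \<in> U}"
  have hol: "(\<lambda>t. f (z + axis i t)) holomorphic_on ?S"
    using holo_line[OF f, of z "axis i 1"] by (simp add: axis_smult)
  have sub: "cball 0 r \<subseteq> ?S"
    using r(2) by (auto simp: subset_iff dist_norm norm_smult_vec)
  have hb: "(\<lambda>t. f (z + axis i t)) holomorphic_on cball 0 r"
    using hol sub by (rule holomorphic_on_subset)
  have "contour_integral (circlepath 0 r) (\<lambda>u. f (z + axis i u) / (u - 0)^2)
      = (2 * pi * \<i>) * deriv (\<lambda>t. f (z + axis i t)) 0"
    using hb r(1) by (intro Cauchy_contour_integral_circlepath_2)
      (auto intro: holomorphic_on_imp_continuous_on holomorphic_on_subset)
  also have "deriv (\<lambda>t. f (z + axis i t)) 0 = cgrad f z $ i"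
    by (simp add: cgrad_def)
  also have "contour_integral (circlepath 0 r) (\<lambda>u. f (z + axis i u) / (u - 0)^2) =
    integral (cbox 0 1) (\<lambda>t::real. (2 * pi * \<i>) * (f (z + axis i (r * exp (2 * of_real pi * \<i> * t)))
      / (r * exp (2 * of_real pi * \<i> * t))))"
    unfolding contour_integral_integral cbox_interval using r(1)
    by (intro integral_cong, subst vector_derivative_circlepath)
       (simp add: circlepath field_simps power2_eq_square)
  finally show ?thesis unfolding integral_mult_right by simp
qed

lemma holo_cball_margin:
  assumes f: "holo f U" and z0: "z0 \<in> U"
  obtains r where "r > 0" "\<And>z. z \<in> ball z0 r \<Longrightarrow> cball z r \<subseteq> U"
proof -
  obtain e where e: "e > 0" "cball z0 e \<subseteq> U"
    using open_contains_cball[THEN iffD1, OF holo_open[OF f], rule_format, OF z0] by blast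
  have "cball z (e/2) \<subseteq> U" if "z \<in> ball z0 (e/2)" for z
  proof
    fix w assume "w \<in> cball z (e/2)"
    then have "dist z0 w \<le> e"
      using that dist_triangle[of z0 w z] by simp
    then show "w \<in> U" using e(2) by auto
  qed
  then show ?thesis using e(1) that[of "e/2"] by simp
qed

text \<open>\<open>holo\<close> asks only for pointwise derivatives; continuity of the gradient
  comes from the integral formula, whose radius can be kept fixed for all nearby centres.\<close>

lemma continuous_on_cgrad:
  assumes f: "holo f U"
  shows "continuous_on U (\<lambda>z. cgrad f z $ i)"
proof -
  have "isCont (\<lambda>z. cgrad f z $ i) z0" if z0: "z0 \<in> U" for z0
  proof -
    obtain r where r: "r > 0" and sub: "\<And>z. z \<in> ball z0 r \<Longrightarrow> cball z r \<subseteq> U"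
      using holo_cball_margin[OF f z0] by blast
    define E where "E t = r * exp (2 * of_real pi * \<i> * t)" for t :: real
    have E0: "E t \<noteq> 0" for t using r by (simp add: E_def)
    have *: "z + axis i (E t) \<in> U" if "z \<in> ball z0 r" for z t
      using sub[OF that] r by (auto simp: subset_iff dist_norm norm_axis_complex norm_mult E_def)
    have contE: "continuous_on UNIV E"
      unfolding E_def by (intro continuous_intros)
    have "continuous_on (ball z0 r) (\<lambda>z. integral (cbox 0 1) (\<lambda>t. f (z + axis i (E t)) / E t))"
    proof (rule integral_continuous_on_param, unfold split_beta)
      show "continuous_on (ball z0 r \<times> cbox 0 1) (\<lambda>p. f (fst p + axis i (E (snd p))) / E (snd p))"
        by (intro continuous_on_divide continuous_on_compose2[OF holo_continuous[OF f]]
            continuous_on_add continuous_on_fst continuous_on_id continuous_on_snd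
            continuous_on_compose2[OF contE]
            bounded_linear.continuous_on[OF bounded_linear_axis]) (use * E0 in auto)
    qed
    then have "continuous_on (ball z0 r) (\<lambda>z. cgrad f z $ i)"
      by (rule continuous_on_eq) (simp add: cgrad_integral[OF f r sub] E_def)
    then show ?thesis
      using r by (simp add: continuous_on_eq_continuous_at)
  qed
  then show ?thesis
    by (simp add: continuous_at_imp_continuous_on)
qed

text \<open>Differentiation of Cauchy's formula under the integral sign. The derivative is kept as
  an explicit integral because the symmetry of second derivatives is read off from it.\<close>

lemma cgrad_has_derivative:
  fixes f :: "complex^'n \<Rightarrow> complex"
  assumes f: "holo f U" and z0: "z0 \<in> U"
  obtains r where "r > 0" "cball z0 r \<subseteq> U"
    "((\<lambda>z. cgrad f z $ i) has_derivative cdot (\<chi> j. integral (cbox 0 1)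
      (\<lambda>t::real. cgrad f (z0 + axis i (r * exp (2 * of_real pi * \<i> * t))) $ j / (r * exp (2 * of_real pi * \<i> * t))))) (at z0)"
proof -
  obtain r where r: "r > 0" and sub: "\<And>z. z \<in> ball z0 r \<Longrightarrow> cball z r \<subseteq> U"
    using holo_cball_margin[OF f z0] by blast
  define E where "E t = r * exp (2 * of_real pi * \<i> * t)" for t :: real
  have E0: "E t \<noteq> 0" for t using r by (simp add: E_def)
  have *: "z + axis i (E t) \<in> U" if "z \<in> ball z0 r" for z t
    using sub[OF that] r by (auto simp: subset_iff dist_norm norm_axis_complex norm_mult E_def)
  \<comment> \<open>The Leibniz rule expects the partial derivative as a continuous function into
    bounded linear maps; \<open>fx\<close> is assembled from bundled coordinate functionals for this
    purpose.\<close>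
  define B where "B j = Blinfun (\<lambda>v :: complex^'n. v $ j)" for j
  have B: "blinfun_apply (B j) v = v $ j" for j v
    unfolding B_def by (simp add: bounded_linear_Blinfun_apply bounded_linear_vec_nth)
  define fx where "fx z t = (\<Sum>j\<in>UNIV. blinfun_mult_right (cgrad f (z + axis i (E t)) $ j / E t) o\<^sub>L B j)" for z t
  have fx: "blinfun_apply (fx z t) v = cdot (cgrad f (z + axis i (E t))) v / E t" for z t v
    by (simp add: fx_def blinfun.sum_left B cdot_def sum_divide_distrib)
  have contE: "continuous_on S E" for S :: "real set"
    unfolding E_def by (intro continuous_intros)
  have contpd: "continuous_on (ball z0 r \<times> cbox 0 1) (\<lambda>p. cgrad f (fst p + axis i (E (snd p))) $ j)" for j
    by (intro continuous_on_compose2[OF continuous_on_cgrad[OF f]] continuous_on_add continuous_on_fst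
      continuous_on_id continuous_on_snd bounded_linear.continuous_on[OF bounded_linear_axis]
      continuous_on_compose2[OF contE[of UNIV]]) (use * in auto)
  have contq: "continuous_on (ball z0 r \<times> cbox 0 1) (\<lambda>p. cgrad f (fst p + axis i (E (snd p))) $ j / E (snd p))" for j
    by (intro continuous_on_divide contpd continuous_on_compose2[OF contE[of UNIV]] continuous_on_snd
        continuous_on_id) (use E0 in auto)
  have cont_fx: "continuous_on (ball z0 r \<times> cbox 0 1) (\<lambda>(z, t). fx z t)"
    unfolding fx_def split_beta
    by (intro continuous_on_sum bounded_bilinear.continuous_on[OF bounded_bilinear_blinfun_compose]
        bounded_linear.continuous_on[OF bounded_linear_blinfun_mult_right contq] continuous_on_const)
  have contf: "continuous_on (cbox 0 1) (\<lambda>t. f (z + axis i (E t)) / E t)" if "z \<in> ball z0 r" for z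
    by (intro continuous_on_divide continuous_on_compose2[OF holo_continuous[OF f]] continuous_on_add
      continuous_on_const bounded_linear.continuous_on[OF bounded_linear_axis] contE) (use * E0 that in auto)
  have D0: "((\<lambda>z. integral (cbox 0 1) (\<lambda>t. f (z + axis i (E t)) / E t)) has_derivative
      blinfun_apply (integral (cbox 0 1) (fx z0))) (at z0 within ball z0 r)"
  proof (rule leibniz_rule[OF _ _ cont_fx])
    fix z t assume z: "z \<in> ball z0 r"
    have "((\<lambda>z. z + axis i (E t)) has_derivative (\<lambda>v. v)) (at z)"
      by (auto intro!: derivative_eq_intros)
    from bounded_linear.has_derivative[OF bounded_linear_divide
        has_derivative_compose[OF this holo_derivative[OF f *[OF z, of t]]], of "E t"]
    have "((\<lambda>z. f (z + axis i (E t)) / E t) has_derivative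
        (\<lambda>v. cdot (cgrad f (z + axis i (E t))) v / E t)) (at z)" .
    then show "((\<lambda>z. f (z + axis i (E t)) / E t) has_derivative blinfun_apply (fx z t)) (at z within ball z0 r)"
      using has_derivative_at_withinI by (simp only: fx[abs_def])
  next
    fix z assume "z \<in> ball z0 r"
    from contf[OF this] show "(\<lambda>t. f (z + axis i (E t)) / E t) integrable_on cbox 0 1"
      by (rule integrable_continuous)
  next
    show "z0 \<in> ball z0 r" using r by simp
  next
    show "convex (ball z0 r)" by (rule convex_ball)
  qed
  have at: "at z0 within ball z0 r = at z0"
    using r by (intro at_within_open) auto
  note D = D0[unfolded at]
  have D': "((\<lambda>z. cgrad f z $ i) has_derivative blinfun_apply (integral (cbox 0 1) (fx z0))) (at z0)"
  proof (rule has_derivative_transform_within_open[OF D])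
    fix z assume "z \<in> ball z0 r"
    from cgrad_integral[OF f r sub[OF this], of i]
    show "integral (cbox 0 1) (\<lambda>t. f (z + axis i (E t)) / E t) = cgrad f z $ i"
      by (simp add: E_def)
  qed (use r in auto)
  have contz0: "continuous_on (cbox 0 1) (\<lambda>t. cgrad f (z0 + axis i (E t)) $ j / E t)" for j
    by (intro continuous_on_divide continuous_on_compose2[OF continuous_on_cgrad[OF f]] continuous_on_add
      continuous_on_const bounded_linear.continuous_on[OF bounded_linear_axis] contE) (use * E0 r in auto)
  have contfx0: "continuous_on (cbox 0 1) (fx z0)"
    using continuous_on_compose2[OF cont_fx, of "cbox 0 1" "\<lambda>t. (z0, t)"] r
    by (simp add: continuous_on_Pair image_subset_iff)
  have "blinfun_apply (integral (cbox 0 1) (fx z0)) v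
      = cdot (\<chi> j. integral (cbox 0 1) (\<lambda>t. cgrad f (z0 + axis i (E t)) $ j / E t)) v" for v
  proof -
    have "blinfun_apply (integral (cbox 0 1) (fx z0)) v = integral (cbox 0 1) (\<lambda>t. fx z0 t v)"
      by (rule blinfun_apply_integral[OF integrable_continuous[OF contfx0]])
    also have "\<dots> = integral (cbox 0 1) (\<lambda>t. \<Sum>j\<in>UNIV. (cgrad f (z0 + axis i (E t)) $ j / E t) * v $ j)"
      by (simp add: fx cdot_def sum_divide_distrib)
    also have "\<dots> = (\<Sum>j\<in>UNIV. integral (cbox 0 1) (\<lambda>t. (cgrad f (z0 + axis i (E t)) $ j / E t) * v $ j))"
      by (intro integral_sum integrable_continuous continuous_on_mult contz0 continuous_on_const) auto
    finally show ?thesis unfolding integral_mult_left cdot_def by simp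
  qed
  then have "blinfun_apply (integral (cbox 0 1) (fx z0))
      = cdot (\<chi> j. integral (cbox 0 1) (\<lambda>t. cgrad f (z0 + axis i (E t)) $ j / E t))"
    by (rule ext)
  note eq = this
  show ?thesis
  proof (rule that[OF r])
    show "cball z0 r \<subseteq> U" using r sub[of z0] by simp
  qed (use D' in \<open>unfold eq E_def\<close>)
qed

lemma holo_cgrad:
  assumes "holo f U"
  shows "holo (\<lambda>z. cgrad f z $ i) U"
  unfolding holo_def
proof (intro conjI ballI)
  show "open U" using assms by (rule holo_open)
  show "\<exists>g. ((\<lambda>z. cgrad f z $ i) has_derivative cdot g) (at z)" if "z \<in> U" for z
    by (rule cgrad_has_derivative[OF assms that]) (rule exI)
qed

text \<open>Differentiating Cauchy's formula for the \<open>i\<close>-th partial derivative in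
  direction \<open>j\<close> gives an integral of the \<open>j\<close>-th partial derivative over a
  circle in direction \<open>i\<close>, and that is Cauchy's formula for the other mixed
  derivative.\<close>

lemma cgrad_symmetric:
  assumes f: "holo f U" and z: "z \<in> U"
  shows "cgrad (\<lambda>z. cgrad f z $ i) z $ j = cgrad (\<lambda>z. cgrad f z $ j) z $ i"
proof -
  obtain r where r: "r > 0" "cball z r \<subseteq> U" and
    D: "((\<lambda>z. cgrad f z $ i) has_derivative cdot (\<chi> j. integral (cbox 0 1)
      (\<lambda>t::real. cgrad f (z + axis i (r * exp (2 * of_real pi * \<i> * t))) $ j / (r * exp (2 * of_real pi * \<i> * t))))) (at z)"
    by (rule cgrad_has_derivative[OF assms])
  show ?thesis
    unfolding cgrad_eqI[OF D] cgrad_integral[OF holo_cgrad[OF f, of j] r, of i] by (rule vec_lambda_beta)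
qed

section \<open>Real points and real analytic functions\<close>

definition re_vec :: "complex^'n \<Rightarrow> complex^'n" where
  "re_vec z = (\<chi> i. of_real (Re (z $ i)))"

text \<open>With z = x + i y for real x and y, the complex line t -> x + t y has real points at real
  t and passes through z at t = i, so the one-variable identity theorem suffices. Convexity makes
  the slice of \<open>U\<close> connected, and \<open>re_vec z\<close> is its point at t =
  0.\<close>

lemma holo_identity_real:
  fixes f :: "complex^'n \<Rightarrow> complex"
  assumes f: "holo f U" and U: "convex U" "z \<in> U" "re_vec z \<in> U"
    and real: "\<And>w. w \<in> U \<Longrightarrow> (\<forall>i. w $ i \<in> \<real>) \<Longrightarrow> f w = 0"
  shows "f z = 0"
proof -
  define x where "x = re_vec z"
  define y :: "complex^'n" where "y = (\<chi> i. of_real (Im (z $ i)))"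
  have z: "z = x + \<i> *s y"
    by (simp add: vec_eq_iff x_def y_def re_vec_def complex_eq)
  define S where "S = {t. x + t *s y \<in> U}"
  have op: "open S"
    unfolding S_def by (rule open_line[OF holo_open[OF f]])
  have cv: "convex S"
  proof (rule convexI)
    fix s t :: complex and u v :: real
    assume "s \<in> S" "t \<in> S" and uv: "0 \<le> u" "0 \<le> v" "u + v = 1"
    then have "u *\<^sub>R (x + s *s y) + v *\<^sub>R (x + t *s y) \<in> U"
      by (intro convexD[OF U(1)]) (auto simp: S_def)
    also have "u *\<^sub>R (x + s *s y) + v *\<^sub>R (x + t *s y) = (u + v) *\<^sub>R x + (u *\<^sub>R s + v *\<^sub>R t) *s y"
      by (simp add: vec_eq_iff scaleR_add_left scaleR_add_right ring_distribs add_ac)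
    finally show "u *\<^sub>R s + v *\<^sub>R t \<in> S" using uv by (simp add: S_def)
  qed
  have S0: "0 \<in> S" using U(3) by (simp add: S_def x_def)
  have Si: "\<i> \<in> S" using U(2) unfolding S_def mem_Collect_eq by (simp only: z[symmetric])
  obtain d where d: "d > 0" "ball 0 d \<subseteq> S" using op S0 open_contains_ball by blast
  have "f (x + \<i> *s y) = 0"
  proof (rule analytic_continuation[where f = "\<lambda>t. f (x + t *s y)" and S = S and U = "S \<inter> \<real>" and \<xi> = 0])
    show "(\<lambda>t. f (x + t *s y)) holomorphic_on S"
      unfolding S_def by (rule holo_line[OF f])
    show "connected S" using cv by (rule convex_connected)
    show "0 islimpt S \<inter> \<real>"
      unfolding islimpt_approachable
    proof (intro allI impI)
      fix e :: real assume e: "e > 0"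
      define h where "h = complex_of_real (min e d / 2)"
      have m: "min e d / 2 > 0" "min e d / 2 < e" "min e d / 2 < d"
        using d(1) e by auto
      have nh: "norm h = min e d / 2"
        unfolding h_def norm_of_real using m(1) by (rule abs_of_pos)
      have "h \<in> S" using d(2) m(3) nh by (intro subsetD[OF d(2)]) simp
      moreover have "h \<in> \<real>" unfolding h_def by (rule Reals_of_real)
      moreover have "h \<noteq> 0" "dist h 0 < e" using nh m by auto
      ultimately show "\<exists>x'\<in>S \<inter> \<real>. x' \<noteq> 0 \<and> dist x' 0 < e" by blast
    qed
    show "f (x + t *s y) = 0" if "t \<in> S \<inter> \<real>" for t
      using that by (intro real) (auto simp: S_def x_def y_def re_vec_def)
  qed (use op S0 Si in auto)
  then show ?thesis by (simp only: z[symmetric])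
qed

section \<open>From real power series to holomorphic functions\<close>

definition cvec :: "('n::finite \<Rightarrow> 'a::euclidean_space) \<Rightarrow> 'a \<Rightarrow> complex^'n" where
  "cvec b x = (\<chi> i. of_real (x \<bullet> b i))"

lemma cvec_linear:
  "cvec b (x + y) = cvec b x + cvec b y" "cvec b (x - y) = cvec b x - cvec b y"
  "cvec b (a *\<^sub>R x) = of_real a *s cvec b x" "cvec b 0 = 0"
  by (simp_all add: cvec_def vec_eq_iff inner_add_left inner_diff_left)

lemma norm_cvec:
  assumes "bij_betw b UNIV Basis"
  shows "norm (cvec b x) = norm x"
proof -
  have "norm (cvec b x) = sqrt (\<Sum>i\<in>UNIV. (x \<bullet> b i)\<^sup>2)"
    by (simp add: norm_vec_def L2_set_def cvec_def)
  also have "(\<Sum>i\<in>UNIV. (x \<bullet> b i)\<^sup>2) = (\<Sum>i\<in>Basis. (x \<bullet> i)\<^sup>2)"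
    using assms by (rule sum.reindex_bij_betw)
  also have "sqrt \<dots> = norm x"
    by (simp add: norm_eq_sqrt_inner euclidean_inner[of x x] power2_eq_square)
  finally show ?thesis .
qed

lemma cvec_mem_ball:
  assumes "bij_betw b UNIV Basis"
  shows "cvec b x \<in> ball (cvec b p) r \<longleftrightarrow> x \<in> ball p r"
  using norm_cvec[OF assms, of "p - x"] by (simp add: dist_norm cvec_linear)

text \<open>The terms are enumerated, \<open>a n\<close> being the multi-index of the
  \<open>n\<close>-th one, and converge absolutely where all coordinates equal \<rho>. Halving the
  radius pays for differentiation: the new factor \<open>a n j\<close> is at most 2 to the total
  degree.\<close>

lemma power_series_holo:
  fixes C :: "nat \<Rightarrow> real" and a :: "nat \<Rightarrow> 'n::finite \<Rightarrow> nat" and P :: "complex^'n"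
  assumes \<rho>: "\<rho> > 0" and summ: "summable (\<lambda>n. \<bar>C n\<bar> * \<rho> ^ (\<Sum>i\<in>UNIV. a n i))"
  shows "\<exists>G. holo G (ball P (\<rho>/2)) \<and>
    (\<forall>z\<in>ball P (\<rho>/2). (\<lambda>n. of_real (C n) * (\<Prod>i\<in>UNIV. (z $ i - P $ i) ^ a n i)) sums G z)"
proof -
  define S where "S = ball P (\<rho>/2)"
  define g :: "nat \<Rightarrow> complex^'n \<Rightarrow> complex^'n" where
    "g n z = (\<chi> j. of_real (C n) * (of_nat (a n j) * (z $ j - P $ j) ^ (a n j - 1)
        * (\<Prod>i\<in>UNIV - {j}. (z $ i - P $ i) ^ a n i)))" for n z
  define d where "d n = (\<Sum>i\<in>UNIV. a n i)" for n
  \<comment> \<open>Majorant for all partial derivatives of the \<open>n\<close>-th term on the ball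
    of half the radius; 2/\<rho> makes up for the exponent lost in differentiation.\<close>
  define M where "M n = (2 / \<rho>) * (\<bar>C n\<bar> * \<rho> ^ d n)" for n
  have comp: "norm (z $ i - P $ i) \<le> \<rho>/2" if "z \<in> S" for z i
    using that Finite_Cartesian_Product.norm_nth_le[of "z - P" i]
    by (simp add: S_def dist_norm norm_minus_commute)
  have bound: "norm (g n z $ j) \<le> M n" if z: "z \<in> S" for n z j
  proof (cases "a n j = 0")
    case True
    then show ?thesis using \<rho> by (simp add: g_def M_def)
  next
    case False
    define m where "m = (\<Sum>i\<in>UNIV - {j}. a n i)"
    have dn: "d n = a n j + m"
      unfolding d_def m_def by (simp add: sum.remove[of UNIV j])
    have "norm (g n z $ j) = \<bar>C n\<bar> * (real (a n j) * norm (z $ j - P $ j) ^ (a n j - 1)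
        * (\<Prod>i\<in>UNIV - {j}. norm (z $ i - P $ i) ^ a n i))"
      by (simp add: g_def norm_mult norm_power prod_norm[symmetric])
    also have "\<dots> \<le> \<bar>C n\<bar> * (real (a n j) * (\<rho>/2) ^ (a n j - 1) * (\<Prod>i\<in>UNIV - {j}. (\<rho>/2) ^ a n i))"
      using \<rho> comp[OF z]
      by (intro mult_left_mono mult_mono power_mono prod_mono conjI prod_nonneg mult_nonneg_nonneg) auto
    also have "\<dots> = \<bar>C n\<bar> * (real (a n j) * (\<rho>/2) ^ (a n j - 1) * (\<rho>/2) ^ m)"
      by (simp add: m_def power_sum)
    also have "real (a n j) * (\<rho>/2) ^ (a n j - 1) * (\<rho>/2) ^ m = real (a n j) * (\<rho>/2) ^ d n * (2/\<rho>)"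
      using \<rho> False by (cases "a n j") (simp_all add: dn power_add)
    also have "\<bar>C n\<bar> * (real (a n j) * (\<rho>/2) ^ d n * (2/\<rho>)) \<le> \<bar>C n\<bar> * (2 ^ d n * (\<rho>/2) ^ d n * (2/\<rho>))"
    proof -
      have "a n j \<le> d n" by (simp add: dn)
      also have "d n \<le> 2 ^ d n" by (simp add: less_imp_le)
      finally have "real (a n j) \<le> 2 ^ d n" by (metis of_nat_le_iff of_nat_numeral of_nat_power)
      then show ?thesis using \<rho> by (intro mult_left_mono mult_right_mono) auto
    qed
    also have "2 ^ d n * (\<rho>/2) ^ d n = \<rho> ^ d n"
      by (simp add: power_divide)
    finally show ?thesis unfolding M_def by (simp only: mult_ac)
  qed
  have sM: "summable M"
    unfolding M_def d_def by (rule summable_mult[OF summ])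
  define G' where "G' z = (\<chi> j. suminf (\<lambda>n. g n z $ j))" for z
  have unif: "uniform_limit S (\<lambda>n z. \<Sum>i<n. g i z $ j) (\<lambda>z. G' z $ j) sequentially" for j
    unfolding G'_def vec_lambda_beta by (rule Weierstrass_m_test[OF bound sM])
  define T where "T n z = of_real (C n) * (\<Prod>i\<in>UNIV. (z $ i - P $ i) ^ a n i)" for n and z :: "complex^'n"
  have Tder: "(T n has_derivative cdot (g n z)) (at z within S)" for n z
  proof -
    have 1: "((\<lambda>z. (z $ i - P $ i) ^ a n i) has_derivative
        (\<lambda>v. of_nat (a n i) * (v $ i) * (z $ i - P $ i) ^ (a n i - 1))) (at z within S)" for i
      by (rule derivative_eq_intros bounded_linear.has_derivative[OF bounded_linear_vec_nth] | simp)+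
    have "(T n has_derivative (\<lambda>v. of_real (C n) * (\<Sum>i\<in>UNIV. of_nat (a n i) * (v $ i) * (z $ i - P $ i) ^ (a n i - 1)
        * (\<Prod>j\<in>UNIV - {i}. (z $ j - P $ j) ^ a n j)))) (at z within S)"
      unfolding T_def
      by (intro has_derivative_mult_right has_derivative_prod 1)
    moreover have "of_real (C n) * (\<Sum>i\<in>UNIV. of_nat (a n i) * (v $ i) * (z $ i - P $ i) ^ (a n i - 1)
        * (\<Prod>j\<in>UNIV - {i}. (z $ j - P $ j) ^ a n j)) = cdot (g n z) v" for v
      by (simp add: cdot_def g_def sum_distrib_left mult_ac)
    ultimately show ?thesis by simp
  qed
  have P_S: "P \<in> S" using \<rho> by (simp add: S_def)
  have "summable (\<lambda>n. T n P)"
  proof (rule summable_comparison_test'[OF summ])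
    fix n
    have "norm (\<Prod>i\<in>UNIV. (P $ i - P $ i) ^ a n i) \<le> (\<Prod>i\<in>UNIV. \<rho> ^ a n i)"
      unfolding prod_norm[symmetric] using \<rho>
      by (intro prod_mono) (auto simp: norm_power power_0_left)
    then show "norm (T n P) \<le> \<bar>C n\<bar> * \<rho> ^ (\<Sum>i\<in>UNIV. a n i)"
      by (simp add: T_def norm_mult power_sum mult_left_mono)
  qed
  then have sumsP: "(\<lambda>n. T n P) sums suminf (\<lambda>n. T n P)" by (rule summable_sums)
  have "\<exists>G. \<forall>z\<in>S. (\<lambda>n. T n z) sums G z \<and> (G has_derivative cdot (G' z)) (at z within S)"
  proof (rule has_derivative_series[OF _ Tder _ P_S sumsP])
    show "convex S" by (simp add: S_def)
    fix e :: real assume e: "e > 0"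
    define N where "N = real CARD('n)"
    have N: "N > 0" by (simp add: N_def)
    have "\<forall>\<^sub>F n in sequentially. \<forall>z\<in>S. dist (\<Sum>i<n. g i z $ j) (G' z $ j) < e / N" for j
      using unif[of j] e N unfolding uniform_limit_iff by simp
    then have "\<forall>\<^sub>F n in sequentially. \<forall>j. \<forall>z\<in>S. dist (\<Sum>i<n. g i z $ j) (G' z $ j) < e / N"
      by (rule eventually_all_finite)
    then show "\<forall>\<^sub>F n in sequentially. \<forall>z\<in>S. \<forall>h. norm ((\<Sum>i<n. cdot (g i z) h) - cdot (G' z) h) \<le> e * norm h"
    proof eventually_elim
      case (elim n)
      show ?case
      proof (intro ballI allI)
        fix z h assume z: "z \<in> S"
        have "(\<Sum>i<n. cdot (g i z) h) - cdot (G' z) h = (\<Sum>j\<in>UNIV. ((\<Sum>i<n. g i z $ j) - G' z $ j) * h $ j)"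
          by (simp add: cdot_def algebra_simps sum_subtractf sum_distrib_left sum_distrib_right)
             (rule sum.swap)
        also have "norm \<dots> \<le> (\<Sum>j\<in>(UNIV :: 'n set). (e / N) * norm h)"
        proof (rule sum_norm_le)
          fix j :: 'n
          have "norm ((\<Sum>i<n. g i z $ j) - G' z $ j) \<le> e / N"
            using elim z by (auto simp: dist_norm less_imp_le)
          then show "norm (((\<Sum>i<n. g i z $ j) - G' z $ j) * h $ j) \<le> (e / N) * norm h"
            unfolding norm_mult using e N by (intro mult_mono Finite_Cartesian_Product.norm_nth_le) auto
        qed
        also have "\<dots> = e * norm h" using N by (simp add: N_def)
        finally show "norm ((\<Sum>i<n. cdot (g i z) h) - cdot (G' z) h) \<le> e * norm h" .
      qed
    qed
  qed
  then obtain G where G: "\<And>z. z \<in> S \<Longrightarrow> (\<lambda>n. T n z) sums G z"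
    "\<And>z. z \<in> S \<Longrightarrow> (G has_derivative cdot (G' z)) (at z within S)" by blast
  have opS: "open S" by (simp add: S_def)
  have "holo G S"
  proof (rule holoI[where g = G', OF opS])
    fix z assume "z \<in> S"
    from G(2)[OF this] at_within_open[OF this opS]
    show "(G has_derivative cdot (G' z)) (at z)" by simp
  qed
  with G(1) show ?thesis unfolding S_def T_def by blast
qed

text \<open>Since \<open>has_sum\<close> is unconditional, the multi-indices may be enumerated and
  each component converges absolutely; the same coefficients then define the extension.
  \<open>G k\<close> extends the component along \<open>k\<close>.\<close>

lemma real_analytic_at_holo:
  fixes F :: "'a::euclidean_space \<Rightarrow> 'b::euclidean_space" and b :: "'n::finite \<Rightarrow> 'a"
  assumes F: "real_analytic_at F p" and b: "bij_betw b UNIV Basis"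
  shows "\<exists>r>0. \<exists>G. \<forall>k. holo (G k) (ball (cvec b p) r) \<and>
    (\<forall>x\<in>ball p r. G k (cvec b x) = of_real (F x \<bullet> k))"
proof -
  obtain c r where r: "r > 0" and c: "\<And>x. x \<in> ball p r \<Longrightarrow>
      ((\<lambda>\<alpha>. (\<Prod>i\<in>Basis. ((x - p) \<bullet> i) ^ \<alpha> i) *\<^sub>R c \<alpha>) has_sum F x) (Basis \<rightarrow>\<^sub>E UNIV)"
    using F unfolding real_analytic_at_def by blast
  define A :: "('a \<Rightarrow> nat) set" where "A = Basis \<rightarrow>\<^sub>E UNIV"
  have cA: "countable A" unfolding A_def by (rule countable_PiE) auto
  have iA: "infinite A"
    unfolding A_def by (subst finite_PiE_iff) (auto simp: PiE_eq_empty_iff)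
  define e where "e = from_nat_into A"
  have e: "bij_betw e UNIV A"
    unfolding e_def using cA iA by (rule bij_betw_from_nat_into)
  define a where "a n i = e n (b i)" for n i
  have comp: "(\<lambda>n. (\<Prod>i\<in>UNIV. ((x - p) \<bullet> b i) ^ a n i) * (c (e n) \<bullet> k)) sums (F x \<bullet> k)"
    "summable (\<lambda>n. \<bar>(\<Prod>i\<in>UNIV. ((x - p) \<bullet> b i) ^ a n i) * (c (e n) \<bullet> k)\<bar>)"
    if x: "x \<in> ball p r" for x k
  proof -
    define t where "t \<alpha> = ((\<Prod>i\<in>Basis. ((x - p) \<bullet> i) ^ \<alpha> i) *\<^sub>R c \<alpha>) \<bullet> k" for \<alpha>
    have "t = (\<lambda>v. v \<bullet> k) \<circ> (\<lambda>\<alpha>. (\<Prod>i\<in>Basis. ((x - p) \<bullet> i) ^ \<alpha> i) *\<^sub>R c \<alpha>)"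
      by (simp add: fun_eq_iff t_def)
    then have "(t has_sum (F x \<bullet> k)) A"
      using has_sum_bounded_linear[OF bounded_linear_inner_left[of k] c[OF x]] by (simp only: A_def o_def)
    then have "((\<lambda>n. t (e n)) has_sum (F x \<bullet> k)) UNIV"
      by (simp only: has_sum_reindex_bij_betw[OF e, of t])
    then have "((\<lambda>n. (\<Prod>i\<in>Basis. ((x - p) \<bullet> i) ^ e n i) * (c (e n) \<bullet> k)) has_sum (F x \<bullet> k)) UNIV"
      by (simp only: t_def inner_scaleR_left)
    moreover have "(\<Prod>i\<in>Basis. ((x - p) \<bullet> i) ^ e n i) = (\<Prod>i\<in>UNIV. ((x - p) \<bullet> b i) ^ a n i)" for n
      unfolding a_def by (rule prod.reindex_bij_betw[OF b, symmetric])
    ultimately have hs: "((\<lambda>n. (\<Prod>i\<in>UNIV. ((x - p) \<bullet> b i) ^ a n i) * (c (e n) \<bullet> k)) has_sum (F x \<bullet> k)) UNIV"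
      by simp
    then show "(\<lambda>n. (\<Prod>i\<in>UNIV. ((x - p) \<bullet> b i) ^ a n i) * (c (e n) \<bullet> k)) sums (F x \<bullet> k)"
      by (rule has_sum_imp_sums)
    from hs have "(\<lambda>n. (\<Prod>i\<in>UNIV. ((x - p) \<bullet> b i) ^ a n i) * (c (e n) \<bullet> k)) summable_on UNIV"
      by (rule has_sum_imp_summable)
    then have "(\<lambda>n. norm ((\<Prod>i\<in>UNIV. ((x - p) \<bullet> b i) ^ a n i) * (c (e n) \<bullet> k))) summable_on UNIV"
      by (rule summable_on_iff_abs_summable_on_real[THEN iffD1])
    from summable_on_imp_summable[OF this]
    show "summable (\<lambda>n. \<bar>(\<Prod>i\<in>UNIV. ((x - p) \<bullet> b i) ^ a n i) * (c (e n) \<bullet> k)\<bar>)"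
      by simp
  qed
  \<comment> \<open>The vector of ones. At p + \<rho> s every monomial is a power of \<rho>, which
    yields the absolute convergence needed; \<rho> is chosen so that this point lies in the ball of
    convergence.\<close>
  define s where "s = (\<Sum>Basis :: 'a)"
  define \<rho> where "\<rho> = (r / 2) / (1 + norm s)"
  have pos: "0 < 1 + norm s" by (simp add: add_pos_nonneg)
  have \<rho>: "\<rho> > 0" using r pos by (simp add: \<rho>_def)
  have \<rho>r: "\<rho> * (1 + norm s) = r / 2" using pos by (metis \<rho>_def nonzero_eq_divide_eq less_irrefl)
  have "\<rho> \<le> r / 2" "\<rho> * norm s < r"
  proof -
    have "\<rho> + \<rho> * norm s = r / 2" using \<rho>r by (simp add: algebra_simps)
    moreover have "0 \<le> \<rho> * norm s" using \<rho> by simp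
    ultimately show "\<rho> \<le> r / 2" "\<rho> * norm s < r" using \<rho> r by linarith+
  qed
  then have xball: "p + \<rho> *\<^sub>R s \<in> ball p r" using \<rho> by (simp add: dist_norm)
  have si: "s \<bullet> b i = 1" for i
  proof -
    have "b i \<in> Basis" using b by (auto simp: bij_betw_def)
    then show ?thesis by (simp add: s_def inner_sum_left inner_Basis if_distrib sum.delta cong: if_cong)
  qed
  have summ: "summable (\<lambda>n. \<bar>c (e n) \<bullet> k\<bar> * \<rho> ^ (\<Sum>i\<in>UNIV. a n i))" for k
    using comp(2)[OF xball, of k] \<rho> by (simp add: si power_sum abs_mult abs_prod mult.commute)
  have "\<forall>k. \<exists>G. holo G (ball (cvec b p) (\<rho>/2)) \<and>
    (\<forall>z\<in>ball (cvec b p) (\<rho>/2). (\<lambda>n. of_real (c (e n) \<bullet> k) * (\<Prod>i\<in>UNIV. (z $ i - cvec b p $ i) ^ a n i)) sums G z)"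
    by (intro allI power_series_holo[OF \<rho> summ])
  from choice[OF this] obtain G where G': "\<forall>k. holo (G k) (ball (cvec b p) (\<rho>/2)) \<and>
    (\<forall>z\<in>ball (cvec b p) (\<rho>/2). (\<lambda>n. of_real (c (e n) \<bullet> k) * (\<Prod>i\<in>UNIV. (z $ i - cvec b p $ i) ^ a n i)) sums G k z)"
    by (rule exE)
  have G: "holo (G k) (ball (cvec b p) (\<rho>/2))"
    "z \<in> ball (cvec b p) (\<rho>/2) \<Longrightarrow> (\<lambda>n. of_real (c (e n) \<bullet> k) * (\<Prod>i\<in>UNIV. (z $ i - cvec b p $ i) ^ a n i)) sums G k z" for k z
    by (rule G'[THEN spec, THEN conjunct1], rule G'[THEN spec, THEN conjunct2, THEN bspec])
  have "G k (cvec b x) = of_real (F x \<bullet> k)" if x: "x \<in> ball p (\<rho>/2)" for k x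
  proof -
    have xr: "x \<in> ball p r" using x \<open>\<rho> \<le> r / 2\<close> r by auto
    have s1: "(\<lambda>n. complex_of_real ((\<Prod>i\<in>UNIV. ((x - p) \<bullet> b i) ^ a n i) * (c (e n) \<bullet> k))) sums of_real (F x \<bullet> k)"
      by (rule sums_of_real[OF comp(1)[OF xr]])
    have "(\<lambda>n. of_real (c (e n) \<bullet> k) * (\<Prod>i\<in>UNIV. (cvec b x $ i - cvec b p $ i) ^ a n i)) sums G k (cvec b x)"
      using cvec_mem_ball[OF b] x by (rule G(2)[OF iffD2])
    moreover have "of_real (c (e n) \<bullet> k) * (\<Prod>i\<in>UNIV. (cvec b x $ i - cvec b p $ i) ^ a n i)
        = complex_of_real ((\<Prod>i\<in>UNIV. ((x - p) \<bullet> b i) ^ a n i) * (c (e n) \<bullet> k))" for n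
      by (simp add: cvec_def inner_diff_left mult.commute)
    ultimately have "(\<lambda>n. complex_of_real ((\<Prod>i\<in>UNIV. ((x - p) \<bullet> b i) ^ a n i) * (c (e n) \<bullet> k))) sums G k (cvec b x)"
      by (simp only:)
    from sums_unique2[OF this] s1 show ?thesis by blast
  qed
  with G(1) show ?thesis
    using \<rho> by (intro exI[of _ "\<rho>/2"] conjI exI[of _ G] allI ballI) auto
qed

section \<open>Quaternions and orientations\<close>

lemma vector_4 [simp]:
  "(vector [w, x, y, z] :: 'a::zero^4) $ 1 = w"
  "(vector [w, x, y, z] :: 'a::zero^4) $ 2 = x"
  "(vector [w, x, y, z] :: 'a::zero^4) $ 3 = y"
  "(vector [w, x, y, z] :: 'a::zero^4) $ 4 = z"
  by (simp_all add: vector_def)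

lemma det_4:
  fixes A :: "'a::comm_ring_1^4^4"
  shows "det A =
    A$1$1 * (A$2$2 * (A$3$3 * A$4$4 - A$3$4 * A$4$3) - A$2$3 * (A$3$2 * A$4$4 - A$3$4 * A$4$2)
      + A$2$4 * (A$3$2 * A$4$3 - A$3$3 * A$4$2))
  - A$1$2 * (A$2$1 * (A$3$3 * A$4$4 - A$3$4 * A$4$3) - A$2$3 * (A$3$1 * A$4$4 - A$3$4 * A$4$1)
      + A$2$4 * (A$3$1 * A$4$3 - A$3$3 * A$4$1))
  + A$1$3 * (A$2$1 * (A$3$2 * A$4$4 - A$3$4 * A$4$2) - A$2$2 * (A$3$1 * A$4$4 - A$3$4 * A$4$1)
      + A$2$4 * (A$3$1 * A$4$2 - A$3$2 * A$4$1))
  - A$1$4 * (A$2$1 * (A$3$2 * A$4$3 - A$3$3 * A$4$2) - A$2$2 * (A$3$1 * A$4$3 - A$3$3 * A$4$1)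
      + A$2$3 * (A$3$1 * A$4$2 - A$3$2 * A$4$1))"
proof -
  have f1: "finite {2::4, 3, 4}" "1 \<notin> {2::4, 3, 4}" by auto
  have f2: "finite {3::4, 4}" "2 \<notin> {3::4, 4}" by auto
  have f3: "finite {4::4}" "3 \<notin> {4::4}" by auto
  show ?thesis
    unfolding det_def UNIV_4
    unfolding sum_over_permutations_insert[OF f1]
    unfolding sum_over_permutations_insert[OF f2]
    unfolding sum_over_permutations_insert[OF f3]
    unfolding permutes_sing
    by (simp add: sign_swap_id permutation_swap_id permutation_compose sign_compose sign_id swap_id_eq)
       (simp add: algebra_simps)
qed

section \<open>Oriented volumes and Gram determinants\<close>

definition vdet :: "quat \<Rightarrow> quat \<Rightarrow> quat \<Rightarrow> quat \<Rightarrow> real" where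
  "vdet p T A B = det (vector [quat_coords p, quat_coords T, quat_coords A, quat_coords B] :: real^4^4)"

lemma quat_coords_inner: "(\<Sum>i\<in>UNIV. quat_coords p $ i * quat_coords q $ i) = p \<bullet> q"
  by (simp add: sum_4 quat_coords_def inner_prod_def inner_complex_def)

text \<open>Product of one coordinate matrix with the transpose of the other. It turns comparisons
  of orientations into computations with inner products.\<close>

lemma vdet_gram:
  "vdet p T A B * vdet p' T' A' B' = det (vector [
     vector [p \<bullet> p', p \<bullet> T', p \<bullet> A', p \<bullet> B'],
     vector [T \<bullet> p', T \<bullet> T', T \<bullet> A', T \<bullet> B'],
     vector [A \<bullet> p', A \<bullet> T', A \<bullet> A', A \<bullet> B'],
     vector [B \<bullet> p', B \<bullet> T', B \<bullet> A', B \<bullet> B']] :: real^4^4)"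
proof -
  let ?M = "\<lambda>p T A B. (vector [quat_coords p, quat_coords T, quat_coords A, quat_coords B] :: real^4^4)"
  have "vdet p T A B * vdet p' T' A' B' = det (?M p T A B ** transpose (?M p' T' A' B'))"
    by (simp add: vdet_def det_mul det_transpose)
  also have "?M p T A B ** transpose (?M p' T' A' B') = vector [
     vector [p \<bullet> p', p \<bullet> T', p \<bullet> A', p \<bullet> B'],
     vector [T \<bullet> p', T \<bullet> T', T \<bullet> A', T \<bullet> B'],
     vector [A \<bullet> p', A \<bullet> T', A \<bullet> A', A \<bullet> B'],
     vector [B \<bullet> p', B \<bullet> T', B \<bullet> A', B \<bullet> B']]"
    by (simp add: vec_eq_iff forall_4 matrix_matrix_mult_def transpose_def quat_coords_inner)
  finally show ?thesis .
qed

lemma vdet_gram_orth: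
  assumes "p \<bullet> T = 0" "A \<bullet> p = 0" "A \<bullet> T = 0" "B \<bullet> p = 0" "B \<bullet> T = 0"
    "A' \<bullet> p = 0" "A' \<bullet> T = 0" "B' \<bullet> p = 0" "B' \<bullet> T = 0"
  shows "vdet p T A B * vdet p T A' B'
    = (p \<bullet> p) * (T \<bullet> T) * ((A \<bullet> A') * (B \<bullet> B') - (A \<bullet> B') * (B \<bullet> A'))"
  using assms inner_commute[of T p] inner_commute[of p A'] inner_commute[of p B'] inner_commute[of T A']
    inner_commute[of T B']
  by (simp add: vdet_gram det_4 algebra_simps)

lemma quat_eq_iff: "p = q \<longleftrightarrow> Re (fst p) = Re (fst q) \<and> Im (fst p) = Im (fst q)
    \<and> Re (snd p) = Re (snd q) \<and> Im (snd p) = Im (snd q)"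
  by (auto simp: prod_eq_iff complex_eq_iff)

section \<open>Quaternion algebra\<close>

definition qcnj :: "quat \<Rightarrow> quat" where "qcnj q = (cnj (fst q), - snd q)"

lemma quat_inner: "p \<bullet> q = Re (fst p) * Re (fst q) + Im (fst p) * Im (fst q)
    + Re (snd p) * Re (snd q) + Im (snd p) * Im (snd q)" for p q :: quat
  by (simp add: inner_prod_def inner_complex_def)

lemma qmult_assoc: "(a \<otimes>\<^sub>q b) \<otimes>\<^sub>q c = a \<otimes>\<^sub>q (b \<otimes>\<^sub>q c)"
  by (simp add: quat_eq_iff qmult_def algebra_simps)

lemma qmult_simps: "fst (a \<otimes>\<^sub>q b) = fst a * fst b - cnj (snd a) * snd b"
  "snd (a \<otimes>\<^sub>q b) = snd a * fst b + cnj (fst a) * snd b"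
  by (simp_all add: qmult_def)

lemma qmult_inner_left: "(x \<otimes>\<^sub>q a) \<bullet> (x \<otimes>\<^sub>q b) = (x \<bullet> x) * (a \<bullet> b)"
  by (simp add: quat_inner qmult_simps algebra_simps)

lemma qmult_inner_right: "(a \<otimes>\<^sub>q x) \<bullet> (b \<otimes>\<^sub>q x) = (x \<bullet> x) * (a \<bullet> b)"
  by (simp add: quat_inner qmult_simps algebra_simps)

lemma qmult_inner_adjoint: "\<mu> \<in> ImH \<Longrightarrow> (a \<otimes>\<^sub>q \<mu>) \<bullet> b = - (a \<bullet> (b \<otimes>\<^sub>q \<mu>))"
  by (simp add: ImH_def quat_inner qmult_simps algebra_simps)

lemma qcnj_mult: "qcnj x \<otimes>\<^sub>q (x \<otimes>\<^sub>q a) = (x \<bullet> x) *\<^sub>R a" "x \<otimes>\<^sub>q (qcnj x \<otimes>\<^sub>q a) = (x \<bullet> x) *\<^sub>R a"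
  by (simp_all add: quat_eq_iff quat_inner qmult_simps qcnj_def algebra_simps)

lemma qmult_linear:
  "x \<otimes>\<^sub>q (a + b) = x \<otimes>\<^sub>q a + x \<otimes>\<^sub>q b" "(a + b) \<otimes>\<^sub>q x = a \<otimes>\<^sub>q x + b \<otimes>\<^sub>q x"
  "x \<otimes>\<^sub>q (r *\<^sub>R a) = r *\<^sub>R (x \<otimes>\<^sub>q a)" "(r *\<^sub>R a) \<otimes>\<^sub>q x = r *\<^sub>R (a \<otimes>\<^sub>q x)"
  "x \<otimes>\<^sub>q (- a) = - (x \<otimes>\<^sub>q a)" "(- a) \<otimes>\<^sub>q x = - (a \<otimes>\<^sub>q x)"
  by (simp_all add: quat_eq_iff qmult_simps algebra_simps)

text \<open>\<open>?L\<close> is the matrix of left multiplication by \<open>x\<close>, acting on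
  coordinate rows; its determinant is |x|^4. The signs of \<open>x3\<close> reflect that the
  k-coordinate of \<open>x\<close> is \<open>- x3\<close>.\<close>

lemma vdet_qmult: "vdet (x \<otimes>\<^sub>q a) (x \<otimes>\<^sub>q b) (x \<otimes>\<^sub>q c) (x \<otimes>\<^sub>q d) = (x \<bullet> x)\<^sup>2 * vdet a b c d"
proof -
  let ?M = "\<lambda>p T A B. (vector [quat_coords p, quat_coords T, quat_coords A, quat_coords B] :: real^4^4)"
  obtain x0 x1 x2 x3 where x: "x = (Complex x0 x1, Complex x2 x3)"
    by (metis complex.collapse prod.collapse)
  let ?L = "vector [vector [x0, x1, x2, - x3], vector [- x1, x0, - x3, - x2],
     vector [- x2, x3, x0, x1], vector [x3, x2, - x1, x0]] :: real^4^4"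
  have "?M (x \<otimes>\<^sub>q a) (x \<otimes>\<^sub>q b) (x \<otimes>\<^sub>q c) (x \<otimes>\<^sub>q d) = ?M a b c d ** ?L"
    by (simp add: vec_eq_iff forall_4 matrix_matrix_mult_def sum_4 quat_coords_def qmult_simps x algebra_simps)
  then have "vdet (x \<otimes>\<^sub>q a) (x \<otimes>\<^sub>q b) (x \<otimes>\<^sub>q c) (x \<otimes>\<^sub>q d) = vdet a b c d * det ?L"
    unfolding vdet_def by (simp only: det_mul)
  also have "det ?L = (x \<bullet> x)\<^sup>2"
    unfolding det_4 vector_4 x quat_inner fst_conv snd_conv complex.sel by algebra
  finally show ?thesis by (simp only: mult.commute)
qed

text \<open>For orthogonal imaginary quaternions the product r \<mu> is the cross product, so this
  is the volume of the positive frame formed by \<mu>, the cross product of r and \<mu>, and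
  r.\<close>

lemma vdet_one_im:
  assumes "\<mu> \<in> ImH" "r \<in> ImH" "r \<bullet> \<mu> = 0"
  shows "vdet (1, 0) \<mu> (r \<otimes>\<^sub>q \<mu>) r = (\<mu> \<bullet> \<mu>) * (r \<bullet> r)"
proof -
  obtain m1 m2 m3 where m: "\<mu> = (Complex 0 m1, Complex m2 m3)"
    using assms(1) unfolding ImH_def by (metis complex.collapse prod.collapse mem_Collect_eq)
  obtain r1 r2 r3 where r: "r = (Complex 0 r1, Complex r2 r3)"
    using assms(2) unfolding ImH_def by (metis complex.collapse prod.collapse mem_Collect_eq)
  have o: "r1 * m1 + r2 * m2 + r3 * m3 = 0"
    using assms(3) by (simp add: quat_inner m r)
  have "vdet (1, 0) \<mu> (r \<otimes>\<^sub>q \<mu>) r = (m1^2 + m2^2 + m3^2) * (r1^2 + r2^2 + r3^2) - (r1 * m1 + r2 * m2 + r3 * m3)^2"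
    unfolding vdet_def det_4 vector_4 quat_coords_def qmult_def m r
    by (simp add: algebra_simps power2_eq_square)
  then show ?thesis by (simp add: o quat_inner m r power2_eq_square)
qed

text \<open>Left multiplication by the inverse of the unit quaternion \<open>x\<close> preserves
  volume and moves the base point to 1, where \<open>R\<close> becomes an imaginary quaternion
  orthogonal to \<mu>.\<close>

lemma vdet_orientation:
  assumes x: "x \<bullet> x = 1" and \<mu>: "\<mu> \<in> ImH" and R: "R \<bullet> x = 0" "R \<bullet> (x \<otimes>\<^sub>q \<mu>) = 0"
  shows "vdet x (x \<otimes>\<^sub>q \<mu>) (R \<otimes>\<^sub>q \<mu>) R = (\<mu> \<bullet> \<mu>) * (R \<bullet> R)"
proof -
  define r where "r = qcnj x \<otimes>\<^sub>q R"
  have R': "R = x \<otimes>\<^sub>q r" by (simp add: r_def qcnj_mult x)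
  have x1: "x = x \<otimes>\<^sub>q (1, 0)" by (simp add: qmult_def)
  have "r \<in> ImH"
  proof -
    have "(x \<otimes>\<^sub>q r) \<bullet> (x \<otimes>\<^sub>q (1, 0)) = 0" using R(1) x1 R' by simp
    then show ?thesis unfolding qmult_inner_left x by (simp add: ImH_def quat_inner)
  qed
  moreover have "r \<bullet> \<mu> = 0" using R(2) unfolding R' qmult_inner_left x by simp
  ultimately have "vdet (1, 0) \<mu> (r \<otimes>\<^sub>q \<mu>) r = (\<mu> \<bullet> \<mu>) * (r \<bullet> r)" using \<mu> by (intro vdet_one_im)
  moreover have "vdet x (x \<otimes>\<^sub>q \<mu>) (R \<otimes>\<^sub>q \<mu>) R = vdet (1, 0) \<mu> (r \<otimes>\<^sub>q \<mu>) r"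
    using vdet_qmult[of x "(1, 0)" \<mu> "r \<otimes>\<^sub>q \<mu>" r] x
    by (simp add: x1[symmetric] R' qmult_assoc)
  moreover have "R \<bullet> R = r \<bullet> r" unfolding R' qmult_inner_left x by simp
  ultimately show ?thesis by simp
qed

text \<open>\<open>P + R \<i>\<close> is the complexified gradient of a conformal function.\<close>

lemma positive_tangent_iff_kernel:
  assumes x: "x \<bullet> x = 1" and P: "P \<bullet> x = 0" and R: "R \<bullet> x = 0" "P \<bullet> R = 0"
    and PR: "P \<bullet> P = R \<bullet> R" "R \<noteq> 0"
  shows "(\<exists>\<mu>\<in>ImH. norm \<mu> = 1 \<and> (x \<otimes>\<^sub>q \<mu>) \<bullet> P = 0 \<and> (x \<otimes>\<^sub>q \<mu>) \<bullet> R = 0 \<and> vdet x (x \<otimes>\<^sub>q \<mu>) P R < 0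
      \<and> \<mu> \<otimes>\<^sub>q q = q \<otimes>\<^sub>q quat_i)
    \<longleftrightarrow> P \<otimes>\<^sub>q q + (R \<otimes>\<^sub>q q) \<otimes>\<^sub>q quat_i = 0" (is "?L = ?Q")
proof
  have RR: "R \<bullet> R > 0" using PR by simp
  assume ?L
  then obtain \<mu> where \<mu>: "\<mu> \<in> ImH" "\<mu> \<bullet> \<mu> = 1" "(x \<otimes>\<^sub>q \<mu>) \<bullet> P = 0" "(x \<otimes>\<^sub>q \<mu>) \<bullet> R = 0"
     "vdet x (x \<otimes>\<^sub>q \<mu>) P R < 0" "\<mu> \<otimes>\<^sub>q q = q \<otimes>\<^sub>q quat_i"
    by (auto simp: norm_eq_1)
  define T where "T = x \<otimes>\<^sub>q \<mu>"
  \<comment> \<open>In the plane orthogonal to \<open>x\<close> and \<open>T\<close>, just two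
    vectors are orthogonal to \<open>R\<close> and as long as \<open>R\<close>. \<open>N\<close> is
    the one with the orientation required of \<open>P\<close>, so the aim is
    \<open>P = N\<close>.\<close>
  define N where "N = - (R \<otimes>\<^sub>q \<mu>)"
  have RT: "R \<bullet> T = 0" "P \<bullet> T = 0" using \<mu> by (simp_all add: T_def inner_commute)
  have N1: "N \<bullet> x = 0" using qmult_inner_adjoint[OF \<mu>(1), of R x] RT by (simp add: N_def T_def)
  have N2: "N \<bullet> T = 0" using R(1) by (simp add: N_def T_def qmult_inner_right)
  have N3: "N \<bullet> R = 0" using qmult_inner_adjoint[OF \<mu>(1), of R R] by (simp add: N_def inner_commute)
  have N4: "N \<bullet> N = R \<bullet> R" using \<mu>(2) by (simp add: N_def qmult_inner_right)
  have xT: "x \<bullet> T = 0" using qmult_inner_adjoint[OF \<mu>(1), of x x] by (simp add: T_def inner_commute)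
  have TT: "T \<bullet> T = 1" using \<mu>(2) x by (simp add: T_def qmult_inner_left)
  have "vdet x T N R = - (R \<bullet> R)"
    using vdet_orientation[OF x \<mu>(1) R(1), folded T_def, OF RT(1)] \<mu>(2)
    unfolding N_def vdet_def quat_coords_def det_4 by (simp add: algebra_simps)
  moreover have "vdet x T P R = - (R \<bullet> R)"
  proof -
    have "(vdet x T P R)\<^sup>2 = (R \<bullet> R)\<^sup>2"
      using vdet_gram_orth[OF xT P RT(2) R(1) RT(1) P RT(2) R(1) RT(1)] x TT PR R
      by (simp add: power2_eq_square inner_commute)
    then show ?thesis using \<mu>(5) RR unfolding T_def by (auto simp: power2_eq_iff)
  qed
  moreover have "vdet x T P R * vdet x T N R = (P \<bullet> N) * (R \<bullet> R)"
    using vdet_gram_orth[OF xT P RT(2) R(1) RT(1) N1 N2 R(1) RT(1)] x TT R by simp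
  \<comment> \<open>As \<open>P\<close>, \<open>N\<close> and \<open>R\<close> have the same length,
    this is the equality case of Cauchy-Schwarz and forces \<open>P = N\<close>.\<close>
  ultimately have "P \<bullet> N = R \<bullet> R" using RR by simp
  then have "(P - N) \<bullet> (P - N) = 0"
    using N4 PR by (simp add: inner_diff_left inner_diff_right inner_commute)
  then have "P = - (R \<otimes>\<^sub>q \<mu>)" by (simp add: N_def eq_neg_iff_add_eq_0)
  then show ?Q using \<mu>(6) by (simp add: qmult_linear qmult_assoc)
next
  assume Q: ?Q
  have RR: "R \<bullet> R > 0" using PR by simp
  \<comment> \<open>The only candidate, since it solves
    \<open>P = - (R \<otimes>\<^sub>q \<mu>)\<close>: up to the factor |R|^2, \<open>qcnj R\<close>
    inverts \<open>R\<close>. The hypothesis then reads R \<mu> q = R q i.\<close>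
  define \<mu> where "\<mu> = (- inverse (R \<bullet> R)) *\<^sub>R (qcnj R \<otimes>\<^sub>q P)"
  have P_eq: "P = - (R \<otimes>\<^sub>q \<mu>)" using RR by (simp add: \<mu>_def qmult_linear qcnj_mult)
  have "Re (fst (qcnj R \<otimes>\<^sub>q P)) = R \<bullet> P"
    by (simp add: quat_inner qmult_simps qcnj_def)
  then have \<mu>: "\<mu> \<in> ImH" using R(2) by (simp add: ImH_def \<mu>_def inner_commute)
  have "P \<bullet> P = (R \<bullet> R) * (\<mu> \<bullet> \<mu>)" unfolding P_eq by (simp add: qmult_inner_left)
  then have \<mu>1: "\<mu> \<bullet> \<mu> = 1" using PR RR by simp
  have TR: "R \<bullet> (x \<otimes>\<^sub>q \<mu>) = 0"
    using P qmult_inner_adjoint[OF \<mu>, of R x] by (simp add: P_eq)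
  moreover have "(x \<otimes>\<^sub>q \<mu>) \<bullet> P = 0"
    using R(1) by (simp add: P_eq qmult_inner_right inner_commute)
  moreover have "vdet x (x \<otimes>\<^sub>q \<mu>) P R = - vdet x (x \<otimes>\<^sub>q \<mu>) (R \<otimes>\<^sub>q \<mu>) R"
    unfolding P_eq vdet_def quat_coords_def det_4 by (simp add: algebra_simps)
  moreover have "\<mu> \<otimes>\<^sub>q q = q \<otimes>\<^sub>q quat_i"
  proof -
    have "R \<otimes>\<^sub>q (\<mu> \<otimes>\<^sub>q q) = R \<otimes>\<^sub>q (q \<otimes>\<^sub>q quat_i)"
      using Q unfolding P_eq by (simp add: qmult_linear qmult_assoc add_eq_0_iff)
    then have "(R \<bullet> R) *\<^sub>R (\<mu> \<otimes>\<^sub>q q) = (R \<bullet> R) *\<^sub>R (q \<otimes>\<^sub>q quat_i)"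
      using qcnj_mult(1) by metis
    then show ?thesis using RR by simp
  qed
  ultimately show ?L
    using \<mu> \<mu>1 RR vdet_orientation[OF x \<mu> R(1) TR] by (intro bexI[of _ \<mu>]) (auto simp: norm_eq_1 inner_commute)
qed

section \<open>Conformal submersions in stereographic coordinates\<close>

text \<open>Projection from the pole \<open>s\<close> on the third axis. The extra factor
  \<open>s\<close> in the imaginary part makes the two projections reciprocal to each other, hence
  equally oriented; \<tau> = -1 conjugates both.\<close>

definition stereo :: "real \<Rightarrow> real \<Rightarrow> real^3 \<Rightarrow> complex" where
  "stereo s \<tau> q = of_real (q$1 / (1 - s * q$3)) + \<i> * of_real (\<tau> * s * q$2 / (1 - s * q$3))"

definition dstereo :: "real \<Rightarrow> real \<Rightarrow> real^3 \<Rightarrow> real^3 \<Rightarrow> complex" where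
  "dstereo s \<tau> q v = Complex ((v$1 * (1 - s * q$3) + s * q$1 * v$3) / (1 - s * q$3)\<^sup>2)
     (\<tau> * s * (v$2 * (1 - s * q$3) + s * q$2 * v$3) / (1 - s * q$3)\<^sup>2)"

lemma dstereo_0 [simp]: "dstereo s \<tau> q 0 = 0"
  by (simp add: dstereo_def complex_eq_iff)

lemma has_derivative_stereo:
  assumes "1 - s * q$3 \<noteq> 0"
  shows "(stereo s \<tau> has_derivative dstereo s \<tau> q) (at q)"
proof -
  note vec_nth = bounded_linear.has_derivative[OF bounded_linear_vec_nth has_derivative_ident]
  have quot: "((\<lambda>q. c * q$k / (1 - s * q$3)) has_derivative
      (\<lambda>v. c * (v$k * (1 - s * q$3) + s * q$k * v$3) / (1 - s * q$3)\<^sup>2)) (at q)" for c k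
  proof -
    have "((\<lambda>q. 1 - s * q$3) has_derivative (\<lambda>v. 0 - s * v$3)) (at q)"
      by (intro has_derivative_diff has_derivative_const has_derivative_mult_right vec_nth)
    from has_derivative_divide'[OF has_derivative_mult_right[OF vec_nth] this assms]
    show ?thesis by (simp add: power2_eq_square algebra_simps)
  qed
  have "(stereo s \<tau> has_derivative (\<lambda>v. of_real ((v$1 * (1 - s * q$3) + s * q$1 * v$3) / (1 - s * q$3)\<^sup>2)
    + \<i> * of_real (\<tau> * s * (v$2 * (1 - s * q$3) + s * q$2 * v$3) / (1 - s * q$3)\<^sup>2))) (at q)"
    unfolding stereo_def[abs_def]
    using quot[of 1 1] quot[of "\<tau> * s" 2]
    by (intro has_derivative_add has_derivative_mult_right has_derivative_of_real) simp_all
  then show ?thesis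
    unfolding dstereo_def[abs_def] Complex_eq .
qed

context
  fixes q :: "real^3" and s \<tau> :: real
  assumes q: "q \<bullet> q = 1" and s: "s * s = 1" and \<tau>: "\<tau> * \<tau> = 1" and nz: "1 - s * q$3 \<noteq> 0"
begin

lemma dstereo_inner:
  assumes "v \<bullet> q = 0" "w \<bullet> q = 0"
  shows "dstereo s \<tau> q v \<bullet> dstereo s \<tau> q w = (v \<bullet> w) / (1 - s * q$3)\<^sup>2"
proof -
  define D where "D = 1 - s * q$3"
  have D: "D \<noteq> 0" using nz by (simp add: D_def)
  have h: "q$1 * q$1 + q$2 * q$2 + q$3 * q$3 = 1" "v$1 * q$1 + v$2 * q$2 + v$3 * q$3 = 0"
    "w$1 * q$1 + w$2 * q$2 + w$3 * q$3 = 0"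
    using q assms by (simp_all add: inner_vec_def sum_3)
  have "(v$1 * D + s * q$1 * v$3) * (w$1 * D + s * q$1 * w$3)
      + (\<tau> * s * (v$2 * D + s * q$2 * v$3)) * (\<tau> * s * (w$2 * D + s * q$2 * w$3))
      = D\<^sup>2 * (v$1 * w$1 + v$2 * w$2 + v$3 * w$3)"
    using h s \<tau> unfolding D_def by algebra
  then show ?thesis
    using D unfolding dstereo_def D_def[symmetric] inner_complex_def complex.sel inner_vec_def sum_3
    by (simp add: divide_simps power2_eq_square)
qed

lemma dstereo_area:
  assumes "v \<bullet> q = 0" "w \<bullet> q = 0"
  shows "Re (dstereo s \<tau> q v) * Im (dstereo s \<tau> q w) - Im (dstereo s \<tau> q v) * Re (dstereo s \<tau> q w)
    = - \<tau> * det (vector [q, v, w] :: real^3^3) / (1 - s * q$3)\<^sup>2"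
proof -
  define D where "D = 1 - s * q$3"
  have D: "D \<noteq> 0" using nz by (simp add: D_def)
  have h: "q$1 * q$1 + q$2 * q$2 + q$3 * q$3 = 1" "v$1 * q$1 + v$2 * q$2 + v$3 * q$3 = 0"
    "w$1 * q$1 + w$2 * q$2 + w$3 * q$3 = 0"
    using q assms by (simp_all add: inner_vec_def sum_3)
  define n1 n2 n3 where n: "n1 = v$2 * w$3 - v$3 * w$2" "n2 = v$3 * w$1 - v$1 * w$3" "n3 = v$1 * w$2 - v$2 * w$1"
  define d where "d = q$1 * n1 + q$2 * n2 + q$3 * n3"
  have det: "det (vector [q, v, w] :: real^3^3) = d"
    by (simp add: det_3 d_def n algebra_simps)
  \<comment> \<open>\<open>n\<close> is the cross product of \<open>v\<close> and \<open>w\<close>,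
    hence parallel to the unit vector \<open>q\<close> and equal to \<open>d\<close> times
    it.\<close>
  have "n3 * q$1 = q$3 * n1" "n3 * q$2 = q$3 * n2" using h(2,3) unfolding n by algebra+
  then have n3: "n3 = d * q$3" using h(1) unfolding d_def by algebra
  have "(v$1 * D + s * q$1 * v$3) * (\<tau> * s * (w$2 * D + s * q$2 * w$3))
      - (\<tau> * s * (v$2 * D + s * q$2 * v$3)) * (w$1 * D + s * q$1 * w$3)
      = \<tau> * s * D * (D * n3 - s * (q$1 * n1 + q$2 * n2))"
    unfolding n by algebra
  also have "q$1 * n1 + q$2 * n2 = d - q$3 * n3" by (simp add: d_def)
  also have "\<tau> * s * D * (D * n3 - s * (d - q$3 * n3)) = - \<tau> * D\<^sup>2 * d"
    using s n3 unfolding D_def by algebra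
  finally show ?thesis
    using D unfolding dstereo_def D_def[symmetric] complex.sel det
    by (simp add: divide_simps power2_eq_square)
qed

lemma dstereo_inj:
  assumes "v \<bullet> q = 0"
  shows "dstereo s \<tau> q v = 0 \<longleftrightarrow> v = 0"
  using dstereo_inner[OF assms assms] nz by (metis dstereo_0 divide_eq_0_iff inner_eq_zero_iff zero_eq_power2)

end

section \<open>Gradients of the charts at real points\<close>

lemma has_derivative_sgn:
  fixes x :: "'a::real_inner"
  assumes "x \<noteq> 0"
  shows "(sgn has_derivative (\<lambda>v. (1 / norm x) *\<^sub>R (v - (v \<bullet> sgn x) *\<^sub>R sgn x))) (at x)"
proof -
  have "((\<lambda>y. inverse (norm y) *\<^sub>R y) has_derivative
      (\<lambda>v. inverse (norm x) *\<^sub>R v + (- (inverse (norm x) * (v \<bullet> sgn x) * inverse (norm x))) *\<^sub>R x)) (at x)"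
    using assms
    by (auto intro!: derivative_eq_intros has_derivative_norm)
  moreover have "inverse (norm x) *\<^sub>R v + (- (inverse (norm x) * (v \<bullet> sgn x) * inverse (norm x))) *\<^sub>R x
      = (1 / norm x) *\<^sub>R (v - (v \<bullet> sgn x) *\<^sub>R sgn x)" for v
    by (simp add: sgn_div_norm scaleR_diff_right divide_inverse)
  ultimately show ?thesis by (simp add: sgn_div_norm[abs_def])
qed

lemma exists_orthogonal_area:
  fixes q :: "real^3"
  assumes "q \<bullet> q = 1"
  obtains v w where "v \<bullet> q = 0" "w \<bullet> q = 0" "det (vector [q, v, w] :: real^3^3) \<noteq> 0"
proof -
  obtain v :: "real^3" where v: "v \<noteq> 0" "orthogonal q v"
    using orthogonal_to_vector_exists[of q] by auto
  let ?w = "cross3 q v"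
  have vq: "v \<bullet> q = 0" using v(2) by (simp add: orthogonal_def inner_commute)
  have "det (vector [q, v, ?w] :: real^3^3) = (q \<bullet> q) * (v \<bullet> v) - (v \<bullet> q)\<^sup>2"
    by (simp add: det_3 cross3_def inner_vec_def sum_3 power2_eq_square algebra_simps)
  then show ?thesis
    using v(1) vq assms by (intro that[of v ?w]) (simp_all add: dot_cross_self inner_commute)
qed

text \<open>\<open>P\<close> and \<open>R\<close> are the real and imaginary gradients of the chart
  extended to be constant on rays. They are orthogonal to vertical vectors, hence horizontal, so
  conformality may be tested on \<open>P\<close> and \<open>R\<close> themselves and no orthonormal
  frame is chosen.\<close>

lemma conformal_gradient:
  fixes \<pi> :: "quat \<Rightarrow> real^3" and x P R :: quat
  assumes conf: "conformal_submersion \<pi>" and x: "x \<noteq> 0"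
    and s: "s * s = 1" and \<tau>: "\<tau> * \<tau> = 1" and nz: "1 - s * \<pi> (sgn x) $ 3 \<noteq> 0"
    and L: "((\<lambda>y. stereo s \<tau> (\<pi> (sgn y))) has_derivative (\<lambda>v. Complex (P \<bullet> v) (R \<bullet> v))) (at x)"
  shows "P \<bullet> x = 0" "R \<bullet> x = 0" "P \<bullet> R = 0" "P \<bullet> P = R \<bullet> R" "R \<noteq> 0"
    "norm x = 1 \<Longrightarrow> v \<bullet> x = 0 \<Longrightarrow> v \<in> vertical \<pi> x \<longleftrightarrow> v \<bullet> P = 0 \<and> v \<bullet> R = 0"
    "norm x = 1 \<Longrightarrow> A \<bullet> x = 0 \<Longrightarrow> B \<bullet> x = 0 \<Longrightarrow>
      vol2 o2 (\<pi> x) (sphere_diff \<pi> x A) (sphere_diff \<pi> x B)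
        = - o2 * \<tau> * (1 - s * \<pi> x $ 3)\<^sup>2 * ((P \<bullet> A) * (R \<bullet> B) - (R \<bullet> A) * (P \<bullet> B))"
proof -
  define u where "u = sgn x"
  define q where "q = \<pi> u"
  define D where "D = 1 - s * q$3"
  define D1 where "D1 = sphere_diff \<pi> u"
  have u: "u \<in> sphere 0 1" "u \<bullet> u = 1" using x by (simp_all add: u_def norm_sgn norm_eq_1[symmetric])
  have qS: "q \<in> sphere 0 1" using conf u unfolding conformal_submersion_def q_def by blast
  have q: "q \<bullet> q = 1" using qS by (simp add: norm_eq_1[symmetric])
  have D: "D \<noteq> 0" using nz by (simp add: D_def q_def u_def)
  have diff: "\<pi> differentiable (at u within sphere 0 1)"
    and img: "D1 ` sphere_tangent u = sphere_tangent q"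
    and con: "conformal_on D1 (horizontal \<pi> u)"
    using conf u unfolding conformal_submersion_def D1_def q_def by blast+
  have D1: "(\<pi> has_derivative D1) (at u within sphere 0 1)"
    using diff unfolding D1_def sphere_diff_def by (simp add: frechet_derivative_works)
  define pr where "pr v = (1 / norm x) *\<^sub>R (v - (v \<bullet> u) *\<^sub>R u)" for v
  \<comment> \<open>\<pi> is differentiable only within the sphere, so the chain rule is applied on
    a set that \<open>sgn\<close> maps into the sphere.\<close>
  have "(sgn has_derivative pr) (at x within - {0})"
    using has_derivative_sgn[OF x] unfolding pr_def[abs_def] u_def by (rule has_derivative_at_withinI)
  moreover have "(\<pi> has_derivative D1) (at (sgn x) within sgn ` (- {0}))"
  proof (rule has_derivative_subset)
    show "(\<pi> has_derivative D1) (at (sgn x) within sphere 0 1)" using D1 by (simp only: u_def)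
    show "sgn ` (- {0 :: quat}) \<subseteq> sphere 0 1" by (rule image_subsetI) (simp add: norm_sgn)
  qed
  ultimately have "((\<lambda>y. \<pi> (sgn y)) has_derivative (\<lambda>v. D1 (pr v))) (at x within - {0})"
    by (rule has_derivative_in_compose)
  then have "((\<lambda>y. \<pi> (sgn y)) has_derivative (\<lambda>v. D1 (pr v))) (at x)"
    using at_within_open[of x "- {0}"] x by (simp only: open_Compl closed_singleton Compl_iff singleton_iff not_False_eq_True)
  from has_derivative_compose[OF this has_derivative_stereo[of s "\<pi> (sgn x)" \<tau>]]
  have "((\<lambda>y. stereo s \<tau> (\<pi> (sgn y))) has_derivative (\<lambda>v. dstereo s \<tau> q (D1 (pr v)))) (at x)"
    using nz by (simp add: q_def u_def)
  from has_derivative_unique[OF L this]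
  have LD: "Complex (P \<bullet> v) (R \<bullet> v) = dstereo s \<tau> q (D1 (pr v))" for v by (rule fun_cong)
  have lin: "linear D1" using D1 has_derivative_linear by blast
  have tq: "D1 v \<bullet> q = 0" if "v \<bullet> u = 0" for v
    using img that unfolding sphere_tangent_def by blast
  define M where "M v = (1 / norm x) *\<^sub>R D1 v" for v
  have LM: "Complex (P \<bullet> v) (R \<bullet> v) = dstereo s \<tau> q (M v)" and Mq: "M v \<bullet> q = 0" if "v \<bullet> u = 0" for v
    using that LD[of v] tq[OF that] lin by (simp_all add: pr_def M_def linear_cmul)
  have xu: "norm x *\<^sub>R u = x" using x by (simp add: u_def sgn_div_norm)
  have "x \<bullet> u = (norm x *\<^sub>R u) \<bullet> u" by (simp only: xu)
  then have "x \<bullet> u = norm x" using u(2) by simp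
  then have "pr x = 0" by (simp add: pr_def xu)
  then show Px: "P \<bullet> x = 0" and Rx: "R \<bullet> x = 0"
    using LD[of x] lin by (simp_all add: linear_0 complex_eq_iff)
  have Pu: "P \<bullet> u = 0" "R \<bullet> u = 0" using Px Rx x by (simp_all add: u_def sgn_div_norm)
  have nx: "norm x \<noteq> 0" using x by simp
  have vert: "P \<bullet> v = 0" "R \<bullet> v = 0" if "v \<in> vertical \<pi> u" for v
    using LM[of v] that by (simp_all add: vertical_def sphere_tangent_def M_def D1_def complex_eq_iff)
  have hor: "P \<in> horizontal \<pi> u" "R \<in> horizontal \<pi> u"
    using vert Pu by (simp_all add: horizontal_def sphere_tangent_def)
  obtain c where c: "\<And>v w. v \<in> horizontal \<pi> u \<Longrightarrow> w \<in> horizontal \<pi> u \<Longrightarrow> D1 v \<bullet> D1 w = c * (v \<bullet> w)"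
    using con unfolding conformal_on_def by blast
  define K where "K = c / ((norm x)\<^sup>2 * D\<^sup>2)"
  have K: "Complex (P \<bullet> v) (R \<bullet> v) \<bullet> Complex (P \<bullet> w) (R \<bullet> w) = K * (v \<bullet> w)"
    if "v \<in> horizontal \<pi> u" "w \<in> horizontal \<pi> u" for v w
  proof -
    have vw: "v \<bullet> u = 0" "w \<bullet> u = 0" using that by (simp_all add: horizontal_def sphere_tangent_def)
    show ?thesis
      unfolding LM[OF vw(1)] LM[OF vw(2)]
      using dstereo_inner[OF q s \<tau> _ Mq[OF vw(1)] Mq[OF vw(2)]] D c[OF that]
      by (simp add: D_def K_def M_def power2_eq_square divide_simps)
  qed
  \<comment> \<open>The derivative sends tangent v to (P \<bullet> v, R \<bullet> v). Conformality
    on the pairs (P, P), (R, R) and (P, R) gives three relations whose only solution with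
    \<open>P\<close> and \<open>R\<close> independent is m = 0, a = b = K.\<close>
  define a b m where "a = P \<bullet> P" "b = R \<bullet> R" "m = P \<bullet> R"
  have 1: "a * a + m * m = K * a" "m * m + b * b = K * b" "a * m + m * b = K * m"
    using K[OF hor(1,1)] K[OF hor(2,2)] K[OF hor(1,2)]
    by (simp_all add: a_b_m_def inner_complex_def inner_commute)
  have area: "(P \<bullet> v) * (R \<bullet> w) - (R \<bullet> v) * (P \<bullet> w) = - \<tau> * det (vector [q, M v, M w] :: real^3^3) / D\<^sup>2"
    if vw: "v \<bullet> u = 0" "w \<bullet> u = 0" for v w
    using dstereo_area[OF q s \<tau> _ Mq[OF vw(1)] Mq[OF vw(2)]] D
    unfolding LM[OF vw(1), symmetric] LM[OF vw(2), symmetric] D_def[symmetric] by simp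
  \<comment> \<open>Equality would make \<open>P\<close> and \<open>R\<close> dependent and the area
    form of the derivative zero, whereas surjectivity supplies vectors on which it is not.\<close>
  have indep: "a * b \<noteq> m * m"
  proof
    assume ab: "a * b = m * m"
    obtain v' w' where vw': "v' \<bullet> q = 0" "w' \<bullet> q = 0" "det (vector [q, v', w'] :: real^3^3) \<noteq> 0"
      using exists_orthogonal_area[OF q] .
    have "norm x *\<^sub>R v' \<in> sphere_tangent q" "norm x *\<^sub>R w' \<in> sphere_tangent q"
      using vw' by (simp_all add: sphere_tangent_def)
    then obtain v w where vw: "v \<bullet> u = 0" "w \<bullet> u = 0" "D1 v = norm x *\<^sub>R v'" "D1 w = norm x *\<^sub>R w'"
      unfolding img[symmetric] by (auto simp: sphere_tangent_def)
    then have "M v = v'" "M w = w'" using nx by (simp_all add: M_def)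
    then have ne: "(P \<bullet> v) * (R \<bullet> w) - (R \<bullet> v) * (P \<bullet> w) \<noteq> 0"
      using area[OF vw(1,2)] vw'(3) D \<tau> by auto
    have "(a *\<^sub>R R - m *\<^sub>R P) \<bullet> (a *\<^sub>R R - m *\<^sub>R P) = a * (a * b - m * m)"
      by (simp add: inner_diff_left inner_diff_right inner_commute a_b_m_def algebra_simps)
    then have "a *\<^sub>R R - m *\<^sub>R P = 0" using ab by simp
    then have aR: "a *\<^sub>R R = m *\<^sub>R P" by simp
    have "a * ((P \<bullet> v) * (R \<bullet> w) - (R \<bullet> v) * (P \<bullet> w)) = (P \<bullet> v) * ((a *\<^sub>R R) \<bullet> w) - ((a *\<^sub>R R) \<bullet> v) * (P \<bullet> w)"
      by (simp add: algebra_simps)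
    also have "\<dots> = 0" unfolding aR by simp
    finally have "a = 0" using ne by simp
    then have "P = 0" by (simp add: a_b_m_def)
    with ne show False by simp
  qed
  have m0: "m = 0"
  proof (rule ccontr)
    assume "m \<noteq> 0"
    then have "a + b = K" using 1(3) by (metis distrib_left mult.commute mult_cancel_left)
    then have "a * a + m * m = (a + b) * a" using 1(1) by simp
    then have "a * b = m * m" by (simp add: algebra_simps)
    with indep show False by simp
  qed
  then show "P \<bullet> R = 0" by (simp add: a_b_m_def)
  have ab0: "a \<noteq> 0" "b \<noteq> 0" using indep m0 by auto
  then show "R \<noteq> 0" by (auto simp: a_b_m_def)
  have "a = K" "b = K" using 1(1,2) m0 ab0 by auto
  then show "P \<bullet> P = R \<bullet> R" by (simp add: a_b_m_def)
  show "v \<in> vertical \<pi> x \<longleftrightarrow> v \<bullet> P = 0 \<and> v \<bullet> R = 0" if "norm x = 1" "v \<bullet> x = 0" for v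
  proof -
    have ux: "u = x" using that by (simp add: u_def sgn_div_norm)
    have "v \<in> vertical \<pi> x \<longleftrightarrow> D1 v = 0"
      using that ux by (simp add: vertical_def sphere_tangent_def D1_def)
    also have "\<dots> \<longleftrightarrow> dstereo s \<tau> q (M v) = 0"
      using dstereo_inj[OF q s \<tau> _ Mq[of v]] D that ux by (simp add: D_def M_def)
    also have "\<dots> \<longleftrightarrow> Complex (P \<bullet> v) (R \<bullet> v) = 0"
      using LM[of v] that ux by simp
    finally show ?thesis by (simp add: complex_eq_iff inner_commute)
  qed
  show "vol2 o2 (\<pi> x) (sphere_diff \<pi> x A) (sphere_diff \<pi> x B)
        = - o2 * \<tau> * (1 - s * \<pi> x $ 3)\<^sup>2 * ((P \<bullet> A) * (R \<bullet> B) - (R \<bullet> A) * (P \<bullet> B))"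
    if "norm x = 1" "A \<bullet> x = 0" "B \<bullet> x = 0" for A B
  proof -
    have ux: "u = x" using that by (simp add: u_def sgn_div_norm)
    have "M A = sphere_diff \<pi> x A" "M B = sphere_diff \<pi> x B" using that ux by (simp_all add: M_def D1_def)
    then show ?thesis
      using area[of A B] that ux D \<tau> unfolding vol2_def by (simp add: D_def q_def)
  qed
qed

text \<open>With \<tau> = o2 o3 the sign \<open>o2\<close> drops out of the condition on
  \<open>vol2\<close>, and the remaining \<open>o3\<close> cancels against that of
  \<open>vol3\<close>. By the Gram identity the condition on all pairs \<open>A\<close>,
  \<open>B\<close> then becomes a single sign.\<close>

lemma positive_fiber_tangent_iff:
  fixes \<pi> :: "quat \<Rightarrow> real^3" and x P R :: quat
  assumes conf: "conformal_submersion \<pi>" and x: "norm x = 1"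
    and o: "o3 \<in> {1, -1}" "o2 \<in> {1, -1}"
    and s: "s * s = 1" and nz: "1 - s * \<pi> x $ 3 \<noteq> 0"
    and L: "((\<lambda>y. stereo s (o2 * o3) (\<pi> (sgn y))) has_derivative (\<lambda>v. Complex (P \<bullet> v) (R \<bullet> v))) (at x)"
  shows "positive_fiber_tangent o3 o2 \<pi> x T \<longleftrightarrow>
    T \<noteq> 0 \<and> T \<bullet> x = 0 \<and> T \<bullet> P = 0 \<and> T \<bullet> R = 0 \<and> vdet x T P R < 0"
proof -
  have sx: "sgn x = x" "x \<noteq> 0" using x by (auto simp: sgn_div_norm)
  have \<tau>: "(o2 * o3) * (o2 * o3) = 1" using o by auto
  have nz': "1 - s * \<pi> (sgn x) $ 3 \<noteq> 0" using nz sx by simp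
  note cg = conformal_gradient[OF conf sx(2) s \<tau> nz' L]
  define J where "J A B = (P \<bullet> A) * (R \<bullet> B) - (R \<bullet> A) * (P \<bullet> B)" for A B
  have vol2: "vol2 o2 (\<pi> x) (sphere_diff \<pi> x A) (sphere_diff \<pi> x B) > 0 \<longleftrightarrow> o3 * J A B < 0"
    if "A \<bullet> x = 0" "B \<bullet> x = 0" for A B
    using cg(7)[OF x that, of o2] o nz
    by (auto simp: J_def[symmetric] zero_less_mult_iff mult_less_0_iff)
  have vol3: "vol3 o3 x T A B = o3 * vdet x T A B" for A B
    by (simp add: vol3_def vdet_def)
  have gram: "vdet x T A B * vdet x T P R = (T \<bullet> T) * J A B"
    if "T \<bullet> x = 0" "T \<bullet> P = 0" "T \<bullet> R = 0" "A \<bullet> x = 0" "A \<bullet> T = 0" "B \<bullet> x = 0" "B \<bullet> T = 0" for A B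
    using vdet_gram_orth[of x T A B P R] that cg(1,2) x
    by (simp add: inner_commute J_def norm_eq_1 algebra_simps)
  have PR: "P \<bullet> P > 0" "R \<bullet> R > 0" using cg(4,5) by simp_all
  show ?thesis
  proof (cases "T \<noteq> 0 \<and> T \<bullet> x = 0 \<and> T \<bullet> P = 0 \<and> T \<bullet> R = 0")
    case False
    moreover have "T \<bullet> x = 0" "T \<in> vertical \<pi> x" "T \<noteq> 0" if "positive_fiber_tangent o3 o2 \<pi> x T"
      using that by (simp_all add: positive_fiber_tangent_def vertical_def sphere_tangent_def)
    ultimately show ?thesis
      using cg(6)[OF x, of T] by blast
  next
    case True
    then have Tv: "T \<in> vertical \<pi> x" using cg(6)[OF x, of T] by simp
    have TT: "T \<bullet> T > 0" using True by simp
    have JPR: "J P R > 0" "J R P < 0"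
      using PR cg(3) by (simp_all add: J_def inner_commute)
    have dPR: "vdet x T P R * vdet x T P R > 0"
      using gram[of P R] True cg(1,2) JPR TT by (simp add: inner_commute)
    have anti: "vdet x T R P = - vdet x T P R"
      by (simp add: vdet_def det_4 algebra_simps)
    have "positive_fiber_tangent o3 o2 \<pi> x T \<longleftrightarrow> (\<forall>A\<in>sphere_tangent x. \<forall>B\<in>sphere_tangent x.
        A \<bullet> T = 0 \<longrightarrow> B \<bullet> T = 0 \<longrightarrow> o3 * J A B < 0 \<longrightarrow> o3 * vdet x T A B > 0)"
      using Tv True vol2 by (auto simp: positive_fiber_tangent_def vol3 sphere_tangent_def)
    also have "\<dots> \<longleftrightarrow> vdet x T P R < 0"
    proof
      assume h: "\<forall>A\<in>sphere_tangent x. \<forall>B\<in>sphere_tangent x.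
        A \<bullet> T = 0 \<longrightarrow> B \<bullet> T = 0 \<longrightarrow> o3 * J A B < 0 \<longrightarrow> o3 * vdet x T A B > 0"
      have t: "P \<in> sphere_tangent x" "R \<in> sphere_tangent x" "P \<bullet> T = 0" "R \<bullet> T = 0"
        using cg(1,2) True by (simp_all add: sphere_tangent_def inner_commute)
      show "vdet x T P R < 0"
        \<comment> \<open>The pair (P, R) serves for o3 = -1 and (R, P) for o3 = 1.\<close>
        using o(1) h[rule_format, OF t] h[rule_format, OF t(2,1,4,3)] JPR anti by auto
    next
      assume neg: "vdet x T P R < 0"
      show "\<forall>A\<in>sphere_tangent x. \<forall>B\<in>sphere_tangent x.
        A \<bullet> T = 0 \<longrightarrow> B \<bullet> T = 0 \<longrightarrow> o3 * J A B < 0 \<longrightarrow> o3 * vdet x T A B > 0"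
      proof (intro ballI impI)
        fix A B assume AB: "A \<in> sphere_tangent x" "B \<in> sphere_tangent x" "A \<bullet> T = 0" "B \<bullet> T = 0" "o3 * J A B < 0"
        have "(o3 * vdet x T A B) * vdet x T P R = (T \<bullet> T) * (o3 * J A B)"
          using gram[of A B] AB True by (simp add: sphere_tangent_def)
        also have "\<dots> < 0" using AB(5) TT by (simp add: mult_less_0_iff)
        finally show "o3 * vdet x T A B > 0" using neg by (simp add: mult_less_0_iff)
      qed
    qed
    finally show ?thesis using True by blast
  qed
qed

section \<open>Complexified conformal charts\<close>

lemma cdot_eqI: "(\<And>v. cdot g v = cdot h v) \<Longrightarrow> g = h"
  by (metis cdot_axis(1) mult.right_neutral vec_eq_iff)

text \<open>The real basis 1, i, j, j i. The last one is -k, so the coordinates are plain real and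
  imaginary parts, unlike those of \<open>quat_coords\<close>.\<close>

definition quat_basis :: "4 \<Rightarrow> quat" where
  "quat_basis i = (vector [(1, 0), (\<i>, 0), (0, 1), (0, \<i>)] :: quat^4) $ i"

lemma quat_basis_simps [simp]: "quat_basis 1 = (1, 0)" "quat_basis 2 = (\<i>, 0)" "quat_basis 3 = (0, 1)" "quat_basis 4 = (0, \<i>)"
  by (simp_all add: quat_basis_def)

lemma bij_quat_basis: "bij_betw quat_basis UNIV Basis"
proof (rule bij_betw_imageI)
  show "inj quat_basis" unfolding inj_def forall_4 by simp
  show "range quat_basis = Basis" unfolding UNIV_4 by (auto simp: Basis_prod_def Basis_complex_def)
qed

abbreviation cquat :: "quat \<Rightarrow> complex^4" where "cquat \<equiv> cvec quat_basis"

lemma cquat_nth: "cquat x $ 1 = of_real (Re (fst x))" "cquat x $ 2 = of_real (Im (fst x))"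
  "cquat x $ 3 = of_real (Re (snd x))" "cquat x $ 4 = of_real (Im (snd x))"
  by (simp_all add: cvec_def quat_inner)

lemma real_vec_cquat:
  assumes "\<forall>i. w $ i \<in> \<real>"
  obtains x where "w = cquat x"
proof
  show "w = cquat (Complex (Re (w$1)) (Re (w$2)), Complex (Re (w$3)) (Re (w$4)))"
    using assms by (simp add: vec_eq_iff forall_4 cquat_nth of_real_Re)
qed

lemma bounded_linear_cquat: "bounded_linear cquat"
proof (rule bounded_linear_intro[where K = 1])
  show "cquat (r *\<^sub>R x) = r *\<^sub>R cquat x" for r x
    by (simp add: vec_eq_iff cvec_def scaleR_conv_of_real[where 'a = complex])
qed (simp_all add: cvec_linear norm_cvec[OF bij_quat_basis])

lemmas cquat_mem_ball = cvec_mem_ball[OF bij_quat_basis]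

text \<open>Together with \<open>grad_im\<close> this is the decomposition W = cquat P + i cquat R
  of a complexified quaternion.\<close>

definition grad_re :: "complex^4 \<Rightarrow> quat" where
  "grad_re W = (Complex (Re (W$1)) (Re (W$2)), Complex (Re (W$3)) (Re (W$4)))"

definition grad_im :: "complex^4 \<Rightarrow> quat" where
  "grad_im W = (Complex (Im (W$1)) (Im (W$2)), Complex (Im (W$3)) (Im (W$4)))"

lemma cdot_cquat: "cdot W (cquat v) = Complex (grad_re W \<bullet> v) (grad_im W \<bullet> v)"
  by (simp add: complex_eq_iff cdot_def sum_4 cquat_nth quat_inner grad_re_def grad_im_def)

text \<open>Turns conformality into a holomorphic equation: null means orthogonal real and imaginary
  parts of equal length.\<close>

lemma cdot_self: "cdot W W = Complex (grad_re W \<bullet> grad_re W - grad_im W \<bullet> grad_im W) (2 * (grad_re W \<bullet> grad_im W))"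
  by (simp add: complex_eq_iff cdot_def sum_4 quat_inner grad_re_def grad_im_def)

lemma has_derivative_real_points:
  assumes "holo w U" "cquat x \<in> U"
  shows "((\<lambda>y. w (cquat y)) has_derivative
    (\<lambda>v. Complex (grad_re (cgrad w (cquat x)) \<bullet> v) (grad_im (cgrad w (cquat x)) \<bullet> v))) (at x)"
  using has_derivative_compose[OF bounded_linear_imp_has_derivative[OF bounded_linear_cquat]
      holo_derivative[OF assms]]
  by (simp add: cdot_cquat)

lemma stereo_antipodal:
  assumes q: "q \<bullet> q = 1" and s: "s * s = 1" and \<tau>: "\<tau> * \<tau> = 1"
    and nz: "1 - s * q$3 \<noteq> 0" "1 - (- s) * q$3 \<noteq> 0"
  shows "stereo s \<tau> q * stereo (- s) \<tau> q = 1"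
proof -
  have h: "q$1 * q$1 + q$2 * q$2 + q$3 * q$3 = 1"
    using q by (simp add: inner_vec_def sum_3)
  have "(q$1) * (q$1) - (\<tau> * s * q$2) * (\<tau> * (- s) * q$2) = (1 - s * q$3) * (1 - (- s) * q$3)"
    using h s \<tau> by algebra
  then show ?thesis
    using nz by (simp add: stereo_def complex_eq_iff divide_simps)
qed

text \<open>The sign \<open>s\<close> selects the pole of the stereographic projection and \<open>\<tau>\<close> its orientation.\<close>

definition conformal_chart ::
    "(quat \<Rightarrow> real^3) \<Rightarrow> real \<Rightarrow> quat \<Rightarrow> real \<Rightarrow> real \<Rightarrow> (complex^4 \<Rightarrow> complex) \<Rightarrow> bool" where
  "conformal_chart \<pi> \<tau> p s r w \<longleftrightarrow> s * s = 1 \<and> r > 0 \<and> holo w (ball (cquat p) r) \<and>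
     (\<forall>x\<in>ball p r. x \<noteq> 0 \<and> 1 - s * \<pi> (sgn x) $ 3 \<noteq> 0 \<and> w (cquat x) = stereo s \<tau> (\<pi> (sgn x))) \<and>
     (\<forall>z\<in>ball (cquat p) r. cgrad w z \<noteq> 0)"

lemma chart_gradient:
  assumes "holo w (ball (cquat p) r)" and x: "x \<in> ball p r"
    and w: "\<And>x. x \<in> ball p r \<Longrightarrow> w (cquat x) = stereo s \<tau> (\<pi> (sgn x))"
  shows "((\<lambda>y. stereo s \<tau> (\<pi> (sgn y))) has_derivative
    (\<lambda>v. Complex (grad_re (cgrad w (cquat x)) \<bullet> v) (grad_im (cgrad w (cquat x)) \<bullet> v))) (at x)"
proof (rule has_derivative_transform_within_open[OF _ open_ball x])
  show "((\<lambda>y. w (cquat y)) has_derivative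
    (\<lambda>v. Complex (grad_re (cgrad w (cquat x)) \<bullet> v) (grad_im (cgrad w (cquat x)) \<bullet> v))) (at x)"
    using assms(1) cquat_mem_ball[THEN iffD2, OF x] by (rule has_derivative_real_points)
qed (rule w)

lemma cquat_ball_identity:
  assumes f: "holo f U" and U: "convex U" "U \<subseteq> ball (cquat p) r" "z \<in> U" "re_vec z \<in> U"
    and real: "\<And>x. x \<in> ball p r \<Longrightarrow> cquat x \<in> U \<Longrightarrow> f (cquat x) = 0"
  shows "f z = 0"
proof (rule holo_identity_real[OF f U(1,3,4)])
  fix w assume w: "w \<in> U" "\<forall>i. w $ i \<in> \<real>"
  obtain x where x: "w = cquat x" using real_vec_cquat[OF w(2)] .
  then have "cquat x \<in> U" "cquat x \<in> ball (cquat p) r" using w(1) U(2) by blast+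
  then show "f w = 0" unfolding x using cquat_mem_ball by (intro real) blast+
qed

lemma re_vec_ball:
  assumes "z \<in> ball (cquat p) r"
  shows "re_vec z \<in> ball (cquat p) r"
proof -
  have "norm (re_vec z - cquat p) \<le> norm (z - cquat p)"
  proof (rule norm_le_componentwise_cart)
    fix i
    have "(re_vec z - cquat p) $ i = of_real (Re ((z - cquat p) $ i))"
      by (simp add: re_vec_def cvec_def)
    then show "norm ((re_vec z - cquat p) $ i) \<le> norm ((z - cquat p) $ i)"
      by (simp only: norm_of_real abs_Re_le_cmod)
  qed
  then show ?thesis using assms by (simp add: dist_norm norm_minus_commute)
qed

context
  fixes \<pi> :: "quat \<Rightarrow> real^3" and \<tau> :: real
  assumes conf: "conformal_submersion \<pi>" and \<tau>: "\<tau> * \<tau> = 1"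
begin

lemma chart_real_gradient:
  assumes "conformal_chart \<pi> \<tau> p s r w" "x \<in> ball p r"
  shows "cdot (cgrad w (cquat x)) (cgrad w (cquat x)) = 0" "cdot (cgrad w (cquat x)) (cquat x) = 0"
proof -
  have "x \<noteq> 0" "s * s = 1" "1 - s * \<pi> (sgn x) $ 3 \<noteq> 0" "holo w (ball (cquat p) r)"
    "\<And>x. x \<in> ball p r \<Longrightarrow> w (cquat x) = stereo s \<tau> (\<pi> (sgn x))"
    using assms by (auto simp: conformal_chart_def)
  note cg = conformal_gradient[OF conf this(1,2) \<tau> this(3) chart_gradient[OF this(4) assms(2) this(5)]]
  show "cdot (cgrad w (cquat x)) (cgrad w (cquat x)) = 0"
    using cg(3,4) by (simp add: cdot_self complex_eq_iff)
  show "cdot (cgrad w (cquat x)) (cquat x) = 0"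
    using cg(1,2) by (simp add: cdot_cquat complex_eq_iff)
qed

lemma holo_cdot:
  assumes "\<And>i. holo (\<lambda>z. f z $ i) U" "\<And>i. holo (\<lambda>z. g z $ i) U"
  shows "holo (\<lambda>z. cdot (f z) (g z)) U"
  unfolding cdot_def using assms holo_open by (intro holo_sum holo_mult) blast+

text \<open>The first two hold at real points, the second because the chart is constant on rays, and
  extend by the identity theorem. Differentiating the first in direction \<open>b\<close> gives the
  third up to exchanging the indices of a second derivative; after that exchange it says that W is
  stationary along W.\<close>

lemma chart_null:
  assumes c: "conformal_chart \<pi> \<tau> p s r w" and z: "z \<in> ball (cquat p) r"
  shows "cdot (cgrad w z) (cgrad w z) = 0" "cdot (cgrad w z) z = 0"
    "cdot (cgrad (\<lambda>z. cgrad w z $ b) z) (cgrad w z) = 0"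
proof -
  have h: "holo w (ball (cquat p) r)" using c by (simp add: conformal_chart_def)
  have hb: "holo (\<lambda>z. cdot (cgrad w z) (cgrad w z)) (ball (cquat p) r)" "holo (\<lambda>z. cdot (cgrad w z) z) (ball (cquat p) r)"
    by (rule holo_cdot; intro holo_cgrad[OF h] holo_nth open_ball)+
  have 1: "cdot (cgrad w z) (cgrad w z) = 0" if z: "z \<in> ball (cquat p) r" for z
    by (rule cquat_ball_identity[OF hb(1) convex_ball order_refl z re_vec_ball[OF z]])
       (rule chart_real_gradient(1)[OF c])
  show "cdot (cgrad w z) (cgrad w z) = 0" using 1 z .
  show "cdot (cgrad w z) z = 0"
    by (rule cquat_ball_identity[OF hb(2) convex_ball order_refl z re_vec_ball[OF z]])
       (rule chart_real_gradient(2)[OF c])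
  have "((\<lambda>z. \<Sum>a\<in>UNIV. cgrad w z $ a * cgrad w z $ a) has_derivative
    (\<lambda>v. \<Sum>a\<in>UNIV. cgrad w z $ a * cdot (cgrad (\<lambda>z. cgrad w z $ a) z) v + cdot (cgrad (\<lambda>z. cgrad w z $ a) z) v * cgrad w z $ a)) (at z)"
    by (intro has_derivative_sum has_derivative_mult holo_derivative[OF holo_cgrad[OF h] z])
  then have "((\<lambda>z. cdot (cgrad w z) (cgrad w z)) has_derivative
    (\<lambda>v. \<Sum>a\<in>UNIV. cgrad w z $ a * cdot (cgrad (\<lambda>z. cgrad w z $ a) z) v + cdot (cgrad (\<lambda>z. cgrad w z $ a) z) v * cgrad w z $ a)) (at z)"
    by (simp only: cdot_def[of "cgrad w u" "cgrad w u" for u])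
  moreover have "((\<lambda>z. cdot (cgrad w z) (cgrad w z)) has_derivative (\<lambda>v. 0)) (at z)"
    by (rule has_derivative_transform_within_open[OF has_derivative_const[of 0] open_ball z]) (simp add: 1)
  ultimately have "(\<lambda>v. \<Sum>a\<in>UNIV. cgrad w z $ a * cdot (cgrad (\<lambda>z. cgrad w z $ a) z) v + cdot (cgrad (\<lambda>z. cgrad w z $ a) z) v * cgrad w z $ a) = (\<lambda>v. 0)"
    by (rule has_derivative_unique)
  from fun_cong[OF this, of "axis b 1"]
  have "(\<Sum>a\<in>UNIV. 2 * (cgrad (\<lambda>z. cgrad w z $ a) z $ b * cgrad w z $ a)) = 0"
    by (simp add: mult.commute)
  then have "(\<Sum>a\<in>UNIV. cgrad (\<lambda>z. cgrad w z $ a) z $ b * cgrad w z $ a) = 0"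
    by (simp add: sum_distrib_left[symmetric])
  then show "cdot (cgrad (\<lambda>z. cgrad w z $ b) z) (cgrad w z) = 0"
    unfolding cdot_def cgrad_symmetric[OF h z, of b] .
qed

text \<open>At real points the two charts are equal or reciprocal, according to whether their poles
  agree, and by the identity theorem so they are on the whole overlap. Proportional gradients are
  enough, since only kernels are used.\<close>

lemma chart_overlap:
  assumes c: "conformal_chart \<pi> \<tau> p s r w" "conformal_chart \<pi> \<tau> p' s' r' w'"
    and z: "z \<in> ball (cquat p) r" "z \<in> ball (cquat p') r'"
  shows "\<exists>k. k \<noteq> 0 \<and> cgrad w z = k *s cgrad w' z"
proof -
  define U where "U = ball (cquat p) r \<inter> ball (cquat p') r'"
  have U: "open U" "convex U" "U \<subseteq> ball (cquat p) r" by (auto simp: U_def intro: convex_Int)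
  have hw: "holo w U" "holo w' U"
    using c U(1) by (auto simp: conformal_chart_def U_def intro: holo_subset)
  have reU: "re_vec z \<in> U" if "z \<in> U" for z using that re_vec_ball unfolding U_def by blast
  have zU: "z \<in> U" using z by (simp add: U_def)
  have xU: "x \<in> ball p' r'" if "cquat x \<in> U" for x
    using that cquat_mem_ball[of x p' r'] unfolding U_def by blast
  have ss: "s * s = 1" "s' * s' = 1" using c by (auto simp: conformal_chart_def)
  consider "s' = s" | "s' = - s" using ss by (metis square_eq_iff)
  then show ?thesis
  proof cases
    case 1
    have eq: "w z - w' z = 0" if "z \<in> U" for z
    proof (rule cquat_ball_identity[OF holo_diff[OF hw] U(2,3) that reU[OF that]])
      fix x assume "x \<in> ball p r" "cquat x \<in> U"
      then show "w (cquat x) - w' (cquat x) = 0"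
        using c xU[of x] 1 unfolding conformal_chart_def by simp
    qed
    have "(w has_derivative cdot (cgrad w' z)) (at z)"
      by (rule has_derivative_transform_within_open[OF holo_derivative[OF hw(2) zU] U(1) zU]) (use eq in simp)
    from cgrad_eqI[OF this] show ?thesis by (intro exI[of _ 1]) simp
  next
    case 2
    have eq: "w z * w' z - 1 = 0" if "z \<in> U" for z
    proof (rule cquat_ball_identity[OF _ U(2,3) that reU[OF that], of "\<lambda>z. w z * w' z - 1"])
      show "holo (\<lambda>z. w z * w' z - 1) U" using hw U(1) by (intro holo_diff holo_mult holo_const)
      fix x assume x: "x \<in> ball p r" "cquat x \<in> U"
      have "x \<noteq> 0" "1 - s * \<pi> (sgn x) $ 3 \<noteq> 0" "1 - (- s) * \<pi> (sgn x) $ 3 \<noteq> 0"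
        "w (cquat x) = stereo s \<tau> (\<pi> (sgn x))" "w' (cquat x) = stereo (- s) \<tau> (\<pi> (sgn x))"
        using c x xU[of x] 2 unfolding conformal_chart_def by auto
      moreover have "\<pi> (sgn x) \<bullet> \<pi> (sgn x) = 1"
      proof -
        have "sgn x \<in> sphere 0 1" using calculation(1) by (simp add: norm_sgn)
        then have "\<pi> (sgn x) \<in> sphere 0 1" using conf unfolding conformal_submersion_def by blast
        then show ?thesis by (simp add: norm_eq_1[symmetric])
      qed
      ultimately show "w (cquat x) * w' (cquat x) - 1 = 0"
        using stereo_antipodal[OF _ ss(1) \<tau>] by simp
    qed
    have "((\<lambda>z. w z * w' z) has_derivative (\<lambda>v. w z * cdot (cgrad w' z) v + cdot (cgrad w z) v * w' z)) (at z)"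
      by (intro has_derivative_mult holo_derivative[OF hw(1) zU] holo_derivative[OF hw(2) zU])
    moreover have "((\<lambda>z. w z * w' z) has_derivative (\<lambda>v. 0)) (at z)"
      by (rule has_derivative_transform_within_open[OF has_derivative_const[of 1] U(1) zU]) (use eq in simp)
    ultimately have d: "(\<lambda>v. w z * cdot (cgrad w' z) v + cdot (cgrad w z) v * w' z) = (\<lambda>v. 0)"
      by (rule has_derivative_unique)
    have 1: "w z * w' z = 1" using eq[OF zU] by simp
    \<comment> \<open>The product rule with w' = 1/w; the factor is the derivative of the transition
      map.\<close>
    have "cgrad w z = (- (w z * w z)) *s cgrad w' z"
    proof (rule cdot_eqI)
      fix v
      have "w z * cdot (cgrad w' z) v + cdot (cgrad w z) v * w' z = 0" using fun_cong[OF d, of v] .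
      then show "cdot (cgrad w z) v = cdot ((- (w z * w z)) *s cgrad w' z) v"
        using 1 unfolding cdot_smult by algebra
    qed
    then show ?thesis using 1 by (intro exI[of _ "- (w z * w z)"]) auto
  qed
qed

end

section \<open>Existence of charts\<close>

lemma cdot_cquat_self: "cdot (cquat x) (cquat x) = of_real (x \<bullet> x)"
  by (simp add: cdot_def sum_4 cquat_nth quat_inner)

lemma holo_vec_continuous:
  fixes \<Phi> :: "complex^'n \<Rightarrow> complex^'m"
  assumes "\<And>i. holo (\<lambda>z. \<Phi> z $ i) U"
  shows "continuous_on U \<Phi>"
proof -
  have "continuous_on U (\<lambda>z. \<chi> i. \<Phi> z $ i)"
    by (intro continuous_on_vec_lambda holo_continuous assms)
  then show ?thesis by simp
qed

text \<open>Analyticity provides an extension that agrees with \<pi> on the sphere only. Composing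
  it with a holomorphic version of \<open>sgn\<close> gives constancy along rays, on which the
  orthogonality of the gradient to its base point rests.\<close>

lemma conformal_chart_exists:
  fixes \<pi> :: "quat \<Rightarrow> real^3"
  assumes analytic: "real_analytic_on \<pi> S3" and conf: "conformal_submersion \<pi>"
    and \<tau>: "\<tau> * \<tau> = 1" and p: "p \<in> S3"
  shows "\<exists>s r w. conformal_chart \<pi> \<tau> p s r w"
proof -
  obtain F e where e: "e > 0" and F: "real_analytic_at F p" "\<And>x. x \<in> S3 \<inter> ball p e \<Longrightarrow> F x = \<pi> x"
    using analytic p unfolding real_analytic_on_def by blast
  obtain r1 G where r1: "r1 > 0" and G: "\<And>k. holo (G k) (ball (cquat p) r1)"
    "\<And>k x. x \<in> ball p r1 \<Longrightarrow> G k (cquat x) = of_real (F x \<bullet> k)"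
    using real_analytic_at_holo[OF F(1) bij_quat_basis] by blast
  define d where "d = min e r1"
  have d: "d > 0" "d \<le> e" "d \<le> r1" using e r1 by (simp_all add: d_def)
  have hN: "holo (\<lambda>z :: complex^4. cdot z z) UNIV"
    unfolding cdot_def by (intro holo_sum holo_mult holo_nth) auto
  \<comment> \<open>Here the principal square root of z . z is holomorphic, so dividing z by it
    extends \<open>sgn\<close> from the real points.\<close>
  define U1 where "U1 = {z :: complex^4. Re (cdot z z) > 0}"
  have U1: "open U1"
    unfolding U1_def by (intro open_Collect_less continuous_on_const continuous_on_Re holo_continuous[OF hN])
  define N where "N z = inverse (csqrt (cdot z z)) *s z" for z :: "complex^4"
  have N: "holo (\<lambda>z. N z $ i) U1" for i
  proof -
    have d: "csqrt field_differentiable at (cdot z z)" if "z \<in> U1" for z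
      using that by (intro field_differentiable_at_csqrt) (auto simp: U1_def complex_nonpos_Reals_iff)
    have nz: "csqrt (cdot z z) \<noteq> 0" if "z \<in> U1" for z using that by (auto simp: U1_def)
    have "holo (\<lambda>z. inverse (csqrt (cdot z z))) U1"
      by (rule holo_inverse[OF holo_compose1[OF holo_subset[OF hN U1] d] nz]) simp
    from holo_mult[OF this holo_nth[OF U1]] show ?thesis
      unfolding N_def vector_smult_component .
  qed
  define U2 where "U2 = U1 \<inter> N -` ball (cquat p) d"
  have U2: "open U2" "U2 \<subseteq> U1"
    unfolding U2_def using holo_vec_continuous[OF N] U1 by (auto intro: continuous_open_preimage)
  define f where "f k z = G (axis k 1) (N z)" for k :: 3 and z
  have f: "holo (f k) U2" for k
    unfolding f_def
  proof (rule holo_compose_vec)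
    show "holo (\<lambda>z. N z $ i) U2" for i using N U2 by (rule holo_subset)
    show "holo (G (axis k 1)) (ball (cquat p) d)"
      by (rule holo_subset[OF G(1) open_ball subset_ball[OF d(3)]])
  qed (auto simp: U2_def)
  have real: "x \<noteq> 0" "N (cquat x) = cquat (sgn x)" "f k (cquat x) = of_real (\<pi> (sgn x) $ k)" if "cquat x \<in> U2" for x k
  proof -
    have "x \<bullet> x > 0" using that U2(2) by (auto simp: U1_def cdot_cquat_self)
    then show x: "x \<noteq> 0" by auto
    have "csqrt (of_real (x \<bullet> x)) = of_real (norm x)"
      by (simp add: norm_eq_sqrt_inner)
    then show Nx: "N (cquat x) = cquat (sgn x)"
      using x by (simp add: N_def cdot_cquat_self sgn_div_norm cvec_linear)
    have "cquat (sgn x) \<in> ball (cquat p) d" using that by (simp add: U2_def Nx)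
    then have b: "sgn x \<in> ball p d" by (simp only: cquat_mem_ball)
    then have "F (sgn x) = \<pi> (sgn x)" using x d(2) by (intro F(2)) (auto simp: norm_sgn)
    then show "f k (cquat x) = of_real (\<pi> (sgn x) $ k)"
      using G(2)[of "sgn x" "axis k 1"] b d(3) by (simp add: f_def Nx inner_axis)
  qed
  have np: "norm p = 1" "p \<noteq> 0" "sgn p = p" using p by (auto simp: sgn_div_norm)
  have pU2: "cquat p \<in> U2"
    using np d(1) by (simp add: U2_def U1_def cdot_cquat_self N_def norm_eq_1[symmetric] dot_square_norm)
  \<comment> \<open>The pole of projection must differ from \<pi> p.\<close>
  obtain s :: real where s: "s * s = 1" "1 - s * \<pi> p $ 3 \<noteq> 0"
  proof (cases "\<pi> p $ 3 = 1")
    case True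
    then show ?thesis using that[of "-1"] by simp
  next
    case False
    then show ?thesis using that[of 1] by simp
  qed
  define den where "den z = 1 - of_real s * f 3 z" for z
  have den: "holo den U2"
    unfolding den_def by (intro holo_diff holo_mult holo_const f U2)
  define U3 where "U3 = U2 \<inter> den -` (- {0})"
  have U3: "open U3" "U3 \<subseteq> U2"
    unfolding U3_def using holo_continuous[OF den] U2 by (auto intro!: continuous_open_preimage)
  define w where "w z = f 1 z / den z + \<i> * (of_real (\<tau> * s) * f 2 z / den z)" for z
  have w: "holo w U3"
    unfolding w_def
    by (intro holo_add holo_mult holo_divide holo_const holo_subset[OF f] holo_subset[OF den] U3)
       (auto simp: U3_def)
  have wreal: "x \<noteq> 0 \<and> 1 - s * \<pi> (sgn x) $ 3 \<noteq> 0 \<and> w (cquat x) = stereo s \<tau> (\<pi> (sgn x))" if "cquat x \<in> U3" for x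
  proof -
    have x2: "cquat x \<in> U2" using that U3(2) by blast
    have de: "den (cquat x) = of_real (1 - s * \<pi> (sgn x) $ 3)" by (simp add: den_def real(3)[OF x2])
    moreover have "den (cquat x) \<noteq> 0" using that by (simp add: U3_def)
    ultimately have c: "1 - s * \<pi> (sgn x) $ 3 \<noteq> 0" by (metis of_real_0)
    have "w (cquat x) = stereo s \<tau> (\<pi> (sgn x))"
      unfolding w_def stereo_def real(3)[OF x2] de by (simp only: of_real_divide of_real_mult)
    with c real(1)[OF x2] show ?thesis by blast
  qed
  have pU3: "cquat p \<in> U3"
    using pU2 s(2) real(3)[OF pU2, of 3] np by (simp add: U3_def den_def complex_eq_iff)
  obtain r3 where r3: "r3 > 0" "ball (cquat p) r3 \<subseteq> U3" using U3(1) pU3 open_contains_ball by blast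
  have "cgrad w (cquat p) \<noteq> 0"
  proof -
    have wr: "w (cquat x) = stereo s \<tau> (\<pi> (sgn x))" if "x \<in> ball p r3" for x
      using wreal r3(2) cquat_mem_ball[of x p r3] that by blast
    have pb: "p \<in> ball p r3" using r3 by simp
    have s3: "1 - s * \<pi> (sgn p) $ 3 \<noteq> 0" using s np by simp
    have "grad_im (cgrad w (cquat p)) \<noteq> 0"
      by (rule conformal_gradient(5)[OF conf np(2) s(1) \<tau> s3
          chart_gradient[OF holo_subset[OF w open_ball r3(2)] pb wr]])
    then show ?thesis by (auto simp: grad_im_def zero_prod_def complex_eq_iff)
  qed
  moreover have "open (U3 \<inter> cgrad w -` (- {0}))"
    using holo_vec_continuous[OF holo_cgrad[OF w]] U3(1) by (auto intro!: continuous_open_preimage)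
  ultimately obtain r where r: "r > 0" "ball (cquat p) r \<subseteq> U3 \<inter> cgrad w -` (- {0})"
    using pU3 unfolding open_contains_ball by (meson IntI vimageI2 ComplI singletonD)
  have "conformal_chart \<pi> \<tau> p s r w"
    unfolding conformal_chart_def
  proof (intro conjI)
    show "holo w (ball (cquat p) r)" using r(2) by (intro holo_subset[OF w open_ball]) blast
    show "\<forall>x\<in>ball p r. x \<noteq> 0 \<and> 1 - s * \<pi> (sgn x) $ 3 \<noteq> 0 \<and> w (cquat x) = stereo s \<tau> (\<pi> (sgn x))"
      using wreal r(2) cquat_mem_ball by blast
    show "\<forall>z\<in>ball (cquat p) r. cgrad w z \<noteq> 0" using r(2) by auto
  qed (use s r in auto)
  then show ?thesis by blast
qed

section \<open>Null lines\<close>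

text \<open>|H|^2 exp(-2 C t) is nonincreasing and starts at 0.\<close>

lemma gronwall_zero:
  fixes H :: "real \<Rightarrow> 'a::real_inner"
  assumes H: "\<And>t. 0 \<le> t \<Longrightarrow> t \<le> 1 \<Longrightarrow> (H has_vector_derivative H' t) (at t)"
    and bound: "\<And>t. 0 \<le> t \<Longrightarrow> t \<le> 1 \<Longrightarrow> norm (H' t) \<le> C * norm (H t)"
    and H0: "H 0 = 0"
  shows "H 1 = 0"
proof -
  define \<phi> where "\<phi> t = (H t \<bullet> H t) * exp (- 2 * C * t)" for t
  have "\<phi> 1 \<le> \<phi> 0"
  proof (rule DERIV_nonpos_imp_nonincreasing[where f = \<phi>])
    fix t :: real assume t: "0 \<le> t" "t \<le> 1"
    let ?d = "(2 * (H t \<bullet> H' t) - 2 * C * (H t \<bullet> H t)) * exp (- 2 * C * t)"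
    have 1: "((\<lambda>t. H t \<bullet> H t) has_real_derivative 2 * (H t \<bullet> H' t)) (at t)"
      using has_derivative_inner[OF H[OF t, unfolded has_vector_derivative_def] H[OF t, unfolded has_vector_derivative_def]]
      by (simp add: has_field_derivative_def inner_commute mult.commute[of "inner _ _"] algebra_simps mult_commute_abs)
    have 2: "((\<lambda>t. exp (- 2 * C * t)) has_real_derivative exp (- 2 * C * t) * (- 2 * C)) (at t)"
      by (auto intro!: derivative_eq_intros)
    have "(\<phi> has_real_derivative ?d) (at t)"
      unfolding \<phi>_def using DERIV_mult[OF 1 2] by (simp add: algebra_simps)
    moreover have "?d \<le> 0"
    proof -
      have "H t \<bullet> H' t \<le> norm (H t) * norm (H' t)" by (rule norm_cauchy_schwarz)
      also have "\<dots> \<le> norm (H t) * (C * norm (H t))" using bound[OF t] by (simp add: mult_left_mono)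
      also have "\<dots> = C * (H t \<bullet> H t)" by (simp add: dot_square_norm power2_eq_square)
      finally show ?thesis by (simp add: mult_nonpos_nonneg)
    qed
    ultimately show "\<exists>y. (\<phi> has_real_derivative y) (at t) \<and> y \<le> 0" by blast
  qed simp
  then have "(H 1 \<bullet> H 1) * exp (- 2 * C * 1) \<le> 0" by (simp add: \<phi>_def H0)
  then have "H 1 \<bullet> H 1 \<le> 0" by (simp add: mult_le_0_iff)
  then show ?thesis by (metis inner_eq_zero_iff inner_ge_zero order_antisym)
qed

lemma norm_cdot_le: "norm (cdot g u) \<le> norm g * norm u"
proof -
  have "norm (cdot g u) \<le> (\<Sum>i\<in>UNIV. \<bar>norm (g $ i)\<bar> * \<bar>norm (u $ i)\<bar>)"
    unfolding cdot_def by (rule order_trans[OF norm_sum]) (simp add: norm_mult)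
  also have "\<dots> \<le> L2_set (\<lambda>i. norm (g $ i)) UNIV * L2_set (\<lambda>i. norm (u $ i)) UNIV"
    by (rule L2_set_mult_ineq)
  finally show ?thesis by (simp add: norm_vec_def)
qed

lemma norm_vec_le_sum: "norm (x :: complex^'n) \<le> (\<Sum>i\<in>UNIV. norm (x $ i))"
  unfolding norm_vec_def by (rule L2_set_le_sum) simp

lemma holo_gradient_continuous:
  assumes "holo w U"
  shows "continuous_on U (cgrad w)"
proof -
  have "continuous_on U (\<lambda>z. \<chi> i. cgrad w z $ i)"
    by (intro continuous_on_vec_lambda continuous_on_cgrad[OF assms])
  then show ?thesis by simp
qed

text \<open>The hypothesis controls W only along its own value at each point, while the segment
  keeps the direction V of W at \<open>X\<close>. Writing V = W - H, the contribution of W vanishes,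
  so the derivative along the segment is linear in \<open>H\<close>, and Gronwall's inequality gives
  H = 0.\<close>

lemma gradient_constant_on_segment:
  fixes w :: "complex^'n \<Rightarrow> complex"
  assumes w: "holo w U" and U: "convex U" "X \<in> U" "Y \<in> U"
    and null: "\<And>z b. z \<in> U \<Longrightarrow> cdot (cgrad (\<lambda>z. cgrad w z $ b) z) (cgrad w z) = 0"
    and Y: "Y = X + k *s cgrad w X"
  shows "cgrad w Y = cgrad w X"
proof -
  define \<gamma> where "\<gamma> t = X + of_real t *s (Y - X)" for t :: real
  have \<gamma>U: "\<gamma> t \<in> U" if "0 \<le> t" "t \<le> 1" for t
  proof -
    have "(1 - t) *\<^sub>R X + t *\<^sub>R Y \<in> U" using U that by (intro convexD) auto
    also have "(1 - t) *\<^sub>R X + t *\<^sub>R Y = \<gamma> t"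
      by (simp add: \<gamma>_def vec_eq_iff algebra_simps scaleR_conv_of_real[where 'a = complex])
    finally show ?thesis .
  qed
  define V where "V = cgrad w X"
  define A where "A t b = cgrad (\<lambda>z. cgrad w z $ b) (\<gamma> t)" for t b
  define H where "H t = cgrad w (\<gamma> t) - V" for t
  define H' where "H' t = (\<chi> b. cdot (A t b) (Y - X))" for t
  have YX: "Y - X = k *s V" using Y by (simp add: V_def)
  have cont\<gamma>: "continuous_on S \<gamma>" for S
    unfolding \<gamma>_def
    by (intro continuous_on_add continuous_on_const
        bounded_linear.continuous_on[OF bounded_linear_smult_left] continuous_on_of_real continuous_on_id)
  have contA: "continuous_on {0..1} (\<lambda>t. A t b)" for b
    unfolding A_def
    by (rule continuous_on_compose2[OF holo_gradient_continuous[OF holo_cgrad[OF w]] cont\<gamma>]) (use \<gamma>U in auto)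
  then have "continuous_on {0..1} (\<lambda>t. \<Sum>b\<in>UNIV. norm (A t b))"
    by (intro continuous_on_sum continuous_on_norm) auto
  then have "bounded ((\<lambda>t. \<Sum>b\<in>UNIV. norm (A t b)) ` {0..1})"
    by (intro compact_imp_bounded compact_continuous_image) auto
  then obtain C where C: "\<And>t. 0 \<le> t \<Longrightarrow> t \<le> 1 \<Longrightarrow> norm (\<Sum>b\<in>UNIV. norm (A t b)) \<le> C"
    unfolding bounded_iff by (meson atLeastAtMost_iff imageI)
  have "H 1 = 0"
  proof (rule gronwall_zero)
    fix t :: real assume t: "0 \<le> t" "t \<le> 1"
    have "((\<lambda>t. cgrad w (\<gamma> t) $ b) has_vector_derivative cdot (A t b) (Y - X)) (at t)" for b
    proof -
      have "((\<lambda>s. cgrad w (X + s *s (Y - X)) $ b) has_field_derivative cdot (A t b) (Y - X)) (at (of_real t))"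
        unfolding A_def \<gamma>_def
        by (rule has_field_derivative_line holo_derivative[OF holo_cgrad[OF w]])+
           (use \<gamma>U[OF t] in \<open>simp add: \<gamma>_def\<close>)
      from has_vector_derivative_real_field[OF this] show ?thesis by (simp add: \<gamma>_def)
    qed
    then have "((\<lambda>t. cgrad w (\<gamma> t)) has_vector_derivative H' t) (at t)"
      unfolding H'_def has_vector_derivative_def
      by (subst has_derivative_componentwise_within)
         (auto simp: Basis_vec_def inner_axis intro!: has_derivative_inner_left[THEN has_derivative_eq_rhs])
    then show "(H has_vector_derivative H' t) (at t)"
      using has_vector_derivative_diff[OF _ has_vector_derivative_const[of V]] unfolding H_def by fastforce
    have "norm (H' t) \<le> (\<Sum>b\<in>UNIV. norm (H' t $ b))" by (rule norm_vec_le_sum)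
    also have "\<dots> \<le> (\<Sum>b\<in>UNIV. norm k * (norm (A t b) * norm (H t)))"
    proof (rule sum_mono)
      fix b
      have "H' t $ b = k * cdot (A t b) (- H t)"
        using null[OF \<gamma>U[OF t], of b] by (simp add: H'_def YX H_def cdot_diff A_def)
      also have "norm \<dots> \<le> norm k * (norm (A t b) * norm (H t))"
        unfolding norm_mult using norm_cdot_le[of "A t b" "- H t"] by (simp add: mult_left_mono)
      finally show "norm (H' t $ b) \<le> norm k * (norm (A t b) * norm (H t))" .
    qed
    also have "\<dots> = norm k * (\<Sum>b\<in>UNIV. norm (A t b)) * norm (H t)"
      by (simp add: sum_distrib_left sum_distrib_right mult_ac)
    also have "\<dots> \<le> norm k * C * norm (H t)"
      using C[OF t] by (intro mult_right_mono mult_left_mono) auto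
    finally show "norm (H' t) \<le> norm k * C * norm (H t)" .
  qed (simp add: H_def \<gamma>_def V_def)
  then show ?thesis by (simp add: H_def \<gamma>_def V_def)
qed

text \<open>The vector \<open>M\<close> of coordinates of a complexified quaternion acts on \<open>\<complex>\<^sup>2 = \<H>\<close> by the matrix that
  extends left multiplication. On matrices, \<^term>\<open>cdot M M\<close> is the determinant.\<close>

definition act1 :: "complex^4 \<Rightarrow> complex \<Rightarrow> complex \<Rightarrow> complex" where
  "act1 M a b = (M$1 + \<i> * M$2) * a + (\<i> * M$4 - M$3) * b"

definition act2 :: "complex^4 \<Rightarrow> complex \<Rightarrow> complex \<Rightarrow> complex" where
  "act2 M a b = (M$3 + \<i> * M$4) * a + (M$1 - \<i> * M$2) * b"

definition of_mat :: "complex \<Rightarrow> complex \<Rightarrow> complex \<Rightarrow> complex \<Rightarrow> complex^4" where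
  "of_mat m11 m12 m21 m22 = vector [(m11 + m22) / 2, (m11 - m22) / (2 * \<i>), (m21 - m12) / 2, (m21 + m12) / (2 * \<i>)]"

lemma act_of_mat [simp]:
  "act1 (of_mat m11 m12 m21 m22) a b = m11 * a + m12 * b"
  "act2 (of_mat m11 m12 m21 m22) a b = m21 * a + m22 * b"
  by (simp_all add: act1_def act2_def of_mat_def field_simps)

text \<open>Polarisation of the determinant, to which it reduces on equal arguments.\<close>

lemma cdot_of_mat:
  "cdot (of_mat m11 m12 m21 m22) (of_mat n11 n12 n21 n22)
    = (m11 * n22 + m22 * n11 - m12 * n21 - m21 * n12) / 2"
  by (simp add: cdot_def sum_4 of_mat_def field_simps)

lemma of_mat_cases:
  obtains m11 m12 m21 m22 where "M = of_mat m11 m12 m21 m22"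
proof
  show "M = of_mat (M$1 + \<i> * M$2) (\<i> * M$4 - M$3) (M$3 + \<i> * M$4) (M$1 - \<i> * M$2)"
    by (simp add: of_mat_def vec_eq_iff forall_4)
qed

lemma of_mat_linear:
  "of_mat a b c d + of_mat a' b' c' d' = of_mat (a + a') (b + b') (c + c') (d + d')"
  "of_mat a b c d - of_mat a' b' c' d' = of_mat (a - a') (b - b') (c - c') (d - d')"
  "k *s of_mat a b c d = of_mat (k * a) (k * b) (k * c) (k * d)"
  by (simp_all add: of_mat_def vec_eq_iff forall_4 field_simps)

lemma act_linear:
  "act1 (M - N) a b = act1 M a b - act1 N a b" "act2 (M - N) a b = act2 M a b - act2 N a b"
  "act1 (k *s M) a b = k * act1 M a b" "act2 (k *s M) a b = k * act2 M a b"
  "act1 M (k * a) (k * b) = k * act1 M a b" "act2 M (k * a) (k * b) = k * act2 M a b"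
  by (simp_all add: act1_def act2_def algebra_simps)

lemma null_of_kernel:
  assumes "act1 v a b = 0" "act2 v a b = 0" "a \<noteq> 0 \<or> b \<noteq> 0"
  shows "cdot v v = 0"
proof -
  obtain m11 m12 m21 m22 where v: "v = of_mat m11 m12 m21 m22" by (rule of_mat_cases)
  have "m11 * a + m12 * b = 0" "m21 * a + m22 * b = 0" using assms(1,2) by (simp_all add: v)
  then have "(m11 * m22 - m12 * m21) * a = 0" "(m11 * m22 - m12 * m21) * b = 0" by algebra+
  then have "m11 * m22 - m12 * m21 = 0" using assms(3) by auto
  then show ?thesis by (simp add: v cdot_of_mat algebra_simps)
qed

lemma row_multiple:
  fixes x y a b :: complex
  assumes "x * a + y * b = 0" "a \<noteq> 0 \<or> b \<noteq> 0"
  obtains c where "x = - c * b" "y = c * a"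
proof (cases "a = 0")
  case True
  then show ?thesis using assms that[of "- x / b"] by auto
next
  case False
  then show ?thesis using assms that[of "y / a"] by (auto simp: field_simps eq_neg_iff_add_eq_0)
qed

text \<open>The rows of \<open>v\<close> annihilate (a, b), so v is a column c times the row (-b,
  a), and orthogonality to \<open>X\<close> makes c parallel to (e1, e2). The direction thus depends
  on the null line only, not on the point \<open>X\<close> of it.\<close>

lemma kernel_direction:
  assumes v: "act1 v a b = 0" "act2 v a b = 0" "cdot X v = 0" and ab: "a \<noteq> 0 \<or> b \<noteq> 0"
    and e: "act1 X a b = e1" "act2 X a b = e2" "e1 \<noteq> 0 \<or> e2 \<noteq> 0"
  shows "\<exists>k. v = k *s of_mat (- e1 * b) (e1 * a) (- e2 * b) (e2 * a)"
proof -
  obtain n11 n12 n21 n22 where n: "v = of_mat n11 n12 n21 n22" by (rule of_mat_cases)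
  obtain m11 m12 m21 m22 where m: "X = of_mat m11 m12 m21 m22" by (rule of_mat_cases)
  obtain c1 where c1: "n11 = - c1 * b" "n12 = c1 * a" using row_multiple[of n11 a n12 b] v(1) ab by (auto simp: n)
  obtain c2 where c2: "n21 = - c2 * b" "n22 = c2 * a" using row_multiple[of n21 a n22 b] v(2) ab by (auto simp: n)
  have E: "e1 = m11 * a + m12 * b" "e2 = m21 * a + m22 * b" using e by (simp_all add: m)
  have "c2 * e1 - c1 * e2 = 0"
    using v(3) unfolding n m cdot_of_mat E c1 c2 by (simp add: algebra_simps)
  then have "c1 * (- e2) + c2 * e1 = 0" by (simp add: algebra_simps)
  moreover have "- e2 \<noteq> 0 \<or> e1 \<noteq> 0" using e(3) by auto
  ultimately obtain k where k: "c1 = - k * e1" "c2 = k * - e2" by (rule row_multiple)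
  show ?thesis
    unfolding n c1 c2 k by (rule exI[of _ "- k"]) (simp add: of_mat_linear algebra_simps)
qed

text \<open>The matrix of determinant \<open>1\<close> mapping \<open>(z$3, z$4)\<close> to \<open>(z$1, z$2)\<close> and \<open>(n1, n2)\<close> to a multiple of
  \<open>(x1, x2)\<close>.\<close>

definition twistor_section :: "complex \<Rightarrow> complex \<Rightarrow> complex \<Rightarrow> complex \<Rightarrow> complex^4 \<Rightarrow> complex^4" where
  "twistor_section n1 n2 x1 x2 z = (let d = z$3 * n2 - z$4 * n1; e = z$1 * x2 - z$2 * x1 in
     of_mat (n2 * z$1 / d - z$4 * x1 / e) (z$3 * x1 / e - n1 * z$1 / d)
            (n2 * z$2 / d - z$4 * x2 / e) (z$3 * x2 / e - n1 * z$2 / d))"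

text \<open>The section is a sum of two rank-one matrices: the first sends (z3, z4) to (z1, z2) and
  kills n, the second kills (z3, z4) and sends n to d/e times x. The ratio d/e is what gives
  determinant 1.\<close>

lemma twistor_section:
  assumes "z$3 * n2 - z$4 * n1 \<noteq> 0" "z$1 * x2 - z$2 * x1 \<noteq> 0"
  shows "act1 (twistor_section n1 n2 x1 x2 z) (z$3) (z$4) = z$1"
    "act2 (twistor_section n1 n2 x1 x2 z) (z$3) (z$4) = z$2"
    "cdot (twistor_section n1 n2 x1 x2 z) (twistor_section n1 n2 x1 x2 z) = 1"
proof -
  define d e where de: "d = z$3 * n2 - z$4 * n1" "e = z$1 * x2 - z$2 * x1"
  have nz: "d \<noteq> 0" "e \<noteq> 0" using assms by (simp_all add: de)
  have S: "twistor_section n1 n2 x1 x2 z = of_mat (n2 * z$1 / d - z$4 * x1 / e) (z$3 * x1 / e - n1 * z$1 / d)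
            (n2 * z$2 / d - z$4 * x2 / e) (z$3 * x2 / e - n1 * z$2 / d)"
    by (simp add: twistor_section_def de Let_def)
  define u v where uv: "u = inverse d" "v = inverse e"
  have u: "u * d = 1" "v * e = 1" using nz by (simp_all add: uv)
  have 1: "(n2 * z$1 * u - z$4 * x1 * v) * z$3 + (z$3 * x1 * v - n1 * z$1 * u) * z$4 = z$1"
    "(n2 * z$2 * u - z$4 * x2 * v) * z$3 + (z$3 * x2 * v - n1 * z$2 * u) * z$4 = z$2"
    "(n2 * z$1 * u - z$4 * x1 * v) * (z$3 * x2 * v - n1 * z$2 * u)
      - (z$3 * x1 * v - n1 * z$1 * u) * (n2 * z$2 * u - z$4 * x2 * v) = 1"
    using u unfolding de by algebra+
  show "act1 (twistor_section n1 n2 x1 x2 z) (z$3) (z$4) = z$1"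
    "act2 (twistor_section n1 n2 x1 x2 z) (z$3) (z$4) = z$2"
    using 1(1,2) by (simp_all add: S uv divide_inverse)
  show "cdot (twistor_section n1 n2 x1 x2 z) (twistor_section n1 n2 x1 x2 z) = 1"
    using 1(3) unfolding S cdot_of_mat divide_inverse uv[symmetric] by (simp add: algebra_simps)
qed

text \<open>A matrix of determinant 1 preserves the determinant of a pair of vectors, so the two
  denominators agree and the section coincides with \<open>X\<close> on the basis (z3, z4),
  n.\<close>

lemma twistor_section_eqI:
  assumes X: "cdot X X = 1" and z: "z$1 = act1 X (z$3) (z$4)" "z$2 = act2 X (z$3) (z$4)"
    and x: "x1 = act1 X n1 n2" "x2 = act2 X n1 n2" and nz: "z$3 * n2 - z$4 * n1 \<noteq> 0"
  shows "twistor_section n1 n2 x1 x2 z = X" "z$1 * x2 - z$2 * x1 = z$3 * n2 - z$4 * n1"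
proof -
  obtain m11 m12 m21 m22 where m: "X = of_mat m11 m12 m21 m22" by (rule of_mat_cases)
  have "2 * (m11 * m22 - m12 * m21) = 2" using X unfolding m cdot_of_mat by (simp add: algebra_simps)
  then have det: "m11 * m22 - m12 * m21 = 1" unfolding mult_cancel_left2 by simp
  have z': "z$1 = m11 * z$3 + m12 * z$4" "z$2 = m21 * z$3 + m22 * z$4"
    and x': "x1 = m11 * n1 + m12 * n2" "x2 = m21 * n1 + m22 * n2" using z x by (simp_all add: m)
  show e: "z$1 * x2 - z$2 * x1 = z$3 * n2 - z$4 * n1"
    using det unfolding z' x' by algebra
  define d where "d = z$3 * n2 - z$4 * n1"
  have d: "d \<noteq> 0" using nz by (simp add: d_def)
  have num: "n2 * z$1 - z$4 * x1 = m11 * d" "z$3 * x1 - n1 * z$1 = m12 * d"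
    "n2 * z$2 - z$4 * x2 = m21 * d" "z$3 * x2 - n1 * z$2 = m22 * d"
    unfolding z' x' d_def by algebra+
  show "twistor_section n1 n2 x1 x2 z = X"
    unfolding twistor_section_def e d_def[symmetric] Let_def diff_divide_distrib[symmetric] num m
    using d by simp
qed

context
  fixes \<pi> :: "quat \<Rightarrow> real^3" and \<tau> :: real
  assumes conf: "conformal_submersion \<pi>" and \<tau>: "\<tau> * \<tau> = 1"
begin

text \<open>Both \<open>Y - X\<close> and the gradient at \<open>X\<close> kill (a, b) and are
  orthogonal to \<open>X\<close>, so by \<open>kernel_direction\<close> they are multiples of one
  matrix, and \<open>Y\<close> is reached from \<open>X\<close> along the gradient.\<close>

lemma chart_null_line:
  assumes c: "conformal_chart \<pi> \<tau> p s r w" and XY: "X \<in> ball (cquat p) r" "Y \<in> ball (cquat p) r"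
    and det: "cdot X X = 1" "cdot Y Y = 1" and ab: "a \<noteq> 0 \<or> b \<noteq> 0"
    and e: "act1 X a b = e1" "act2 X a b = e2" "e1 \<noteq> 0 \<or> e2 \<noteq> 0"
    and eY: "act1 Y a b = e1" "act2 Y a b = e2"
    and ker: "act1 (cgrad w X) a b = 0" "act2 (cgrad w X) a b = 0"
  shows "cgrad w Y = cgrad w X"
proof -
  have h: "holo w (ball (cquat p) r)" "cgrad w X \<noteq> 0" using c XY by (auto simp: conformal_chart_def)
  have v: "act1 (Y - X) a b = 0" "act2 (Y - X) a b = 0" by (simp_all add: act_linear e eY)
  have "cdot (Y - X) (Y - X) = cdot Y Y - cdot X X - 2 * cdot X (Y - X)"
    by (simp add: cdot_diff cdot_commute algebra_simps)
  \<comment> \<open>Both points have determinant 1, and their difference is null because it has a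
    kernel.\<close>
  then have "cdot X (Y - X) = 0" using det null_of_kernel[OF v ab] by simp
  from kernel_direction[OF v this ab e] obtain k1 where
    k1: "Y - X = k1 *s of_mat (- e1 * b) (e1 * a) (- e2 * b) (e2 * a)" by blast
  have "cdot X (cgrad w X) = 0" using chart_null(2)[OF conf \<tau> c XY(1)] by (simp add: cdot_commute)
  from kernel_direction[OF ker this ab e] obtain k2 where
    k2: "cgrad w X = k2 *s of_mat (- e1 * b) (e1 * a) (- e2 * b) (e2 * a)" by blast
  have "k2 \<noteq> 0" using k2 h(2) by auto
  then have "Y = X + (k1 / k2) *s cgrad w X"
    unfolding k2 using k1 by (simp add: algebra_simps)
  then show ?thesis
    using chart_null(3)[OF conf \<tau> c] XY by (intro gradient_constant_on_segment[OF h(1) convex_ball]) auto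
qed

end

section \<open>Regular zero sets\<close>

lemma dim_coordinate_hyperplane:
  fixes k :: "'n::finite"
  assumes "CARD('n) = Suc d"
  shows "vec.subspace {u :: complex^'n. u $ k = 0}" "vec.dim {u :: complex^'n. u $ k = 0} = d"
proof -
  let ?L = "{u :: complex^'n. u $ k = 0}"
  let ?B = "(\<lambda>i. axis i (1 :: complex)) ` (UNIV - {k})"
  show "vec.subspace ?L" by (simp add: vec.subspace_def)
  show "vec.dim ?L = d"
  proof (rule vec.dim_unique[of ?B])
    show "?B \<subseteq> ?L" by (auto simp: axis_def)
    show "?L \<subseteq> vec.span ?B"
    proof
      fix u assume u: "u \<in> ?L"
      have "u = (\<Sum>i\<in>UNIV. u $ i *s axis i 1)" by (simp add: basis_expansion)
      also have "\<dots> = (\<Sum>i\<in>UNIV - {k}. u $ i *s axis i 1)"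
        using u by (simp add: sum.remove[of UNIV k])
      also have "\<dots> \<in> vec.span ?B"
        by (intro vec.span_sum vec.span_scale vec.span_base) auto
      finally show "u \<in> vec.span ?B" .
    qed
    show "vec.independent ?B"
      using independent_cart_basis by (rule vec.independent_mono) (auto simp: cart_basis_def)
    have "inj_on (\<lambda>i. axis i (1 :: complex)) (UNIV - {k})"
      by (auto simp: inj_on_def axis_eq_axis)
    then have "card ?B = card (UNIV - {k})" by (rule card_image)
    then show "card ?B = d" using assms by simp
  qed
qed

text \<open>\<open>h\<close> takes the place of a coordinate \<open>k\<close> along which its
  derivative is nonzero; the zero set becomes a coordinate hyperplane.\<close>

lemma regular_zero_set_chart:
  fixes h :: "complex^'n \<Rightarrow> complex"
  assumes card: "CARD('n) = Suc d" and h: "holo h W" and a: "a \<in> W" "cgrad h a \<noteq> 0"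
    and S: "\<And>w. w \<in> W \<Longrightarrow> w \<in> S \<longleftrightarrow> h w = 0"
  shows "\<exists>U V \<phi> L. a \<in> U \<and> biholomorphism U V \<phi> \<and>
        vec.subspace L \<and> vec.dim L = d \<and> \<phi> ` (S \<inter> U) = V \<inter> L"
proof -
  obtain k where k: "cgrad h a $ k \<noteq> 0" using a(2) by (auto simp: vec_eq_iff)
  define \<phi> where "\<phi> w = (\<chi> i. if i = k then h w else w $ i)" for w
  define \<phi>' where "\<phi>' w v = (\<chi> i. if i = k then cdot (cgrad h w) v else v $ i)" for w v :: "complex^'n"
  define Q where "Q = Blinfun (\<lambda>v :: complex^'n. \<chi> i. if i = k then 0 else v $ i)"
  define B where "B j = Blinfun (\<lambda>v :: complex^'n. v $ j)" for j
  define K where "K = Blinfun (axis k :: complex \<Rightarrow> complex^'n)"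
  have "linear (\<lambda>v :: complex^'n. (\<chi> i. if i = k then 0 else v $ i) :: complex^'n)"
    by (rule linearI) (simp_all add: vec_eq_iff)
  then have Q: "blinfun_apply Q v = (\<chi> i. if i = k then 0 else v $ i)" for v
    unfolding Q_def by (simp add: bounded_linear_Blinfun_apply linear_conv_bounded_linear)
  have B: "blinfun_apply (B j) v = v $ j" for j v
    unfolding B_def by (simp add: bounded_linear_Blinfun_apply bounded_linear_vec_nth)
  have K: "blinfun_apply K t = axis k t" for t
    unfolding K_def by (simp add: bounded_linear_Blinfun_apply bounded_linear_axis)
  \<comment> \<open>The derivative as a continuous map into bounded linear operators, the form the
    inverse function theorem expects: identity off entry \<open>k\<close>, differential of
    \<open>h\<close> in entry \<open>k\<close>.\<close>
  define F where "F w = Q + (K o\<^sub>L (\<Sum>j\<in>UNIV. blinfun_mult_right (cgrad h w $ j) o\<^sub>L B j))" for w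
  have F: "blinfun_apply (F w) = \<phi>' w" for w
    by (rule ext) (simp add: F_def \<phi>'_def blinfun.add_left blinfun.sum_left Q K B vec_eq_iff axis_def cdot_def)
  have contF: "continuous_on W F"
    unfolding F_def
    by (intro continuous_on_add continuous_on_const continuous_on_sum
        bounded_bilinear.continuous_on[OF bounded_bilinear_blinfun_compose]
        bounded_linear.continuous_on[OF bounded_linear_blinfun_mult_right continuous_on_cgrad[OF h]])
  have der: "(\<phi> has_derivative blinfun_apply (F w)) (at w)" if w: "w \<in> W" for w
    unfolding F
  proof (subst has_derivative_componentwise_within, rule ballI)
    fix b :: "complex^'n" assume "b \<in> Basis"
    then obtain i c where b: "b = axis i c" by (auto simp: Basis_vec_def)
    have "((\<lambda>w. \<phi> w $ i) has_derivative (\<lambda>v. \<phi>' w v $ i)) (at w)"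
      using holo_derivative[OF h w]
      by (cases "i = k") (simp_all add: \<phi>_def \<phi>'_def bounded_linear_imp_has_derivative bounded_linear_vec_nth)
    then show "((\<lambda>w. \<phi> w \<bullet> b) has_derivative (\<lambda>v. \<phi>' w v \<bullet> b)) (at w)"
      unfolding b inner_axis by (rule has_derivative_inner_left)
  qed
  have lin: "\<phi>' w (c *s v) = c *s \<phi>' w v" for w c v
    by (simp add: \<phi>'_def vec_eq_iff)
  have "linear (\<phi>' a)" using F[of a] blinfun.bounded_linear_right[of "F a"] linear_conv_bounded_linear by metis
  moreover have "inj (\<phi>' a)"
  proof (rule linear_injective_0[THEN iffD2, OF \<open>linear (\<phi>' a)\<close>], intro allI impI)
    fix v assume v: "\<phi>' a v = 0"
    have vi: "v $ i = 0" if "i \<noteq> k" for i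
    proof -
      have "\<phi>' a v $ i = 0" by (simp add: v)
      then show ?thesis using that by (simp add: \<phi>'_def)
    qed
    have "\<phi>' a v $ k = 0" by (simp add: v)
    then have "0 = cdot (cgrad h a) v" by (simp add: \<phi>'_def)
    also have "\<dots> = cgrad h a $ k * v $ k"
      unfolding cdot_def using vi by (simp add: sum.remove[of UNIV k])
    finally have "v $ k = 0" using k by simp
    then have "v $ i = 0" for i using vi by (cases "i = k") auto
    then show "v = 0" by (simp add: vec_eq_iff)
  qed
  ultimately obtain G where G: "linear G" "G \<circ> \<phi>' a = id"
    using linear_injective_left_inverse by blast
  have GF: "Blinfun G o\<^sub>L F a = id_blinfun"
    using G by (intro blinfun_eqI)
      (simp add: bounded_linear_Blinfun_apply linear_conv_bounded_linear F fun_eq_iff)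
  obtain U V g g' where UV: "open U" "U \<subseteq> W" "a \<in> U" "open V" "\<phi> a \<in> V" "homeomorphism U V \<phi> g"
    and g: "\<And>y. y \<in> V \<Longrightarrow> (g has_derivative g' y) (at y)"
      "\<And>y. y \<in> V \<Longrightarrow> g' y = inv (blinfun_apply (F (g y)))"
      "\<And>y. y \<in> V \<Longrightarrow> bij (blinfun_apply (F (g y)))"
    using inverse_function_theorem[OF holo_open[OF h] der contF a(1) GF, of thesis] by auto
  have bij: "bij_betw \<phi> U V"
    using UV(6) by (intro bij_betwI[where g = g]) (auto simp: homeomorphism_def)
  have inv: "inv_into U \<phi> y = g y" if "y \<in> V" for y
    using UV(6) that bij by (metis bij_betw_def homeomorphism_def imageI inv_into_f_f)
  have "biholomorphism U V \<phi>"
    unfolding biholomorphism_def holomorphic_map_on_def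
  proof (intro conjI ballI UV(1,4) bij)
    fix w assume "w \<in> U"
    then show "\<exists>D. (\<phi> has_derivative D) (at w) \<and> (\<forall>c v. D (c *s v) = c *s D v)"
      using der[of w] UV(2) lin unfolding F by blast
  next
    fix y assume y: "y \<in> V"
    have "(inv_into U \<phi> has_derivative g' y) (at y)"
      by (rule has_derivative_transform_within_open[OF g(1)[OF y] UV(4) y]) (simp add: inv)
    \<comment> \<open>The theorem yields only a real derivative of the inverse, but the inverse of a
      complex linear bijection is complex linear.\<close>
    moreover have "g' y (c *s v) = c *s g' y v" for c v
    proof -
      have b: "bij (\<phi>' (g y))" using g(3)[OF y] by (simp add: F)
      have "\<phi>' (g y) (c *s g' y v) = c *s v"
        using b by (simp add: lin g(2)[OF y] F bij_is_surj surj_f_inv_f)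
      then show ?thesis using b by (metis F bij_inv_eq_iff g(2)[OF y])
    qed
    ultimately show "\<exists>D. (inv_into U \<phi> has_derivative D) (at y) \<and> (\<forall>c v. D (c *s v) = c *s D v)" by blast
  qed
  moreover have "\<phi> ` (S \<inter> U) = V \<inter> {u. u $ k = 0}"
  proof -
    have "\<phi> w \<in> V \<and> (w \<in> S \<longleftrightarrow> \<phi> w $ k = 0)" if "w \<in> U" for w
      using that UV(2) S[of w] bij by (auto simp: \<phi>_def bij_betw_def)
    moreover have "V = \<phi> ` U" using bij by (simp add: bij_betw_def)
    ultimately show ?thesis by blast
  qed
  ultimately show ?thesis
    using UV(3) dim_coordinate_hyperplane[OF card, of k] by blast
qed

text \<open>Lets the four charts be treated alike: each parametrises the affine hyperplane z$i = 1
  for some \<open>i\<close>, and directions with entry 0 at \<open>i\<close> come from the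
  chart.\<close>

lemma affine_lift_cases:
  assumes "\<sigma> \<in> affine_lifts"
  obtains i where "\<And>v. \<sigma> v $ i = 1" "\<And>j. holo (\<lambda>v. \<sigma> v $ j) UNIV"
    "\<And>d. d $ i = 0 \<Longrightarrow> \<exists>u. \<forall>v t. \<sigma> (v + t *s u) = \<sigma> v + t *s d"
proof -
  have h: "\<forall>j. holo (\<lambda>v. \<sigma> v $ j) UNIV"
    using assms unfolding affine_lifts_def forall_4
    by (auto simp: holo_const holo_nth)
  consider "\<sigma> = (\<lambda>w. vector [1, w$1, w$2, w$3])" | "\<sigma> = (\<lambda>w. vector [w$1, 1, w$2, w$3])"
    | "\<sigma> = (\<lambda>w. vector [w$1, w$2, 1, w$3])" | "\<sigma> = (\<lambda>w. vector [w$1, w$2, w$3, 1])"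
    using assms unfolding affine_lifts_def by blast
  then show ?thesis
  proof cases
    case 1
    show ?thesis
    proof (rule that[of 1])
      show "holo (\<lambda>v. \<sigma> v $ j) UNIV" for j using h by blast
      show "\<exists>u. \<forall>v t. \<sigma> (v + t *s u) = \<sigma> v + t *s d" if "d $ 1 = 0" for d
        by (rule exI[of _ "vector [d$2, d$3, d$4]"]) (simp add: 1 that vec_eq_iff forall_4)
    qed (simp add: 1)
  next
    case 2
    show ?thesis
    proof (rule that[of 2])
      show "holo (\<lambda>v. \<sigma> v $ j) UNIV" for j using h by blast
      show "\<exists>u. \<forall>v t. \<sigma> (v + t *s u) = \<sigma> v + t *s d" if "d $ 2 = 0" for d
        by (rule exI[of _ "vector [d$1, d$3, d$4]"]) (simp add: 2 that vec_eq_iff forall_4)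
    qed (simp add: 2)
  next
    case 3
    show ?thesis
    proof (rule that[of 3])
      show "holo (\<lambda>v. \<sigma> v $ j) UNIV" for j using h by blast
      show "\<exists>u. \<forall>v t. \<sigma> (v + t *s u) = \<sigma> v + t *s d" if "d $ 3 = 0" for d
        by (rule exI[of _ "vector [d$1, d$2, d$4]"]) (simp add: 3 that vec_eq_iff forall_4)
    qed (simp add: 3)
  next
    case 4
    show ?thesis
    proof (rule that[of 4])
      show "holo (\<lambda>v. \<sigma> v $ j) UNIV" for j using h by blast
      show "\<exists>u. \<forall>v t. \<sigma> (v + t *s u) = \<sigma> v + t *s d" if "d $ 4 = 0" for d
        by (rule exI[of _ "vector [d$1, d$2, d$3]"]) (simp add: 4 that vec_eq_iff forall_4)
    qed (simp add: 4)
  qed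
qed

section \<open>Points of the null lines\<close>

lemma act_independent:
  assumes "W \<noteq> 0"
  shows "act1 W 1 0 \<noteq> 0 \<or> act1 W 0 1 \<noteq> 0 \<or> act2 W 1 0 \<noteq> 0 \<or> act2 W 0 1 \<noteq> 0"
proof -
  obtain m11 m12 m21 m22 where m: "W = of_mat m11 m12 m21 m22" by (rule of_mat_cases)
  have "of_mat 0 0 0 0 = 0" by (simp add: of_mat_def vec_eq_iff forall_4)
  then show ?thesis using assms by (auto simp: m)
qed

text \<open>A null matrix has rank at most one, so a nonzero row already determines its kernel. This
  reduces two equations to one, as a hypersurface requires.\<close>

lemma null_rows:
  assumes "cdot W W = 0" and ac: "ac = act1 \<or> ac = act2" and nz: "ac W a' b' \<noteq> 0"
  shows "ac W a b = 0 \<longleftrightarrow> act1 W a b = 0 \<and> act2 W a b = 0"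
proof -
  obtain m11 m12 m21 m22 where m: "W = of_mat m11 m12 m21 m22" by (rule of_mat_cases)
  have det: "m11 * m22 = m12 * m21" using assms(1) unfolding m cdot_of_mat by (simp add: algebra_simps)
  have 1: "m21 * a + m22 * b = 0" if "m11 * a + m12 * b = 0" "m11 \<noteq> 0 \<or> m12 \<noteq> 0"
  proof -
    have "m11 * (m21 * a + m22 * b) = 0" "m12 * (m21 * a + m22 * b) = 0" using that(1) det by algebra+
    then show ?thesis using that(2) by auto
  qed
  have 2: "m11 * a + m12 * b = 0" if "m21 * a + m22 * b = 0" "m21 \<noteq> 0 \<or> m22 \<noteq> 0"
  proof -
    have "m21 * (m11 * a + m12 * b) = 0" "m22 * (m11 * a + m12 * b) = 0" using that(1) det by algebra+
    then show ?thesis using that(2) by auto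
  qed
  show ?thesis using ac
  proof
    assume ac1: "ac = act1"
    then have "m11 \<noteq> 0 \<or> m12 \<noteq> 0" using nz by (auto simp: m)
    then show ?thesis unfolding ac1 m act_of_mat using 1 by blast
  next
    assume ac2: "ac = act2"
    then have "m21 \<noteq> 0 \<or> m22 \<noteq> 0" using nz by (auto simp: m)
    then show ?thesis unfolding ac2 m act_of_mat using 2 by blast
  qed
qed

lemma null_kernel_exists:
  assumes "cdot W W = 0" "W \<noteq> 0"
  obtains a b where "a \<noteq> 0 \<or> b \<noteq> 0" "act1 W a b = 0" "act2 W a b = 0"
proof -
  obtain m11 m12 m21 m22 where m: "W = of_mat m11 m12 m21 m22" by (rule of_mat_cases)
  have det: "m11 * m22 = m12 * m21" using assms(1) unfolding m cdot_of_mat by (simp add: algebra_simps)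
  have "of_mat 0 0 0 0 = 0" by (simp add: of_mat_def vec_eq_iff forall_4)
  then have nz: "m11 \<noteq> 0 \<or> m12 \<noteq> 0 \<or> m21 \<noteq> 0 \<or> m22 \<noteq> 0" using assms(2) m by auto
  show ?thesis
  proof (cases "m11 = 0 \<and> m12 = 0")
    case True
    then show ?thesis using nz by (intro that[of m22 "- m21"]) (auto simp: m)
  next
    case False
    then show ?thesis using det by (intro that[of m12 "- m11"]) (auto simp: m algebra_simps)
  qed
qed

lemma kernel_line:
  assumes W: "W \<noteq> 0" "act1 W a b = 0" "act2 W a b = 0" "act1 W a' b' = 0" "act2 W a' b' = 0"
    and nz: "a \<noteq> 0 \<or> b \<noteq> 0"
  obtains k where "a' = k * a" "b' = k * b"
proof -
  obtain m11 m12 m21 m22 where m: "W = of_mat m11 m12 m21 m22" by (rule of_mat_cases)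
  have "of_mat 0 0 0 0 = 0" by (simp add: of_mat_def vec_eq_iff forall_4)
  then have mz: "m11 \<noteq> 0 \<or> m12 \<noteq> 0 \<or> m21 \<noteq> 0 \<or> m22 \<noteq> 0" using W(1) m by auto
  have "m11 * (a * b' - b * a') = 0" "m12 * (a * b' - b * a') = 0"
    "m21 * (a * b' - b * a') = 0" "m22 * (a * b' - b * a') = 0"
    using W(2-5) unfolding m act_of_mat by algebra+
  then have "a * b' - b * a' = 0" using mz by auto
  then have "a' * (- b) + b' * a = 0" by (simp add: algebra_simps)
  moreover have "- b \<noteq> 0 \<or> a \<noteq> 0" using nz by auto
  ultimately obtain c where "a' = - c * a" "b' = c * - b" by (rule row_multiple)
  then show ?thesis by (intro that[of "- c"]) simp_all
qed

section \<open>Real points and sections of the family of null lines\<close>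

lemma cquat_of_mat: "cquat x = of_mat (fst x) (- cnj (snd x)) (snd x) (cnj (fst x))"
  by (simp add: vec_eq_iff forall_4 cquat_nth of_mat_def complex_eq_iff)

lemma act_cquat: "act1 (cquat x) a b = fst (x \<otimes>\<^sub>q (a, b))" "act2 (cquat x) a b = snd (x \<otimes>\<^sub>q (a, b))"
  by (simp_all add: cquat_of_mat qmult_def)

text \<open>Right multiplication by \<open>quat_i\<close> is the scalar i on pairs of complex
  numbers, so the quaternionic expression is the matrix W = P + i R applied to (a, b).\<close>

lemma act_gradient_iff:
  "act1 W a b = 0 \<and> act2 W a b = 0 \<longleftrightarrow>
    grad_re W \<otimes>\<^sub>q (a, b) + (grad_im W \<otimes>\<^sub>q (a, b)) \<otimes>\<^sub>q quat_i = 0"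
  by (auto simp: act1_def act2_def quat_eq_iff qmult_simps quat_i_def grad_re_def grad_im_def complex_eq_iff algebra_simps)

lemma holo_of_mat:
  assumes "holo m11 U" "holo m12 U" "holo m21 U" "holo m22 U"
  shows "holo (\<lambda>z. of_mat (m11 z) (m12 z) (m21 z) (m22 z) $ j) U"
proof -
  have c: "holo (\<lambda>z. f z / c) U" if "holo f U" "c \<noteq> 0" for f c
    using that holo_divide[OF that(1) holo_const[OF holo_open[OF that(1)], of c]] by simp
  have "\<forall>j. holo (\<lambda>z. of_mat (m11 z) (m12 z) (m21 z) (m22 z) $ j) U"
    unfolding forall_4 of_mat_def vector_4
    by (intro conjI c holo_add[OF assms(1,4)] holo_diff[OF assms(1,4)] holo_diff[OF assms(3,2)]
        holo_add[OF assms(3,2)]) simp_all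
  then show ?thesis by blast
qed

lemma holo_twistor_section:
  assumes "open U" "\<And>z. z \<in> U \<Longrightarrow> z$3 * n2 - z$4 * n1 \<noteq> 0" "\<And>z. z \<in> U \<Longrightarrow> z$1 * x2 - z$2 * x1 \<noteq> 0"
  shows "holo (\<lambda>z. twistor_section n1 n2 x1 x2 z $ j) U"
proof -
  note m = holo_mult[OF holo_nth[OF assms(1)] holo_const[OF assms(1)]]
    holo_mult[OF holo_const[OF assms(1)] holo_nth[OF assms(1)]]
  have 1: "holo (\<lambda>z. (c * z$i) / (z$3 * n2 - z$4 * n1)) U" "holo (\<lambda>z. (z$i * c) / (z$1 * x2 - z$2 * x1)) U" for c i
    by (rule holo_divide[OF m(2) holo_diff[OF m(1) m(1)] assms(2)], simp)
       (rule holo_divide[OF m(1) holo_diff[OF m(1) m(1)] assms(3)], simp)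
  show ?thesis
    unfolding twistor_section_def Let_def by (intro holo_of_mat holo_diff 1)
qed

lemma continuous_of_mat:
  assumes "continuous_on S m11" "continuous_on S m12" "continuous_on S m21" "continuous_on S m22"
  shows "continuous_on S (\<lambda>z. of_mat (m11 z) (m12 z) (m21 z) (m22 z))"
proof -
  have "\<forall>j. continuous_on S (\<lambda>z. of_mat (m11 z) (m12 z) (m21 z) (m22 z) $ j)"
    unfolding forall_4 of_mat_def vector_4 using assms by (intro conjI continuous_intros) simp_all
  then have "continuous_on S (\<lambda>z. \<chi> j. of_mat (m11 z) (m12 z) (m21 z) (m22 z) $ j)"
    by (intro continuous_on_vec_lambda) blast
  then show ?thesis by simp
qed

text \<open>A continuous choice, not holomorphic, of a point on every null line. It lies on \<open>S\<^sup>3\<close> when the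
  line meets \<open>S\<^sup>3\<close>, which makes the intersection with the quadric immediate.\<close>

definition canonical_section :: "complex^4 \<Rightarrow> complex^4" where
  "canonical_section z = twistor_section (- cnj (z$4)) (cnj (z$3)) (- cnj (z$2)) (cnj (z$1)) z"

lemma hermitian_form_nonzero: "a * cnj a - b * - cnj b \<noteq> 0 \<longleftrightarrow> a \<noteq> 0 \<or> b \<noteq> 0"
proof -
  have "a * cnj a - b * - cnj b = of_real ((cmod a)\<^sup>2 + (cmod b)\<^sup>2)"
    by (simp add: complex_norm_square[symmetric])
  also have "\<dots> \<noteq> 0 \<longleftrightarrow> a \<noteq> 0 \<or> b \<noteq> 0"
    unfolding of_real_eq_0_iff by (simp add: sum_power2_eq_zero_iff)
  finally show ?thesis .
qed

lemma canonical_section: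
  assumes "z$1 \<noteq> 0 \<or> z$2 \<noteq> 0" "z$3 \<noteq> 0 \<or> z$4 \<noteq> 0"
  shows "act1 (canonical_section z) (z$3) (z$4) = z$1" "act2 (canonical_section z) (z$3) (z$4) = z$2"
    "cdot (canonical_section z) (canonical_section z) = 1"
  unfolding canonical_section_def using assms hermitian_form_nonzero by (intro twistor_section; blast)+

lemma continuous_canonical_section:
  "continuous_on {z. (z$1 \<noteq> 0 \<or> z$2 \<noteq> 0) \<and> (z$3 \<noteq> 0 \<or> z$4 \<noteq> 0)} canonical_section"
  unfolding canonical_section_def twistor_section_def Let_def
  by (intro continuous_of_mat continuous_intros) (use hermitian_form_nonzero in auto)

text \<open>Each quotient carries one factor k and one conjugate factor above and below, so |k|^2
  cancels and the section is well defined on projective space.\<close>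

lemma canonical_section_scale:
  assumes "k \<noteq> 0"
  shows "canonical_section (k *s z) = canonical_section z"
proof -
  have k: "cnj k \<noteq> 0" using assms by simp
  have c: "(cnj k * a) * (k * b) / (k * c * (cnj k * d) - k * e * (- (cnj k * f))) = a * b / (c * d - e * (- f))"
    for a b c d e f
  proof -
    have "k * c * (cnj k * d) - k * e * (- (cnj k * f)) = (k * cnj k) * (c * d - e * (- f))"
      "(cnj k * a) * (k * b) = (k * cnj k) * (a * b)" by (simp_all add: algebra_simps)
    then show ?thesis using k assms by simp
  qed
  show ?thesis
    unfolding canonical_section_def twistor_section_def Let_def vector_smult_component complex_cnj_mult
    using c[of "cnj (z$3)" "z$1" "z$3" "cnj (z$3)" "z$4" "cnj (z$4)"]
      c[of "cnj (z$3)" "z$2" "z$3" "cnj (z$3)" "z$4" "cnj (z$4)"]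
      c[of "- cnj (z$4)" "z$1" "z$3" "cnj (z$3)" "z$4" "cnj (z$4)"]
      c[of "- cnj (z$4)" "z$2" "z$3" "cnj (z$3)" "z$4" "cnj (z$4)"]
      c[of "- cnj (z$2)" "z$4" "z$1" "cnj (z$1)" "z$2" "cnj (z$2)"]
      c[of "- cnj (z$2)" "z$3" "z$1" "cnj (z$1)" "z$2" "cnj (z$2)"]
      c[of "cnj (z$1)" "z$4" "z$1" "cnj (z$1)" "z$2" "cnj (z$2)"]
      c[of "cnj (z$1)" "z$3" "z$1" "cnj (z$1)" "z$2" "cnj (z$2)"]
    by (simp add: mult_ac)
qed

text \<open>With \<lambda> = (z3, z4) and \<eta> = (z1, z2), the section maps \<lambda> to \<eta>
  and \<lambda> j to a multiple of \<eta> j. On the quadric both denominators are |\<lambda>|^2 =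
  |\<eta>|^2, the multiple is 1, and the matrix is left multiplication by a quaternion, of norm 1 by
  the determinant.\<close>

lemma canonical_section_quadric:
  assumes nz: "z$1 \<noteq> 0 \<or> z$2 \<noteq> 0" "z$3 \<noteq> 0 \<or> z$4 \<noteq> 0"
    and Q: "(cmod (z$1))\<^sup>2 + (cmod (z$2))\<^sup>2 - (cmod (z$3))\<^sup>2 - (cmod (z$4))\<^sup>2 = 0"
  obtains x where "x \<in> S3" "canonical_section z = cquat x"
proof -
  define n where "n = (cmod (z$1))\<^sup>2 + (cmod (z$2))\<^sup>2"
  have n2: "n = (cmod (z$3))\<^sup>2 + (cmod (z$4))\<^sup>2" using Q by (simp add: n_def)
  have n: "z$1 * cnj (z$1) - z$2 * - cnj (z$2) = of_real n"
    by (simp add: n_def complex_norm_square[symmetric])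
  have "z$3 * cnj (z$3) - z$4 * - cnj (z$4) = of_real n"
    by (simp add: n2 complex_norm_square[symmetric])
  note n = n this
  define x where "x = (cnj (z$3) * z$1 / of_real n + z$4 * cnj (z$2) / of_real n,
     cnj (z$3) * z$2 / of_real n - z$4 * cnj (z$1) / of_real n)"
  have c: "canonical_section z = cquat x"
    unfolding canonical_section_def twistor_section_def Let_def n cquat_of_mat x_def
    by (simp add: mult_ac)
  have "of_real (x \<bullet> x) = (1 :: complex)"
    using canonical_section(3)[OF nz] unfolding c cdot_cquat_self .
  then have "x \<bullet> x = 1" by (simp only: of_real_eq_1_iff)
  then have "x \<in> S3" by (simp add: norm_eq_1)
  with c show ?thesis using that by blast
qed

text \<open>Left multiplication by \<open>x\<close> commutes with right multiplication by j, so it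
  also maps \<lambda> j to \<eta> j, and \<open>twistor_section_eqI\<close> recognises it. The
  equality of denominators there is the equation of the quadric.\<close>

lemma canonical_section_cquat:
  assumes z: "z$1 = act1 (cquat x) (z$3) (z$4)" "z$2 = act2 (cquat x) (z$3) (z$4)" and nz: "z$3 \<noteq> 0 \<or> z$4 \<noteq> 0"
    and x: "x \<in> S3"
  shows "canonical_section z = cquat x"
    "(cmod (z$1))\<^sup>2 + (cmod (z$2))\<^sup>2 - (cmod (z$3))\<^sup>2 - (cmod (z$4))\<^sup>2 = 0"
    "z$1 \<noteq> 0 \<or> z$2 \<noteq> 0"
proof -
  have xx: "x \<bullet> x = 1" using x by (simp add: norm_eq_1)
  have X: "cdot (cquat x) (cquat x) = 1" by (simp add: cdot_cquat_self xx)
  have nz': "z$3 * cnj (z$3) - z$4 * - cnj (z$4) \<noteq> 0" using nz hermitian_form_nonzero by blast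
  have "- cnj (z$2) = act1 (cquat x) (- cnj (z$4)) (cnj (z$3))" "cnj (z$1) = act2 (cquat x) (- cnj (z$4)) (cnj (z$3))"
    unfolding z by (simp_all add: cquat_of_mat algebra_simps)
  note e = twistor_section_eqI[OF X z this nz']
  show "canonical_section z = cquat x" unfolding canonical_section_def by (rule e(1))
  have "of_real ((cmod (z$1))\<^sup>2 + (cmod (z$2))\<^sup>2) = complex_of_real ((cmod (z$3))\<^sup>2 + (cmod (z$4))\<^sup>2)"
    using e(2) by (simp add: complex_norm_square[symmetric])
  then have "(cmod (z$1))\<^sup>2 + (cmod (z$2))\<^sup>2 = (cmod (z$3))\<^sup>2 + (cmod (z$4))\<^sup>2"
    by (simp only: of_real_eq_iff)
  then show "(cmod (z$1))\<^sup>2 + (cmod (z$2))\<^sup>2 - (cmod (z$3))\<^sup>2 - (cmod (z$4))\<^sup>2 = 0" by simp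
  show "z$1 \<noteq> 0 \<or> z$2 \<noteq> 0" using nz' e(2) by auto
qed

lemma span_singleton_eq_iff:
  fixes z z' :: "complex^'n"
  assumes "vec.span {z} = vec.span {z'}" "z \<noteq> 0"
  obtains k where "k \<noteq> 0" "z = k *s z'"
proof -
  have "z \<in> vec.span {z'}" using assms(1) vec.span_base[of z "{z}"] by auto
  then obtain k where "z = k *s z'" unfolding vec.span_singleton by auto
  then show ?thesis using assms(2) by (intro that[of k]) auto
qed

section \<open>The twistor surface\<close>

text \<open>An invertible matrix taking (z3, z4) to (z1, z2) needs both to be nonzero or both zero;
  the latter is excluded. By \<open>chart_overlap\<close> the chart does not matter, and by
  \<open>chart_null_line\<close> any other point of the null line in the same ball would serve as
  well as the canonical one.\<close>

definition on_twistor_surface :: "(quat \<Rightarrow> real) \<Rightarrow> (quat \<Rightarrow> complex^4 \<Rightarrow> complex) \<Rightarrow> complex^4 \<Rightarrow> bool" where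
  "on_twistor_surface r w z \<longleftrightarrow> (z$1 \<noteq> 0 \<or> z$2 \<noteq> 0) \<and> (z$3 \<noteq> 0 \<or> z$4 \<noteq> 0) \<and>
     (\<exists>p\<in>S3. canonical_section z \<in> ball (cquat p) (r p) \<and>
        act1 (cgrad (w p) (canonical_section z)) (z$3) (z$4) = 0 \<and>
        act2 (cgrad (w p) (canonical_section z)) (z$3) (z$4) = 0)"

definition twistor_surface :: "(quat \<Rightarrow> real) \<Rightarrow> (quat \<Rightarrow> complex^4 \<Rightarrow> complex) \<Rightarrow> (complex^4) set set" where
  "twistor_surface r w = {vec.span {z} | z. on_twistor_surface r w z}"

lemma act_add:
  "act1 M (a + t * c) (b + t * d) = act1 M a b + t * act1 M c d"
  "act2 M (a + t * c) (b + t * d) = act2 M a b + t * act2 M c d"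
  by (simp_all add: act1_def act2_def algebra_simps)

lemma on_twistor_surface_scale:
  assumes "on_twistor_surface r w z" "k \<noteq> 0"
  shows "on_twistor_surface r w (k *s z)"
  using assms unfolding on_twistor_surface_def
  by (simp add: canonical_section_scale act_linear)

lemma on_twistor_surface_nonzero: "on_twistor_surface r w z \<Longrightarrow> z \<noteq> 0"
  by (auto simp: on_twistor_surface_def)

lemma span_mem_twistor_surface:
  "vec.span {z} \<in> twistor_surface r w \<longleftrightarrow> on_twistor_surface r w z"
proof
  assume "vec.span {z} \<in> twistor_surface r w"
  then obtain z' where z': "vec.span {z'} = vec.span {z}" "on_twistor_surface r w z'"
    unfolding twistor_surface_def by auto
  obtain k where k: "k \<noteq> 0" "z' = k *s z"
    using span_singleton_eq_iff[OF z'(1) on_twistor_surface_nonzero[OF z'(2)]] .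
  then have "z = inverse k *s z'" by (simp add: vec_eq_iff)
  then show "on_twistor_surface r w z" using on_twistor_surface_scale[OF z'(2), of "inverse k"] k by simp
qed (auto simp: twistor_surface_def)

lemma twistor_surface_subset_CP3: "twistor_surface r w \<subseteq> CP3"
proof
  fix e assume "e \<in> twistor_surface r w"
  then obtain z where z: "e = vec.span {z}" "on_twistor_surface r w z" unfolding twistor_surface_def by auto
  have "vec.independent {z}" using on_twistor_surface_nonzero[OF z(2)] by simp
  then have "vec.dim (vec.span {z}) = 1" by (simp add: vec.dim_span_eq_card_independent)
  then show "e \<in> CP3" unfolding CP3_def z(1) by simp
qed

context
  fixes \<pi> :: "quat \<Rightarrow> real^3" and o3 o2 :: real and s r :: "quat \<Rightarrow> real"
    and w :: "quat \<Rightarrow> complex^4 \<Rightarrow> complex"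
  assumes o: "o3 \<in> {1, -1}" "o2 \<in> {1, -1}" and conf: "conformal_submersion \<pi>"
    and chart: "\<And>p. p \<in> S3 \<Longrightarrow> conformal_chart \<pi> (o2 * o3) p (s p) (r p) (w p)"
begin

lemma orientation_sign: "(o2 * o3) * (o2 * o3) = 1"
  using o by auto

lemma centre_in_chart: "x \<in> S3 \<Longrightarrow> x \<in> ball x (r x)" "x \<in> S3 \<Longrightarrow> cquat x \<in> ball (cquat x) (r x)"
  using chart by (simp_all add: conformal_chart_def)

text \<open>The unit vector \<mu> is eliminated: by \<open>positive_fiber_tangent_iff\<close>,
  positivity of \<open>x \<otimes>\<^sub>q \<mu>\<close> amounts to orthogonality to the gradients
  and one sign, and \<open>positive_tangent_iff_kernel\<close> turns the existence of such a \<mu>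
  with \<mu> q = q i into W q = 0.\<close>

lemma Psi_eq_kernel:
  assumes x: "x \<in> S3"
  shows "Psi o3 o2 \<pi> x = {z. z$1 = act1 (cquat x) (z$3) (z$4) \<and> z$2 = act2 (cquat x) (z$3) (z$4) \<and>
    act1 (cgrad (w x) (cquat x)) (z$3) (z$4) = 0 \<and> act2 (cgrad (w x) (cquat x)) (z$3) (z$4) = 0}"
proof -
  define P R where PR: "P = grad_re (cgrad (w x) (cquat x))" "R = grad_im (cgrad (w x) (cquat x))"
  have nx: "norm x = 1" "x \<noteq> 0" "sgn x = x" using x by (auto simp: sgn_div_norm)
  have C: "\<forall>y\<in>ball x (r x). y \<noteq> 0 \<and> 1 - s x * \<pi> (sgn y) $ 3 \<noteq> 0 \<and> w x (cquat y) = stereo (s x) (o2 * o3) (\<pi> (sgn y))"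
    using chart[OF x] unfolding conformal_chart_def by blast
  have c: "s x * s x = 1" "1 - s x * \<pi> x $ 3 \<noteq> 0" "1 - s x * \<pi> (sgn x) $ 3 \<noteq> 0" "holo (w x) (ball (cquat x) (r x))"
    "\<And>y. y \<in> ball x (r x) \<Longrightarrow> w x (cquat y) = stereo (s x) (o2 * o3) (\<pi> (sgn y))"
    using chart[OF x] C[THEN bspec, OF centre_in_chart(1)[OF x]] C nx(3) unfolding conformal_chart_def by metis+
  note L = chart_gradient[where \<pi> = \<pi>, OF c(4) centre_in_chart(1)[OF x] c(5), folded PR]
  note cg = conformal_gradient(1-5)[OF conf nx(2) c(1) orientation_sign c(3) L]
  note pos = positive_fiber_tangent_iff[OF conf nx(1) o c(1,2) L]
  have xx: "x \<bullet> x = 1" using nx by (simp add: norm_eq_1)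
  have pos': "positive_fiber_tangent o3 o2 \<pi> x (x \<otimes>\<^sub>q \<mu>) \<longleftrightarrow>
      (x \<otimes>\<^sub>q \<mu>) \<bullet> P = 0 \<and> (x \<otimes>\<^sub>q \<mu>) \<bullet> R = 0 \<and> vdet x (x \<otimes>\<^sub>q \<mu>) P R < 0"
    if \<mu>: "\<mu> \<in> ImH" "norm \<mu> = 1" for \<mu>
  proof -
    have "(x \<otimes>\<^sub>q \<mu>) \<bullet> x = 0" using qmult_inner_adjoint[OF \<mu>(1), of x x] by (simp add: inner_commute)
    moreover have "(x \<otimes>\<^sub>q \<mu>) \<bullet> (x \<otimes>\<^sub>q \<mu>) = 1" using \<mu>(2) xx by (simp add: qmult_inner_left norm_eq_1)
    then have "x \<otimes>\<^sub>q \<mu> \<noteq> 0" by auto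
    ultimately show ?thesis using pos by blast
  qed
  have "Psi o3 o2 \<pi> x = {H2_to_C4 (x \<otimes>\<^sub>q q, q) | q. \<exists>\<mu>\<in>ImH. norm \<mu> = 1 \<and> (x \<otimes>\<^sub>q \<mu>) \<bullet> P = 0 \<and>
      (x \<otimes>\<^sub>q \<mu>) \<bullet> R = 0 \<and> vdet x (x \<otimes>\<^sub>q \<mu>) P R < 0 \<and> \<mu> \<otimes>\<^sub>q q = q \<otimes>\<^sub>q quat_i}"
    unfolding Psi_def SS3_to_Q_def fiber_tangent_map_def prod.case mem_Collect_eq using pos' by blast
  also have "\<dots> = {H2_to_C4 (x \<otimes>\<^sub>q q, q) | q. P \<otimes>\<^sub>q q + (R \<otimes>\<^sub>q q) \<otimes>\<^sub>q quat_i = 0}"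
    using positive_tangent_iff_kernel[OF xx cg] by blast
  also have "\<dots> = {z. z$1 = act1 (cquat x) (z$3) (z$4) \<and> z$2 = act2 (cquat x) (z$3) (z$4) \<and>
    act1 (cgrad (w x) (cquat x)) (z$3) (z$4) = 0 \<and> act2 (cgrad (w x) (cquat x)) (z$3) (z$4) = 0}"
    (is "?A = ?B")
  proof
    show "?A \<subseteq> ?B"
    proof
      fix z assume "z \<in> ?A"
      then obtain q where q: "z = H2_to_C4 (x \<otimes>\<^sub>q q, q)" "P \<otimes>\<^sub>q q + (R \<otimes>\<^sub>q q) \<otimes>\<^sub>q quat_i = 0" by blast
      have zq: "(z$3, z$4) = q" "z$1 = fst (x \<otimes>\<^sub>q q)" "z$2 = snd (x \<otimes>\<^sub>q q)"
        by (simp_all add: q(1) H2_to_C4_def)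
      show "z \<in> ?B"
        using q(2) act_gradient_iff[of "cgrad (w x) (cquat x)" "z$3" "z$4"] unfolding mem_Collect_eq act_cquat zq(1)
        by (simp add: zq(2,3) PR)
    qed
    show "?B \<subseteq> ?A"
    proof
      fix z assume z: "z \<in> ?B"
      have "z = H2_to_C4 (x \<otimes>\<^sub>q (z$3, z$4), (z$3, z$4))"
        using z by (simp add: vec_eq_iff forall_4 H2_to_C4_def act_cquat)
      moreover have "P \<otimes>\<^sub>q (z$3, z$4) + (R \<otimes>\<^sub>q (z$3, z$4)) \<otimes>\<^sub>q quat_i = 0"
        using z act_gradient_iff[of "cgrad (w x) (cquat x)" "z$3" "z$4"] by (simp add: PR)
      ultimately show "z \<in> ?A" by blast
    qed
  qed
  finally show ?thesis .
qed

text \<open>The kernel of a nonzero singular matrix is a line, and the first two coordinates are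
  functions of the last two.\<close>

lemma Psi_eq_span:
  assumes x: "x \<in> S3" and z: "z \<in> Psi o3 o2 \<pi> x" "z$3 \<noteq> 0 \<or> z$4 \<noteq> 0"
  shows "Psi o3 o2 \<pi> x = vec.span {z}"
proof -
  have W0: "cgrad (w x) (cquat x) \<noteq> 0"
    using chart[OF x] centre_in_chart(2)[OF x] unfolding conformal_chart_def by blast
  have zk: "z$1 = act1 (cquat x) (z$3) (z$4)" "z$2 = act2 (cquat x) (z$3) (z$4)"
    "act1 (cgrad (w x) (cquat x)) (z$3) (z$4) = 0" "act2 (cgrad (w x) (cquat x)) (z$3) (z$4) = 0"
    using z(1) unfolding Psi_eq_kernel[OF x] by auto
  show ?thesis
    unfolding Psi_eq_kernel[OF x] vec.span_singleton
  proof (intro set_eqI iffI)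
    fix y :: "complex^4" assume "y \<in> {z. z$1 = act1 (cquat x) (z$3) (z$4) \<and> z$2 = act2 (cquat x) (z$3) (z$4) \<and>
      act1 (cgrad (w x) (cquat x)) (z$3) (z$4) = 0 \<and> act2 (cgrad (w x) (cquat x)) (z$3) (z$4) = 0}"
    then have y: "y$1 = act1 (cquat x) (y$3) (y$4)" "y$2 = act2 (cquat x) (y$3) (y$4)"
      "act1 (cgrad (w x) (cquat x)) (y$3) (y$4) = 0" "act2 (cgrad (w x) (cquat x)) (y$3) (y$4) = 0" by auto
    obtain k where k: "y$3 = k * z$3" "y$4 = k * z$4"
      using kernel_line[OF W0 zk(3,4) y(3,4) z(2)] .
    have "y = k *s z"
      using y(1,2) unfolding k act_linear zk(1,2)[symmetric] by (simp add: vec_eq_iff forall_4 k)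
    then show "y \<in> range (\<lambda>k. k *s z)" by blast
  next
    fix y :: "complex^4" assume "y \<in> range (\<lambda>k. k *s z)"
    then obtain k where "y = k *s z" by blast
    then show "y \<in> {z. z$1 = act1 (cquat x) (z$3) (z$4) \<and> z$2 = act2 (cquat x) (z$3) (z$4) \<and>
      act1 (cgrad (w x) (cquat x)) (z$3) (z$4) = 0 \<and> act2 (cgrad (w x) (cquat x)) (z$3) (z$4) = 0}"
      using zk by (simp add: act_linear)
  qed
qed

lemma kernel_independent_of_chart:
  assumes "p \<in> S3" "p' \<in> S3" "X \<in> ball (cquat p) (r p)" "X \<in> ball (cquat p') (r p')"
  shows "act1 (cgrad (w p) X) a b = 0 \<and> act2 (cgrad (w p) X) a b = 0
    \<longleftrightarrow> act1 (cgrad (w p') X) a b = 0 \<and> act2 (cgrad (w p') X) a b = 0"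
proof -
  obtain k where "k \<noteq> 0" "cgrad (w p) X = k *s cgrad (w p') X"
    using chart_overlap[OF conf orientation_sign chart chart, of p p' X] assms by blast
  then show ?thesis by (simp add: act_linear)
qed

lemma Psi_image_eq: "Psi o3 o2 \<pi> ` S3 = twistor_surface r w \<inter> real_quadric"
proof (intro set_eqI iffI)
  fix e assume "e \<in> Psi o3 o2 \<pi> ` S3"
  then obtain x where x: "x \<in> S3" "e = Psi o3 o2 \<pi> x" by blast
  have W0: "cgrad (w x) (cquat x) \<noteq> 0"
    using chart[OF x(1)] centre_in_chart(2)[OF x(1)] unfolding conformal_chart_def by blast
  \<comment> \<open>The gradient is null, so it has a nonzero kernel vector; together with its image
    under \<open>x\<close> this gives the point of the surface.\<close>
  obtain a b where ab: "a \<noteq> 0 \<or> b \<noteq> 0" "act1 (cgrad (w x) (cquat x)) a b = 0" "act2 (cgrad (w x) (cquat x)) a b = 0"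
    using null_kernel_exists[OF chart_null(1)[OF conf orientation_sign chart[OF x(1)] centre_in_chart(2)[OF x(1)]] W0] .
  define z :: "complex^4" where "z = vector [act1 (cquat x) a b, act2 (cquat x) a b, a, b]"
  have z: "z$1 = act1 (cquat x) (z$3) (z$4)" "z$2 = act2 (cquat x) (z$3) (z$4)" "z$3 = a" "z$4 = b" by (simp_all add: z_def)
  have zn: "z$3 \<noteq> 0 \<or> z$4 \<noteq> 0" using ab(1) by (simp add: z)
  have "z \<in> Psi o3 o2 \<pi> x" unfolding Psi_eq_kernel[OF x(1)] using z ab by simp
  from Psi_eq_span[OF x(1) this zn] have e: "e = vec.span {z}" by (simp add: x(2))
  note cs = canonical_section_cquat[OF z(1,2) zn x(1)]
  have "on_twistor_surface r w z"
    unfolding on_twistor_surface_def cs(1)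
    by (intro conjI cs(3) zn bexI[OF _ x(1)] centre_in_chart(2)[OF x(1)]) (simp_all only: z(3,4) ab(2,3))
  moreover have "z \<noteq> 0" using zn by auto
  then have "e \<in> real_quadric" unfolding real_quadric_def e using cs(2) by blast
  ultimately show "e \<in> twistor_surface r w \<inter> real_quadric"
    by (simp add: e span_mem_twistor_surface)
next
  fix e assume "e \<in> twistor_surface r w \<inter> real_quadric"
  then obtain z where e: "e = vec.span {z}" and z0: "z \<noteq> 0"
    and Q: "(cmod (z$1))\<^sup>2 + (cmod (z$2))\<^sup>2 - (cmod (z$3))\<^sup>2 - (cmod (z$4))\<^sup>2 = 0"
    and on: "on_twistor_surface r w z"
    unfolding real_quadric_def using span_mem_twistor_surface by auto
  then have nz: "z$1 \<noteq> 0 \<or> z$2 \<noteq> 0" "z$3 \<noteq> 0 \<or> z$4 \<noteq> 0" by (auto simp: on_twistor_surface_def)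
  obtain x where x: "x \<in> S3" "canonical_section z = cquat x" using canonical_section_quadric[OF nz Q] .
  obtain p where p: "p \<in> S3" "cquat x \<in> ball (cquat p) (r p)"
    "act1 (cgrad (w p) (cquat x)) (z$3) (z$4) = 0" "act2 (cgrad (w p) (cquat x)) (z$3) (z$4) = 0"
    using on unfolding on_twistor_surface_def x(2) by blast
  \<comment> \<open>Membership is witnessed in the chart centred at \<open>p\<close>, whereas
    \<open>Psi_eq_kernel\<close> uses the chart centred at \<open>x\<close>.\<close>
  have "act1 (cgrad (w x) (cquat x)) (z$3) (z$4) = 0 \<and> act2 (cgrad (w x) (cquat x)) (z$3) (z$4) = 0"
    using kernel_independent_of_chart[OF p(1) x(1) p(2) centre_in_chart(2)[OF x(1)]] p(3,4) by blast
  then have "z \<in> Psi o3 o2 \<pi> x"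
    unfolding Psi_eq_kernel[OF x(1)] using canonical_section(1,2)[OF nz] by (simp add: x(2))
  from Psi_eq_span[OF x(1) this nz(2)] show "e \<in> Psi o3 o2 \<pi> ` S3" using x(1) e by blast
qed

text \<open>\<open>H z\<close> is one row of the gradient at the point of the null line of \<open>z\<close> chosen by a holomorphic
  section; the section is constant along the twistor line over \<open>X0\<close>, which makes \<open>H\<close> regular.\<close>

lemma twistor_surface_local_equation:
  assumes on: "on_twistor_surface r w z0"
  obtains U H d where "z0 \<in> U" "holo H U" "\<And>z. z \<in> U \<Longrightarrow> on_twistor_surface r w z \<longleftrightarrow> H z = 0"
    "cdot (cgrad H z0) z0 = 0" "cdot (cgrad H z0) d \<noteq> 0"
proof -
  obtain p where nz: "z0$1 \<noteq> 0 \<or> z0$2 \<noteq> 0" "z0$3 \<noteq> 0 \<or> z0$4 \<noteq> 0" and p: "p \<in> S3"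
    and b0: "canonical_section z0 \<in> ball (cquat p) (r p)"
    and k0: "act1 (cgrad (w p) (canonical_section z0)) (z0$3) (z0$4) = 0"
      "act2 (cgrad (w p) (canonical_section z0)) (z0$3) (z0$4) = 0"
    using on unfolding on_twistor_surface_def by blast
  define X0 where "X0 = canonical_section z0"
  define W where "W = cgrad (w p)"
  define B where "B = ball (cquat p) (r p)"
  note X0 = canonical_section[OF nz, folded X0_def]
  note c = chart[OF p]
  have hw: "holo (w p) B" using c by (simp add: conformal_chart_def B_def)
  have W0: "W X \<noteq> 0" if "X \<in> B" for X using c that by (auto simp: conformal_chart_def B_def W_def)
  have Wnull: "cdot (W X) (W X) = 0" if "X \<in> B" for X
    using chart_null(1)[OF conf orientation_sign c] that by (simp add: W_def B_def)
  have X0B: "X0 \<in> B" using b0 by (simp add: X0_def B_def)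
  \<comment> \<open>A row of the gradient that is nonzero at \<open>X0\<close>, with a vector (a',
    b') on which it does not vanish.\<close>
  obtain ac a' b' where ac: "ac = act1 \<or> ac = act2" "ac (W X0) a' b' \<noteq> 0"
    using act_independent[OF W0[OF X0B]] by metis
  \<comment> \<open>Freezing these values at \<open>z0\<close> makes the section holomorphic in
    \<open>z\<close>, unlike \<open>canonical_section\<close>, and still gives
    \<open>Y z0 = X0\<close>.\<close>
  define n1 n2 where n: "n1 = - cnj (z0$4)" "n2 = cnj (z0$3)"
  define x1 x2 where x: "x1 = act1 X0 n1 n2" "x2 = act2 X0 n1 n2"
  define Y where "Y = twistor_section n1 n2 x1 x2"
  define H where "H z = ac (W (Y z)) (z$3) (z$4)" for z
  have Yeq: "Y z = X0" "z$1 * x2 - z$2 * x1 \<noteq> 0"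
    if "z$1 = act1 X0 (z$3) (z$4)" "z$2 = act2 X0 (z$3) (z$4)" "z$3 * n2 - z$4 * n1 \<noteq> 0" for z
    using twistor_section_eqI[OF X0(3) that(1,2) x that(3)] that(3) by (simp_all add: Y_def)
  have d0: "z0$3 * n2 - z0$4 * n1 \<noteq> 0" using nz(2) hermitian_form_nonzero unfolding n by blast
  have e0: "z0$1 * x2 - z0$2 * x1 \<noteq> 0" and Y0: "Y z0 = X0" using Yeq[of z0] X0 d0 by simp_all
  define U1 where "U1 = {z :: complex^4. z$3 * n2 - z$4 * n1 \<noteq> 0} \<inter> {z. z$1 * x2 - z$2 * x1 \<noteq> 0}"
  have U1: "open U1"
    unfolding U1_def by (intro open_Int open_Collect_neq continuous_intros)
  have hY: "holo (\<lambda>z. Y z $ j) U1" for j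
    unfolding Y_def by (intro holo_twistor_section U1) (auto simp: U1_def)
  have U1nz: "z$1 \<noteq> 0 \<or> z$2 \<noteq> 0" "z$3 \<noteq> 0 \<or> z$4 \<noteq> 0" if "z \<in> U1" for z
    using that by (auto simp: U1_def)
  have contY: "continuous_on U1 Y" by (rule holo_vec_continuous[OF hY])
  have contX: "continuous_on U1 canonical_section"
    by (rule continuous_on_subset[OF continuous_canonical_section]) (use U1nz in auto)
  define U2 where "U2 = (U1 \<inter> Y -` B) \<inter> (U1 \<inter> canonical_section -` B)"
  have U2: "open U2" "U2 \<subseteq> U1"
    unfolding U2_def B_def
    using continuous_open_preimage[OF contY U1 open_ball] continuous_open_preimage[OF contX U1 open_ball] by auto
  have hac: "holo (\<lambda>z. ac (W (Y z)) (f z) (g z)) U2" if fg: "holo f U2" "holo g U2" for f g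
  proof -
    have hWY: "holo (\<lambda>z. W (Y z) $ j) U2" for j
      unfolding W_def
      by (rule holo_compose_vec[OF holo_subset[OF hY U2] holo_cgrad[OF hw]]) (auto simp: U2_def)
    have k: "holo (\<lambda>z. \<i> * W (Y z) $ j) U2" for j by (rule holo_mult[OF holo_const[OF U2(1)] hWY])
    show ?thesis
      using ac(1) unfolding act1_def act2_def
      by (elim disjE) (simp_all add: holo_add holo_diff holo_mult fg hWY k)
  qed
  have hH: "holo H U2"
    unfolding H_def by (intro hac holo_nth U2)
  \<comment> \<open>On \<open>U\<close> the chosen row stays nonzero and so has the same kernel as
    the whole gradient.\<close>
  define U where "U = U2 \<inter> (\<lambda>z. ac (W (Y z)) a' b') -` (- {0})"
  have U: "open U" "U \<subseteq> U2"
    unfolding U_def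
    using continuous_open_preimage[OF holo_continuous[OF hac[OF holo_const[OF U2(1)] holo_const[OF U2(1)]]] U2(1),
        of "- {0}" a' b'] by auto
  have z0U1: "z0 \<in> U1" using d0 e0 by (simp add: U1_def)
  have z0U: "z0 \<in> U" using z0U1 X0B ac(2) by (simp add: U_def U2_def Y0 X0_def[symmetric])
  have eq: "on_twistor_surface r w z \<longleftrightarrow> H z = 0" if z: "z \<in> U" for z
  proof -
    have zU2: "z \<in> U2" and zU1: "z \<in> U1" using z U(2) U2(2) by auto
    note zn = U1nz[OF zU1]
    note cz = canonical_section[OF zn]
    have Yz: "act1 (Y z) (z$3) (z$4) = z$1" "act2 (Y z) (z$3) (z$4) = z$2" "cdot (Y z) (Y z) = 1"
      unfolding Y_def using zU1 by (intro twistor_section; simp add: U1_def)+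
    have inB: "Y z \<in> B" "canonical_section z \<in> B" using zU2 by (auto simp: U2_def)
    have "on_twistor_surface r w z \<longleftrightarrow>
        act1 (W (canonical_section z)) (z$3) (z$4) = 0 \<and> act2 (W (canonical_section z)) (z$3) (z$4) = 0"
      unfolding on_twistor_surface_def W_def
      using zn p inB(2) kernel_independent_of_chart[OF _ p] unfolding B_def by blast
    \<comment> \<open>\<open>canonical_section z\<close> and \<open>Y z\<close> lie on the null line
      of \<open>z\<close>. \<open>chart_null_line\<close> assumes the kernel condition at its first
      point, so each direction needs its own instance.\<close>
    also have "\<dots> \<longleftrightarrow> act1 (W (Y z)) (z$3) (z$4) = 0 \<and> act2 (W (Y z)) (z$3) (z$4) = 0"
      using chart_null_line[OF conf orientation_sign c, folded B_def W_def, OF inB(2,1) cz(3) Yz(3) zn(2) cz(1,2) zn(1) Yz(1,2)]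
        chart_null_line[OF conf orientation_sign c, folded B_def W_def, OF inB Yz(3) cz(3) zn(2) Yz(1,2) zn(1) cz(1,2)]
      by metis
    also have "\<dots> \<longleftrightarrow> H z = 0"
      unfolding H_def using null_rows[OF Wnull[OF inB(1)] ac(1), of a' b'] z by (simp add: U_def)
    finally show ?thesis .
  qed
  have hHU: "holo H U" using hH U by (rule holo_subset)
  have D: "((\<lambda>t. H (z0 + t *s v)) has_field_derivative cdot (cgrad H z0) v) (at 0)" for v
    using has_field_derivative_line[of H "cgrad H z0" z0 0 v] holo_derivative[OF hHU z0U] by simp
  have near: "\<forall>\<^sub>F t in nhds 0. (z0 + t *s v)$3 * n2 - (z0 + t *s v)$4 * n1 \<noteq> 0" for v
  proof -
    have "open {t. z0 + t *s v \<in> U1}" by (rule open_line[OF U1])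
    moreover have "0 \<in> {t. z0 + t *s v \<in> U1}" using z0U1 by simp
    ultimately have "\<forall>\<^sub>F t in nhds 0. t \<in> {t. z0 + t *s v \<in> U1}" by (rule eventually_nhds_in_open)
    then show ?thesis by eventually_elim (simp add: U1_def)
  qed
  have H_line: "\<forall>\<^sub>F t in nhds 0. H (z0 + t *s v) = ac (W X0) (z0$3 + t * v$3) (z0$4 + t * v$4)"
    if v: "v$1 = act1 X0 (v$3) (v$4)" "v$2 = act2 X0 (v$3) (v$4)" for v
    using near[of v]
  proof eventually_elim
    case (elim t)
    have "(z0 + t *s v)$1 = act1 X0 ((z0 + t *s v)$3) ((z0 + t *s v)$4)"
      "(z0 + t *s v)$2 = act2 X0 ((z0 + t *s v)$3) ((z0 + t *s v)$4)"
      by (simp_all add: act_add X0(1,2) v)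
    from Yeq(1)[OF this elim] show ?case by (simp add: H_def)
  qed
  have ac_k0: "ac (W X0) (z0$3) (z0$4) = 0" using ac(1) k0 by (auto simp: W_def X0_def)
  have ac_lin: "ac (W X0) (a + t * c) (b + t * d) = ac (W X0) a b + t * ac (W X0) c d" for a b c d t
    using ac(1) by (auto simp: act_add)
  \<comment> \<open>Over \<open>X0\<close> the function \<open>H\<close> is the fixed row of
    \<open>W X0\<close> applied to the last two entries, so its derivative in such directions is
    that row.\<close>
  have deriv: "cdot (cgrad H z0) v = ac (W X0) (v$3) (v$4)"
    if v: "v$1 = act1 X0 (v$3) (v$4)" "v$2 = act2 X0 (v$3) (v$4)" for v
  proof -
    have "((\<lambda>t. t * ac (W X0) (v$3) (v$4)) has_field_derivative cdot (cgrad H z0) v) (at 0)"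
      using D[of v] H_line[OF v] by (simp add: ac_lin ac_k0 DERIV_cong_ev)
    moreover have "((\<lambda>t. t * ac (W X0) (v$3) (v$4)) has_field_derivative ac (W X0) (v$3) (v$4)) (at 0)"
      by (auto intro!: derivative_eq_intros)
    ultimately show ?thesis by (rule DERIV_unique)
  qed
  \<comment> \<open>(a', b') lifted to the twistor line over \<open>X0\<close>: the chosen row does
    not vanish on it, so neither does the derivative of \<open>H\<close>.\<close>
  define d :: "complex^4" where "d = vector [act1 X0 a' b', act2 X0 a' b', a', b']"
  have "cdot (cgrad H z0) z0 = 0" using deriv[of z0] X0(1,2) ac_k0 by simp
  moreover have "cdot (cgrad H z0) d \<noteq> 0" using deriv[of d] ac(2) by (simp add: d_def)
  ultimately show ?thesis using that[OF z0U hHU eq] by blast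
qed

lemma complex_surface_twistor_surface: "complex_surface_CP3 (twistor_surface r w)"
  unfolding complex_surface_CP3_def complex_submanifold_def
proof (intro conjI twistor_surface_subset_CP3 ballI)
  fix \<sigma> a assume \<sigma>: "\<sigma> \<in> affine_lifts" and a: "a \<in> {v. vec.span {\<sigma> v} \<in> twistor_surface r w}"
  let ?S = "{v. vec.span {\<sigma> v} \<in> twistor_surface r w}"
  obtain i where i: "\<And>v. \<sigma> v $ i = 1" and h\<sigma>: "\<And>j. holo (\<lambda>v. \<sigma> v $ j) UNIV"
    and line: "\<And>d. d $ i = 0 \<Longrightarrow> \<exists>u. \<forall>v t. \<sigma> (v + t *s u) = \<sigma> v + t *s d"
    using affine_lift_cases[OF \<sigma>] by metis
  have "on_twistor_surface r w (\<sigma> a)" using a by (simp add: span_mem_twistor_surface)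
  then obtain U H d where U: "\<sigma> a \<in> U" "holo H U"
    "\<And>z. z \<in> U \<Longrightarrow> on_twistor_surface r w z \<longleftrightarrow> H z = 0"
    and G: "cdot (cgrad H (\<sigma> a)) (\<sigma> a) = 0" "cdot (cgrad H (\<sigma> a)) d \<noteq> 0"
    using twistor_surface_local_equation[of "\<sigma> a" thesis] by auto
  define O1 where "O1 = \<sigma> -` U"
  have "continuous_on UNIV \<sigma>" by (rule holo_vec_continuous[OF h\<sigma>])
  then have O1: "open O1" unfolding O1_def using holo_open[OF U(2)] by (rule open_vimage[rotated])
  define h where "h v = H (\<sigma> v)" for v
  have hh: "holo h O1"
    unfolding h_def
    by (rule holo_compose_vec[OF holo_subset[OF h\<sigma> O1] U(2)]) (auto simp: O1_def)
  have aO: "a \<in> O1" using U(1) by (simp add: O1_def)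
  have "cgrad h a \<noteq> 0"
  proof
    assume z: "cgrad h a = 0"
    \<comment> \<open>The chart sees only directions with entry 0 at \<open>i\<close>. Subtracting a
      multiple of \<sigma> a achieves this without changing the derivative of \<open>H\<close>,
      which vanishes along \<sigma> a.\<close>
    define d' where "d' = d - d $ i *s \<sigma> a"
    have "d' $ i = 0" by (simp add: d'_def i)
    then obtain u where u: "\<And>v t. \<sigma> (v + t *s u) = \<sigma> v + t *s d'" using line by blast
    have "((\<lambda>t. h (a + t *s u)) has_field_derivative cdot (cgrad h a) u) (at 0)"
      using has_field_derivative_line[of h "cgrad h a" a 0 u] holo_derivative[OF hh aO] by simp
    moreover have "((\<lambda>t. H (\<sigma> a + t *s d')) has_field_derivative cdot (cgrad H (\<sigma> a)) d') (at 0)"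
      using has_field_derivative_line[of H "cgrad H (\<sigma> a)" "\<sigma> a" 0 d'] holo_derivative[OF U(2,1)] by simp
    ultimately have "cdot (cgrad H (\<sigma> a)) d' = cdot (cgrad h a) u"
      unfolding h_def u by (rule DERIV_unique[rotated])
    then show False using G by (simp add: z d'_def cdot_diff)
  qed
  then show "\<exists>U V \<phi> L. a \<in> U \<and> biholomorphism U V \<phi> \<and> vec.subspace L \<and> vec.dim L = 2 \<and>
      \<phi> ` (?S \<inter> U) = V \<inter> L"
    using U(3) by (intro regular_zero_set_chart[OF _ hh aO])
      (auto simp: O1_def h_def span_mem_twistor_surface)
qed

end

theorem proposition3p3:
  fixes \<pi> :: "quat \<Rightarrow> real^3" and o3 o2 :: real
  assumes orientations: "o3 \<in> {1, -1}" "o2 \<in> {1, -1}"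
    and maps: "\<pi> \<in> S3 \<rightarrow> S2"
    and analytic: "real_analytic_on \<pi> S3"
    and conformal: "conformal_submersion \<pi>"
  shows "\<exists>A. complex_surface_CP3 A \<and> Psi o3 o2 \<pi> ` S3 = A \<inter> real_quadric"
proof -
  have "(o2 * o3) * (o2 * o3) = 1" using orientations by auto
  then have "\<forall>p\<in>S3. \<exists>s r w. conformal_chart \<pi> (o2 * o3) p s r w"
    using conformal_chart_exists[OF analytic conformal] by blast
  then obtain s r w where chart: "\<And>p. p \<in> S3 \<Longrightarrow> conformal_chart \<pi> (o2 * o3) p (s p) (r p) (w p)"
    by metis
  show ?thesis
    using complex_surface_twistor_surface[OF orientations conformal chart]
      Psi_image_eq[OF orientations conformal chart] by blast
qed

end
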